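(* Let $n\ge 2$, let $G=\langle g\rangle$ be a cyclic group of order $n$, let $\alpha$ be a unital partial action of $G$ on a commutative ring $S$, and let $S\supseteq R$ be a partial $n$-kummerian extension. Let $\omega\in R$ be an element as in the definition of an $n$-kummerian ring, let $\chi:G\to\langle\omega\rangle$ be the character with $\chi(g)=\omega$, and let $\varphi:Q_{\chi_p}^{\otimes n}\to R$ be an $R$-module isomorphism. Let $I\subseteq\{0,\dots,n-1\}$ be an $n$-saturated set, and let $\lambda_I:S_{Q_{\chi_p},\varphi,I}\to S$ be the $R$-linear map whose restriction to $Q_{\chi_p}^{\otimes i}$, $i\in I$, is $a_1\otimes\cdots\otimes a_i\mapsto a_1\cdots a_i$ (the inclusion $R\subseteq S$ if $i=0$). If $S=\bigoplus_{i\in I}Q_{\chi_p^i}$ (internal direct sum of $R$-submodules), then $\lambda_I$ gives an $I$-graded $R$-algebra isomorphism between $S$ and $S_{Q_{\chi_p},\varphi,I}$. Conversely, if $\lambda_I$ is an $R$-algebra isomorphism, then $S=\bigoplus_{i\in I}Q_{\chi_p^i}$.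
   Context: Partial actions. Let $k$ be a commutative ring and $S$ a commutative unital $k$-algebra. A unital partial action $\alpha$ of a finite group $G$ on $S$ is a family of $k$-algebra isomorphisms $\alpha_g:S_{g^{-1}}\to S_g$ ($g\in G$), where each $S_g$ is an ideal of $S$ having an identity element $1_g$, such that (i) $S_1=S$ and $\alpha_1=\mathrm{id}_S$; (ii) $\alpha_g(S_{g^{-1}}\cap S_h)=S_g\cap S_{gh}$ for all $g,h\in G$; (iii) $\alpha_g(\alpha_h(x))=\alpha_{gh}(x)$ for all $g,h\in G$, $x\in S_{h^{-1}}\cap S_{(gh)^{-1}}$. Put $S^\alpha=\{a\in S:\alpha_g(a1_{g^{-1}})=a1_g\ \forall g\in G\}$. For a subring $R\subseteq S$ with $1_R=1_S$, $S\supseteq R$ is a partial Galois extension (with group $G$) if $R=S^\alpha$ and there are $l\in\mathbb N$ and $x_i,y_i\in S$ ($1\le i\le l$) with $\sum_{i=1}^l x_i\alpha_g(y_i1_{g^{-1}})=\delta_{1,g}$ for all $g\in G$. For $n\ge2$, a commutative ring $R$ is $n$-kummerian if there is $\omega\in\mathcal U(R)$ (the group of invertible elements of $R$) with $\omega^n=1$ and $1-\omega^i\in\mathcal U(R)$ for $1\le i\le n-1$. A partial Galois extension $S\supseteq R$ with group $G$ is partial $n$-kummerian if $G$ is abelian of order $n$ and $R$ is $n$-kummerian. A character of $G$ is a group homomorphism $G\to\langle\omega\rangle$. For $0\le i\le n-1$, $\chi_p^i:G\to S$ is $\chi_p^i(h)=\chi(h)^i1_h$ (with $\chi_p=\chi_p^1$),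 and $Q_{\chi_p^i}=\{a\in S:\alpha_h(a1_{h^{-1}})=\chi_p^i(h)a\ \forall h\in G\}$, an $R$-submodule of $S$. Radical extensions. All tensor products are over $R$. For an $R$-module $Q\neq 0$ put $Q^{\otimes 0}=R$ and $Q^{\otimes i}=Q\otimes\cdots\otimes Q$ ($i$ factors). Given $m\in\mathbb N$ and an $R$-module homomorphism $\varphi:Q^{\otimes m}\to R$, let $S_{Q,\varphi}=\bigoplus_{i=0}^{m-1}Q^{\otimes i}$. Define an $R$-linear map $\tilde\varphi:\bigoplus_{i\ge0}Q^{\otimes i}\to S_{Q,\varphi}$ recursively by $\tilde\varphi(x)=x$ for $x\in Q^{\otimes i}$, $0\le i\le m-1$, and $\tilde\varphi(a_1\otimes\cdots\otimes a_i)=\tilde\varphi\big(\varphi(a_1\otimes\cdots\otimes a_m)\,a_{m+1}\otimes\cdots\otimes a_i\big)$ for $i\ge m$ (for $i=m$ this is $\varphi(a_1\otimes\cdots\otimes a_m)\in R$). The product on $S_{Q,\varphi}$ is $x\bullet y=\tilde\varphi(x\otimes y)$; with it $S_{Q,\varphi}$ is called a radical extension of $R$. For $I\subseteq\{0,\dots,m-1\}$ the $I$-radical extension is the $R$-submodule $S_{Q,\varphi,I}=\bigoplus_{i\in I}Q^{\otimes i}$ of $S_{Q,\varphi}$. The set $I$ is $m$-saturated if it is closed under addition modulo $m$, i.e. if, viewed as a subset of the cyclic group $C_m$, it is a subgroup. Here $m=n$ and $Q=Q_{\chi_p}$; for $n$-saturated $I$, $S_{Q_{\chi_p},\varphi,I}$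 is a commutative $R$-subalgebra of $S_{Q_{\chi_p},\varphi}$, graded by the group $I$ with components $Q_{\chi_p}^{\otimes i}$; the grading on $S=\bigoplus_{i\in I}Q_{\chi_p^i}$ is the one with components $Q_{\chi_p^i}$, $i\in I$.
   Formalization: That λ_I is an R-algebra map is proved when I={0} or φ(a_1⊗…⊗a_n)=a_1⋯a_n; for arbitrary φ it fails (S=ℚ×ℚ with swap, φ(x⊗x)=2, x=(1,−1)). The graded R-module isomorphism and the converse are for every φ. *)

theory Defs
  imports "HOL-Algebra.Algebra"
begin

section \<open>Partial actions, partial Galois and partial Kummerian extensions\<close>

text \<open>
  The ideal $S_h$ is \<open>D h\<close> and its identity element $1_h$ is \<open>e h\<close>.  The \<open>k\<close>-algebra
  isomorphism $\alpha_h : S_{h^{-1}} \to S_h$ is \<open>\<alpha> h\<close>; its values outside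
  $S_{h^{-1}}$ are irrelevant.
\<close>

locale unital_partial_action = algebra k S + group G
  for k :: "('k, 'z) ring_scheme" (structure)
    and S :: "('k, 's) module" (structure)
    and G :: "('g, 'y) monoid_scheme" (structure) +
  fixes D :: "'g \<Rightarrow> 's set" and e :: "'g \<Rightarrow> 's" and \<alpha> :: "'g \<Rightarrow> 's \<Rightarrow> 's"
  assumes finite_group: "finite (carrier G)"
    and ideal_D: "\<And>h. h \<in> carrier G \<Longrightarrow> ideal (D h) S"
    and e_in: "\<And>h. h \<in> carrier G \<Longrightarrow> e h \<in> D h"
    and e_unit: "\<And>h x. h \<in> carrier G \<Longrightarrow> x \<in> D h \<Longrightarrow> e h \<otimes>\<^bsub>S\<^esub> x = x"
    and \<alpha>_ring_iso: "\<And>h. h \<in> carrier G \<Longrightarrow>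
        \<alpha> h \<in> ring_iso (S\<lparr>carrier := D (inv\<^bsub>G\<^esub> h), one := e (inv\<^bsub>G\<^esub> h)\<rparr>)
                       (S\<lparr>carrier := D h, one := e h\<rparr>)"
    and \<alpha>_smult: "\<And>h c x. h \<in> carrier G \<Longrightarrow> c \<in> carrier k \<Longrightarrow> x \<in> D (inv\<^bsub>G\<^esub> h) \<Longrightarrow>
        \<alpha> h (c \<odot>\<^bsub>S\<^esub> x) = c \<odot>\<^bsub>S\<^esub> \<alpha> h x"
    and D_one: "D \<one>\<^bsub>G\<^esub> = carrier S"
    and \<alpha>_one: "\<And>x. x \<in> carrier S \<Longrightarrow> \<alpha> \<one>\<^bsub>G\<^esub> x = x"
    and \<alpha>_image: "\<And>h h'. h \<in> carrier G \<Longrightarrow> h' \<in> carrier G \<Longrightarrow>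
        \<alpha> h ` (D (inv\<^bsub>G\<^esub> h) \<inter> D h') = D h \<inter> D (h \<otimes>\<^bsub>G\<^esub> h')"
    and \<alpha>_comp: "\<And>h h' x. h \<in> carrier G \<Longrightarrow> h' \<in> carrier G \<Longrightarrow>
        x \<in> D (inv\<^bsub>G\<^esub> h') \<inter> D (inv\<^bsub>G\<^esub> (h \<otimes>\<^bsub>G\<^esub> h')) \<Longrightarrow>
        \<alpha> h (\<alpha> h' x) = \<alpha> (h \<otimes>\<^bsub>G\<^esub> h') x"

definition partial_invariants ::
  "('s, 'z) ring_scheme \<Rightarrow> ('g, 'y) monoid_scheme \<Rightarrow> ('g \<Rightarrow> 's) \<Rightarrow> ('g \<Rightarrow> 's \<Rightarrow> 's) \<Rightarrow> 's set"
  where "partial_invariants S G e \<alpha> =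
    {a \<in> carrier S. \<forall>h\<in>carrier G. \<alpha> h (a \<otimes>\<^bsub>S\<^esub> e (inv\<^bsub>G\<^esub> h)) = a \<otimes>\<^bsub>S\<^esub> e h}"

definition partial_galois_extension ::
  "('k, 'z) ring_scheme \<Rightarrow> ('k, 's) module \<Rightarrow> ('g, 'y) monoid_scheme \<Rightarrow> ('g \<Rightarrow> 's set) \<Rightarrow>
   ('g \<Rightarrow> 's) \<Rightarrow> ('g \<Rightarrow> 's \<Rightarrow> 's) \<Rightarrow> 's set \<Rightarrow> bool"
  where "partial_galois_extension k S G D e \<alpha> R \<longleftrightarrow>
    unital_partial_action k S G D e \<alpha> \<and> subring R S \<and> R = partial_invariants S G e \<alpha> \<and>
    (\<exists>(l::nat) x y. x \<in> {1..l} \<rightarrow> carrier S \<and> y \<in> {1..l} \<rightarrow> carrier S \<and>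
      (\<forall>h\<in>carrier G. (\<Oplus>\<^bsub>S\<^esub>i\<in>{1..l}. x i \<otimes>\<^bsub>S\<^esub> \<alpha> h (y i \<otimes>\<^bsub>S\<^esub> e (inv\<^bsub>G\<^esub> h)))
        = (if h = \<one>\<^bsub>G\<^esub> then \<one>\<^bsub>S\<^esub> else \<zero>\<^bsub>S\<^esub>)))"

definition kummerian_root :: "('r, 'z) ring_scheme \<Rightarrow> nat \<Rightarrow> 'r \<Rightarrow> bool"
  where "kummerian_root R n \<omega> \<longleftrightarrow>
    \<omega> \<in> Units R \<and> \<omega> [^]\<^bsub>R\<^esub> n = \<one>\<^bsub>R\<^esub> \<and> (\<forall>i\<in>{1..n - 1}. \<one>\<^bsub>R\<^esub> \<ominus>\<^bsub>R\<^esub> \<omega> [^]\<^bsub>R\<^esub> i \<in> Units R)"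

definition kummerian_ring :: "('r, 'z) ring_scheme \<Rightarrow> nat \<Rightarrow> bool"
  where "kummerian_ring R n \<longleftrightarrow> cring R \<and> n \<ge> 2 \<and> (\<exists>\<omega>. kummerian_root R n \<omega>)"

definition partial_kummerian_extension ::
  "nat \<Rightarrow> ('k, 'z) ring_scheme \<Rightarrow> ('k, 's) module \<Rightarrow> ('g, 'y) monoid_scheme \<Rightarrow> ('g \<Rightarrow> 's set) \<Rightarrow>
   ('g \<Rightarrow> 's) \<Rightarrow> ('g \<Rightarrow> 's \<Rightarrow> 's) \<Rightarrow> 's set \<Rightarrow> bool"
  where "partial_kummerian_extension n k S G D e \<alpha> R \<longleftrightarrow>
    partial_galois_extension k S G D e \<alpha> R \<and> comm_group G \<and> order G = n \<and>
    kummerian_ring (S\<lparr>carrier := R\<rparr>) n"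

text \<open>Homomorphisms from \<open>G\<close> to the subgroup generated by \<open>\<omega>\<close> of the unit group of \<open>R\<close>.\<close>

definition characters :: "('g, 'y) monoid_scheme \<Rightarrow> ('r, 'z) ring_scheme \<Rightarrow> 'r \<Rightarrow> ('g \<Rightarrow> 'r) set"
  where "characters G R \<omega> = hom G (subgroup_generated (units_of R) {\<omega>})"

definition partial_char :: "('s, 'z) ring_scheme \<Rightarrow> ('g \<Rightarrow> 's) \<Rightarrow> ('g \<Rightarrow> 's) \<Rightarrow> nat \<Rightarrow> 'g \<Rightarrow> 's"
  where "partial_char S e \<chi> i h = \<chi> h [^]\<^bsub>S\<^esub> i \<otimes>\<^bsub>S\<^esub> e h"

definition char_component ::
  "('s, 'z) ring_scheme \<Rightarrow> ('g, 'y) monoid_scheme \<Rightarrow> ('g \<Rightarrow> 's) \<Rightarrow> ('g \<Rightarrow> 's \<Rightarrow> 's) \<Rightarrow>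
   ('g \<Rightarrow> 's) \<Rightarrow> nat \<Rightarrow> 's set"
  where "char_component S G e \<alpha> \<chi> i =
    {a \<in> carrier S. \<forall>h\<in>carrier G. \<alpha> h (a \<otimes>\<^bsub>S\<^esub> e (inv\<^bsub>G\<^esub> h)) = partial_char S e \<chi> i h \<otimes>\<^bsub>S\<^esub> a}"


section \<open>Modules\<close>

text \<open>
  The library has no unbundled module records: a \<^typ>\<open>('r, 'm) module\<close> also carries a
  multiplication and a unit, which the locale \<^locale>\<open>module\<close> ignores.  They are left
  \<^term>\<open>undefined\<close> in the constructions below unless the object is meant as an algebra.
\<close>

text \<open>A subset \<open>Q\<close> of the ring \<open>S\<close> with scalars acting by multiplication in \<open>S\<close>.  For a subring
  \<open>R\<close>, this turns \<open>R\<close> and \<open>S\<close> into \<open>R\<close>-algebras and an \<open>R\<close>-submodule \<open>Q\<close> of \<open>S\<close> into an \<open>R\<close>-module.\<close>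

definition mult_module :: "('s, 'z) ring_scheme \<Rightarrow> 's set \<Rightarrow> ('s, 's) module"
  where "mult_module S Q = \<lparr>carrier = Q, monoid.mult = monoid.mult S, one = one S,
    ring.zero = ring.zero S, add = add S, smult = monoid.mult S\<rparr>"

definition module_iso :: "('r, 'z) ring_scheme \<Rightarrow> ('r, 'm) module \<Rightarrow> ('r, 'n) module \<Rightarrow> ('m \<Rightarrow> 'n) set"
  where "module_iso R M N = {f. bij_betw f (carrier M) (carrier N) \<and>
    (\<forall>x\<in>carrier M. \<forall>y\<in>carrier M. f (x \<oplus>\<^bsub>M\<^esub> y) = f x \<oplus>\<^bsub>N\<^esub> f y) \<and>
    (\<forall>r\<in>carrier R. \<forall>x\<in>carrier M. f (r \<odot>\<^bsub>M\<^esub> x) = r \<odot>\<^bsub>N\<^esub> f x)}"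

definition algebra_iso :: "('r, 'z) ring_scheme \<Rightarrow> ('r, 'm) module \<Rightarrow> ('r, 'n) module \<Rightarrow> ('m \<Rightarrow> 'n) set"
  where "algebra_iso R A B = ring_iso A B \<inter> module_iso R A B"

definition internal_direct_sum ::
  "('r, 'z) ring_scheme \<Rightarrow> ('r, 'm) module \<Rightarrow> 'i set \<Rightarrow> ('i \<Rightarrow> 'm set) \<Rightarrow> bool"
  where "internal_direct_sum R M I N \<longleftrightarrow> finite I \<and> (\<forall>i\<in>I. submodule (N i) R M) \<and>
    (\<forall>x\<in>carrier M. \<exists>!a. a \<in> (\<Pi>\<^sub>E i\<in>I. N i) \<and> x = (\<Oplus>\<^bsub>M\<^esub>i\<in>I. a i))"

definition free_module :: "('r, 'z) ring_scheme \<Rightarrow> 'x set \<Rightarrow> ('r, 'x \<Rightarrow> 'r) module"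
  where "free_module R B = \<lparr>
    carrier = {f. (\<forall>x\<in>B. f x \<in> carrier R) \<and> (\<forall>x. x \<notin> B \<longrightarrow> f x = \<zero>\<^bsub>R\<^esub>) \<and> finite {x. f x \<noteq> \<zero>\<^bsub>R\<^esub>}},
    monoid.mult = undefined, one = undefined,
    ring.zero = (\<lambda>x. \<zero>\<^bsub>R\<^esub>), add = (\<lambda>f g x. f x \<oplus>\<^bsub>R\<^esub> g x), smult = (\<lambda>r f x. r \<otimes>\<^bsub>R\<^esub> f x)\<rparr>"

definition basis_vec :: "('r, 'z) ring_scheme \<Rightarrow> 'x \<Rightarrow> 'x \<Rightarrow> 'r"
  where "basis_vec R x = (\<lambda>y. if y = x then \<one>\<^bsub>R\<^esub> else \<zero>\<^bsub>R\<^esub>)"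

definition span_submodule :: "('r, 'z) ring_scheme \<Rightarrow> ('r, 'm) module \<Rightarrow> 'm set \<Rightarrow> 'm set"
  where "span_submodule R M B = \<Inter>{N. submodule N R M \<and> B \<subseteq> N}"

definition quotient_module :: "('r, 'm) module \<Rightarrow> 'm set \<Rightarrow> ('r, 'm set) module"
  where "quotient_module M N = \<lparr>carrier = a_rcosets\<^bsub>M\<^esub> N,
    monoid.mult = undefined, one = undefined,
    ring.zero = N, add = set_add M, smult = (\<lambda>r A. \<Union>x\<in>A. N +>\<^bsub>M\<^esub> (r \<odot>\<^bsub>M\<^esub> x))\<rparr>"

text \<open>Families of finite support, extended by zero outside \<open>I\<close>; hence \<^term>\<open>direct_sum T I\<close>
  is a submodule of \<^term>\<open>direct_sum T UNIV\<close>.\<close>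

definition direct_sum :: "('i \<Rightarrow> ('r, 'm) module) \<Rightarrow> 'i set \<Rightarrow> ('r, 'i \<Rightarrow> 'm) module"
  where "direct_sum T I = \<lparr>
    carrier = {x. (\<forall>i\<in>I. x i \<in> carrier (T i)) \<and> (\<forall>i. i \<notin> I \<longrightarrow> x i = \<zero>\<^bsub>T i\<^esub>) \<and>
                  finite {i. x i \<noteq> \<zero>\<^bsub>T i\<^esub>}},
    monoid.mult = undefined, one = undefined,
    ring.zero = (\<lambda>i. \<zero>\<^bsub>T i\<^esub>), add = (\<lambda>x y i. x i \<oplus>\<^bsub>T i\<^esub> y i), smult = (\<lambda>r x i. r \<odot>\<^bsub>T i\<^esub> x i)\<rparr>"

definition ds_inj :: "('i \<Rightarrow> ('r, 'm) module) \<Rightarrow> 'i \<Rightarrow> 'm \<Rightarrow> 'i \<Rightarrow> 'm"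
  where "ds_inj T i a = (\<lambda>j. if j = i then a else \<zero>\<^bsub>T j\<^esub>)"


section \<open>Tensor powers over a commutative ring\<close>

text \<open>
  $M^{\otimes i}$ is the free \<open>R\<close>-module on the lists of length \<open>i\<close> over \<open>M\<close>, modulo the relations
  of multilinearity.  For \<open>i = 0\<close> there are no relations and the only basis element is the empty
  list, so that this is the free module of rank one, i.e. \<open>R\<close> up to the canonical identification of
  \<open>r\<close> with \<open>r\<close> times the empty tensor.
\<close>

definition tensor_words :: "('r, 'm) module \<Rightarrow> nat \<Rightarrow> 'm list set"
  where "tensor_words M i = {as. length as = i \<and> set as \<subseteq> carrier M}"

definition tensor_free :: "('r, 'z) ring_scheme \<Rightarrow> ('r, 'm) module \<Rightarrow> nat \<Rightarrow> ('r, 'm list \<Rightarrow> 'r) module"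
  where "tensor_free R M i = free_module R (tensor_words M i)"

inductive_set tensor_relations ::
  "('r, 'z) ring_scheme \<Rightarrow> ('r, 'm) module \<Rightarrow> nat \<Rightarrow> ('m list \<Rightarrow> 'r) set"
  for R :: "('r, 'z) ring_scheme" and M :: "('r, 'm) module" and i :: nat
  where
    additive: "us @ x # vs \<in> tensor_words M i \<Longrightarrow> y \<in> carrier M \<Longrightarrow>
      basis_vec R (us @ (x \<oplus>\<^bsub>M\<^esub> y) # vs) \<ominus>\<^bsub>tensor_free R M i\<^esub>
        (basis_vec R (us @ x # vs) \<oplus>\<^bsub>tensor_free R M i\<^esub> basis_vec R (us @ y # vs))
      \<in> tensor_relations R M i"
  | homogeneous: "us @ x # vs \<in> tensor_words M i \<Longrightarrow> r \<in> carrier R \<Longrightarrow>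
      basis_vec R (us @ (r \<odot>\<^bsub>M\<^esub> x) # vs) \<ominus>\<^bsub>tensor_free R M i\<^esub>
        (r \<odot>\<^bsub>tensor_free R M i\<^esub> basis_vec R (us @ x # vs))
      \<in> tensor_relations R M i"

definition tensor_null :: "('r, 'z) ring_scheme \<Rightarrow> ('r, 'm) module \<Rightarrow> nat \<Rightarrow> ('m list \<Rightarrow> 'r) set"
  where "tensor_null R M i = span_submodule R (tensor_free R M i) (tensor_relations R M i)"

definition tensor_power ::
  "('r, 'z) ring_scheme \<Rightarrow> ('r, 'm) module \<Rightarrow> nat \<Rightarrow> ('r, ('m list \<Rightarrow> 'r) set) module"
  where "tensor_power R M i = quotient_module (tensor_free R M i) (tensor_null R M i)"

definition pure_tensor :: "('r, 'z) ring_scheme \<Rightarrow> ('r, 'm) module \<Rightarrow> 'm list \<Rightarrow> ('m list \<Rightarrow> 'r) set"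
  where "pure_tensor R M as =
    tensor_null R M (length as) +>\<^bsub>tensor_free R M (length as)\<^esub> basis_vec R as"

text \<open>
  If \<open>u\<close> is multilinear on the words of length \<open>i\<close>, then \<open>tensor_lift R N u\<close> is the \<open>R\<close>-linear map
  from $M^{\otimes i}$ to \<open>N\<close> that sends the pure tensor of \<open>as\<close> to \<open>u as\<close>; by multilinearity the
  value does not depend on the chosen representative \<open>f\<close>.
\<close>

definition tensor_lift ::
  "('r, 'z) ring_scheme \<Rightarrow> ('r, 'n) module \<Rightarrow> ('m list \<Rightarrow> 'n) \<Rightarrow> ('m list \<Rightarrow> 'r) set \<Rightarrow> 'n"
  where "tensor_lift R N u A =
    (let f = (SOME f. f \<in> A) in \<Oplus>\<^bsub>N\<^esub>as\<in>{as. f as \<noteq> \<zero>\<^bsub>R\<^esub>}. f as \<odot>\<^bsub>N\<^esub> u as)"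

text \<open>The product $M^{\otimes i} \times M^{\otimes j} \to M^{\otimes (i+j)}$, induced by
  concatenation of words.\<close>

definition tensor_mult ::
  "('r, 'z) ring_scheme \<Rightarrow> ('r, 'm) module \<Rightarrow> nat \<Rightarrow> nat \<Rightarrow>
   ('m list \<Rightarrow> 'r) set \<Rightarrow> ('m list \<Rightarrow> 'r) set \<Rightarrow> ('m list \<Rightarrow> 'r) set"
  where "tensor_mult R M i j A B = (\<Union>f\<in>A. \<Union>g\<in>B.
    tensor_null R M (i + j) +>\<^bsub>tensor_free R M (i + j)\<^esub>
      (\<lambda>as. f (take i as) \<otimes>\<^bsub>R\<^esub> g (drop i as)))"

text \<open>The product $x \otimes y$ of the tensor algebra $\bigoplus_{i \ge 0} M^{\otimes i}$.\<close>

definition tensor_algebra_mult ::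
  "('r, 'z) ring_scheme \<Rightarrow> ('r, 'm) module \<Rightarrow>
   (nat \<Rightarrow> ('m list \<Rightarrow> 'r) set) \<Rightarrow> (nat \<Rightarrow> ('m list \<Rightarrow> 'r) set) \<Rightarrow> nat \<Rightarrow> ('m list \<Rightarrow> 'r) set"
  where "tensor_algebra_mult R M x y = (\<lambda>l. \<Oplus>\<^bsub>tensor_power R M l\<^esub>i\<in>{..l}.
    tensor_mult R M i (l - i) (x i) (y (l - i)))"


section \<open>Radical extensions\<close>

text \<open>The \<open>R\<close>-linear map $M^{\otimes i} \to M^{\otimes (i-m)}$ for $i \ge m$ with
  $a_1 \otimes \cdots \otimes a_i \mapsto \varphi(a_1 \otimes \cdots \otimes a_m)\,
  a_{m+1} \otimes \cdots \otimes a_i$.\<close>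

definition contract ::
  "('r, 'z) ring_scheme \<Rightarrow> ('r, 'm) module \<Rightarrow> nat \<Rightarrow> (('m list \<Rightarrow> 'r) set \<Rightarrow> 'r) \<Rightarrow> nat \<Rightarrow>
   ('m list \<Rightarrow> 'r) set \<Rightarrow> ('m list \<Rightarrow> 'r) set"
  where "contract R M m \<phi> i = tensor_lift R (tensor_power R M (i - m))
    (\<lambda>as. \<phi> (pure_tensor R M (take m as)) \<odot>\<^bsub>tensor_power R M (i - m)\<^esub> pure_tensor R M (drop m as))"

text \<open>The restriction of $\tilde\varphi$ to $M^{\otimes i}$.  The case \<open>m = 0\<close> is excluded from the
  recursion only for termination.\<close>

function reduce ::
  "('r, 'z) ring_scheme \<Rightarrow> ('r, 'm) module \<Rightarrow> nat \<Rightarrow> (('m list \<Rightarrow> 'r) set \<Rightarrow> 'r) \<Rightarrow> nat \<Rightarrow>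
   ('m list \<Rightarrow> 'r) set \<Rightarrow> nat \<Rightarrow> ('m list \<Rightarrow> 'r) set"
  where "reduce R M m \<phi> i a =
    (if i < m \<or> m = 0 then ds_inj (tensor_power R M) i a
     else reduce R M m \<phi> (i - m) (contract R M m \<phi> i a))"
  by pat_completeness auto
termination
  by (relation "Wellfounded.measure (\<lambda>(R, M, m, \<phi>, i, a). i)") auto

declare reduce.simps [simp del]

definition phi_tilde ::
  "('r, 'z) ring_scheme \<Rightarrow> ('r, 'm) module \<Rightarrow> nat \<Rightarrow> (('m list \<Rightarrow> 'r) set \<Rightarrow> 'r) \<Rightarrow>
   (nat \<Rightarrow> ('m list \<Rightarrow> 'r) set) \<Rightarrow> nat \<Rightarrow> ('m list \<Rightarrow> 'r) set"
  where "phi_tilde R M m \<phi> x =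
    (\<Oplus>\<^bsub>direct_sum (tensor_power R M) {..<m}\<^esub>i\<in>{i. x i \<noteq> \<zero>\<^bsub>tensor_power R M i\<^esub>}. reduce R M m \<phi> i (x i))"

text \<open>$S_{M,\varphi,I}$; the full radical extension $S_{M,\varphi}$ is the case \<open>I = {..<m}\<close>.\<close>

definition radical_extension ::
  "('r, 'z) ring_scheme \<Rightarrow> ('r, 'm) module \<Rightarrow> nat \<Rightarrow> (('m list \<Rightarrow> 'r) set \<Rightarrow> 'r) \<Rightarrow> nat set \<Rightarrow>
   ('r, nat \<Rightarrow> ('m list \<Rightarrow> 'r) set) module"
  where "radical_extension R M m \<phi> I = (direct_sum (tensor_power R M) I)
    \<lparr>monoid.mult := \<lambda>x y. phi_tilde R M m \<phi> (tensor_algebra_mult R M x y),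
     one := ds_inj (tensor_power R M) 0 (pure_tensor R M [])\<rparr>"

text \<open>Being a subgroup forces \<open>0 \<in> I\<close>: the empty set, although closed under addition, is excluded.\<close>

definition saturated :: "nat \<Rightarrow> nat set \<Rightarrow> bool"
  where "saturated m I \<longleftrightarrow> I \<subseteq> {..<m} \<and> subgroup (int ` I) (integer_mod_group m)"

definition list_prod :: "('s, 'z) monoid_scheme \<Rightarrow> 's list \<Rightarrow> 's"
  where "list_prod S as = foldr (\<otimes>\<^bsub>S\<^esub>) as \<one>\<^bsub>S\<^esub>"

text \<open>The \<open>R\<close>-linear map $a_1 \otimes \cdots \otimes a_i \mapsto a_1 \cdots a_i$ from the tensor powers
  of an \<open>R\<close>-submodule of \<open>S\<close> to \<open>S\<close>, and the map it induces on the sum over \<open>I\<close>.\<close>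

definition mult_map :: "('s, 'z) ring_scheme \<Rightarrow> 's set \<Rightarrow> ('s list \<Rightarrow> 's) set \<Rightarrow> 's"
  where "mult_map S R =
    tensor_lift (S\<lparr>carrier := R\<rparr>) (mult_module S (carrier S)) (list_prod S)"

definition lambda_map :: "('s, 'z) ring_scheme \<Rightarrow> 's set \<Rightarrow> nat set \<Rightarrow> (nat \<Rightarrow> ('s list \<Rightarrow> 's) set) \<Rightarrow> 's"
  where "lambda_map S R I x = (\<Oplus>\<^bsub>S\<^esub>i\<in>I. mult_map S R (x i))"

text \<open>A map from \<open>direct_sum T I\<close> to \<open>B\<close> is compatible with the gradings if it carries the
  component \<open>T i\<close> onto \<open>N i\<close>.\<close>

definition graded_map ::
  "('i \<Rightarrow> ('r, 'm) module) \<Rightarrow> 'i set \<Rightarrow> ('i \<Rightarrow> 'n set) \<Rightarrow> (('i \<Rightarrow> 'm) \<Rightarrow> 'n) \<Rightarrow> bool"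
  where "graded_map T I N f \<longleftrightarrow> (\<forall>i\<in>I. f ` (ds_inj T i ` carrier (T i)) = N i)"

end

theory Submission
  imports Defs
begin

text \<open>
  Write $\beta_h(x) = \alpha_h(x 1_{h^{-1}})$ and let $t = \sum_h \beta_h$ be the trace, with values in
  $R = S^\alpha$.  Everything rests on one consequence of the Galois condition: $Q_1 = Q_{\chi_p}$ is
  invertible inside \<open>S\<close>, that is, there are $a_s \in Q_1$ and $b_s \in Q_{\chi^{-1}}$ with
  $\sum_s a_s b_s = 1$ (\<open>component_dual\<close>).

  The Galois coordinates satisfy $s = \sum_i x_i\, t(y_i s)$ for all $s \in S$.  So \<open>S\<close> is a finitely
  generated module over \<open>R\<close> with $S = t(S) S$, and since it contains \<open>1\<close>, Nakayama's lemma puts \<open>1\<close>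
  into the ideal $t(S)$ of \<open>R\<close> (\<open>nakayama_unit\<close>, \<open>trace_one\<close>).  If $t(c) = 1$, then the character sums
  $a_i = \sum_h \chi(h)^{-1} \beta_h(c x_i)$ and $b_i = \sum_h \chi(h) \beta_h(y_i)$ are as wanted: because
  $b_i$ is an eigenvector, $a_i b_i = t(c x_i b_i)$, and $\sum_i x_i b_i = 1$.

  Since $b_s Q_{i+1} \subseteq Q_i$, the elements $b_s$ give maps $Q_1^{\otimes (i+1)} \to Q_1^{\otimes i}$,
  $u_1 \otimes u_2 \otimes \cdots \mapsto (b_s u_1) u_2 \otimes \cdots$, and
  $z = \sum_s a_s \otimes (b_s z)$ for every tensor \<open>z\<close>, because the factors $b_s u_1 \in R$ may be moved.
  By induction on \<open>i\<close> the multiplication map $Q_1^{\otimes i} \to Q_i$ is bijective (\<open>mult_map_bij\<close>).  Hence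
  $\lambda_I$ is a bijection onto the product of the $Q_i$, $i \in I$, followed by summation in \<open>S\<close>; so it
  is bijective exactly if \<open>S\<close> is the internal direct sum of these $Q_i$ (\<open>lambda_map_bij_iff\<close>).  This
  gives the graded module isomorphism and the converse.

  For the products (\<open>lambda_map_ring_hom\<close>), $\lambda$ applied to the tensor algebra is
  multiplicative, and the only question is whether $\tilde\varphi$ preserves its values.  It does if
  $\varphi$ is given by multiplication in \<open>S\<close>, since then contracting $n$ factors does not change the
  product of all factors; and for $I = \{0\}$ only tensors of degree \<open>0\<close> occur, which are never contracted.

  Tensor powers are quotients of free modules on words.  Linear maps on them come from multilinear maps
  on words (\<open>tensor_lift_linear\<close>, \<open>tensor_lift_pure\<close>) and are determined by their values on pure tensors
  (\<open>tensor_power_linear_eq\<close>); all statements about tensors above are checked in this way.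
\<close>

section \<open>Linear maps and submodules\<close>

definition linear_map :: "('r, 'z) ring_scheme \<Rightarrow> ('r, 'm) module \<Rightarrow> ('r, 'n) module \<Rightarrow> ('m \<Rightarrow> 'n) set"
  where "linear_map R M N = {f \<in> carrier M \<rightarrow> carrier N.
    (\<forall>x\<in>carrier M. \<forall>y\<in>carrier M. f (x \<oplus>\<^bsub>M\<^esub> y) = f x \<oplus>\<^bsub>N\<^esub> f y) \<and>
    (\<forall>r\<in>carrier R. \<forall>x\<in>carrier M. f (r \<odot>\<^bsub>M\<^esub> x) = r \<odot>\<^bsub>N\<^esub> f x)}"

lemma linear_mapI:
  assumes "\<And>x. x \<in> carrier M \<Longrightarrow> f x \<in> carrier N"
    and "\<And>x y. x \<in> carrier M \<Longrightarrow> y \<in> carrier M \<Longrightarrow> f (x \<oplus>\<^bsub>M\<^esub> y) = f x \<oplus>\<^bsub>N\<^esub> f y"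
    and "\<And>r x. r \<in> carrier R \<Longrightarrow> x \<in> carrier M \<Longrightarrow> f (r \<odot>\<^bsub>M\<^esub> x) = r \<odot>\<^bsub>N\<^esub> f x"
  shows "f \<in> linear_map R M N"
  using assms by (auto simp: linear_map_def)

lemma linear_mapD:
  assumes "f \<in> linear_map R M N"
  shows "\<And>x. x \<in> carrier M \<Longrightarrow> f x \<in> carrier N"
    and "\<And>x y. x \<in> carrier M \<Longrightarrow> y \<in> carrier M \<Longrightarrow> f (x \<oplus>\<^bsub>M\<^esub> y) = f x \<oplus>\<^bsub>N\<^esub> f y"
    and "\<And>r x. r \<in> carrier R \<Longrightarrow> x \<in> carrier M \<Longrightarrow> f (r \<odot>\<^bsub>M\<^esub> x) = r \<odot>\<^bsub>N\<^esub> f x"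
  using assms by (auto simp: linear_map_def)

lemma linear_map_comp:
  assumes "f \<in> linear_map R L M" "h \<in> linear_map R M N"
  shows "(\<lambda>x. h (f x)) \<in> linear_map R L N"
  using assms by (auto simp: linear_map_def Pi_def)

lemma linear_map_zero:
  assumes "module R M" "module R N" "f \<in> linear_map R M N"
  shows "f \<zero>\<^bsub>M\<^esub> = \<zero>\<^bsub>N\<^esub>"
proof -
  interpret M: module R M by fact
  interpret N: module R N by fact
  have "f (\<zero>\<^bsub>R\<^esub> \<odot>\<^bsub>M\<^esub> \<zero>\<^bsub>M\<^esub>) = \<zero>\<^bsub>R\<^esub> \<odot>\<^bsub>N\<^esub> f \<zero>\<^bsub>M\<^esub>"
    by (rule linear_mapD(3)[OF assms(3)]) auto
  then show ?thesis using linear_mapD(1)[OF assms(3), of "\<zero>\<^bsub>M\<^esub>"] by simp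
qed

lemma linear_map_minus:
  assumes "module R M" "module R N" "f \<in> linear_map R M N" "x \<in> carrier M" "y \<in> carrier M"
  shows "f (x \<ominus>\<^bsub>M\<^esub> y) = f x \<ominus>\<^bsub>N\<^esub> f y"
proof -
  interpret M: module R M by fact
  interpret N: module R N by fact
  note f = linear_mapD[OF assms(3)]
  have "f (\<ominus>\<^bsub>R\<^esub> \<one>\<^bsub>R\<^esub> \<odot>\<^bsub>M\<^esub> y) = \<ominus>\<^bsub>R\<^esub> \<one>\<^bsub>R\<^esub> \<odot>\<^bsub>N\<^esub> f y" by (rule f(3)) (use assms in auto)
  then have "f (\<ominus>\<^bsub>M\<^esub> y) = \<ominus>\<^bsub>N\<^esub> f y"
    using assms f(1) by (simp add: M.smult_l_minus N.smult_l_minus)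
  then show ?thesis using assms f(2) by (simp add: a_minus_def)
qed

lemma linear_map_finsum:
  assumes "module R M" "module R N" "f \<in> linear_map R M N" "finite A" "u \<in> A \<rightarrow> carrier M"
  shows "f (\<Oplus>\<^bsub>M\<^esub>i\<in>A. u i) = (\<Oplus>\<^bsub>N\<^esub>i\<in>A. f (u i))"
proof -
  interpret M: module R M by fact
  interpret N: module R N by fact
  note f = linear_mapD[OF assms(3)]
  show ?thesis using assms(4,5)
  proof induction
    case empty then show ?case by (simp add: linear_map_zero[OF assms(1-3)])
  next
    case (insert x F)
    then show ?case by (simp add: f Pi_def)
  qed
qed

lemma linear_map_sum:
  assumes "module R M" "module R N" "finite A" "\<And>i. i \<in> A \<Longrightarrow> f i \<in> linear_map R M N"
  shows "(\<lambda>x. \<Oplus>\<^bsub>N\<^esub>i\<in>A. f i x) \<in> linear_map R M N"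
proof (rule linear_mapI)
  interpret M: module R M by fact
  interpret N: module R N by fact
  note f = linear_mapD[OF assms(4)]
  show "(\<Oplus>\<^bsub>N\<^esub>i\<in>A. f i x) \<in> carrier N" if "x \<in> carrier M" for x
    using f(1) that by (intro N.finsum_closed) auto
  show "(\<Oplus>\<^bsub>N\<^esub>i\<in>A. f i (x \<oplus>\<^bsub>M\<^esub> y)) = (\<Oplus>\<^bsub>N\<^esub>i\<in>A. f i x) \<oplus>\<^bsub>N\<^esub> (\<Oplus>\<^bsub>N\<^esub>i\<in>A. f i y)"
    if "x \<in> carrier M" "y \<in> carrier M" for x y
  proof -
    have "(\<Oplus>\<^bsub>N\<^esub>i\<in>A. f i (x \<oplus>\<^bsub>M\<^esub> y)) = (\<Oplus>\<^bsub>N\<^esub>i\<in>A. f i x \<oplus>\<^bsub>N\<^esub> f i y)"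
      by (rule N.M.finsum_cong') (use f that in auto)
    also have "\<dots> = (\<Oplus>\<^bsub>N\<^esub>i\<in>A. f i x) \<oplus>\<^bsub>N\<^esub> (\<Oplus>\<^bsub>N\<^esub>i\<in>A. f i y)"
      by (rule N.M.finsum_addf) (use f that in auto)
    finally show ?thesis .
  qed
  show "(\<Oplus>\<^bsub>N\<^esub>i\<in>A. f i (r \<odot>\<^bsub>M\<^esub> x)) = r \<odot>\<^bsub>N\<^esub> (\<Oplus>\<^bsub>N\<^esub>i\<in>A. f i x)"
    if "r \<in> carrier R" "x \<in> carrier M" for r x
  proof -
    have "(\<Oplus>\<^bsub>N\<^esub>i\<in>A. f i (r \<odot>\<^bsub>M\<^esub> x)) = (\<Oplus>\<^bsub>N\<^esub>i\<in>A. r \<odot>\<^bsub>N\<^esub> f i x)"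
      by (rule N.M.finsum_cong') (use f that in auto)
    also have "\<dots> = r \<odot>\<^bsub>N\<^esub> (\<Oplus>\<^bsub>N\<^esub>i\<in>A. f i x)"
      by (rule N.finsum_smult_ldistr[symmetric]) (use f assms that in auto)
    finally show ?thesis .
  qed
qed

text \<open>Closure under negatives follows, since they are multiples by \<open>-1\<close>.\<close>

lemma (in module) submoduleI':
  assumes "H \<subseteq> carrier M" "\<zero>\<^bsub>M\<^esub> \<in> H"
    and "\<And>a b. a \<in> H \<Longrightarrow> b \<in> H \<Longrightarrow> a \<oplus>\<^bsub>M\<^esub> b \<in> H"
    and smult: "\<And>a x. a \<in> carrier R \<Longrightarrow> x \<in> H \<Longrightarrow> a \<odot>\<^bsub>M\<^esub> x \<in> H"
  shows "submodule H R M"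
proof (rule submoduleI)
  fix a assume a: "a \<in> H"
  then have "\<ominus> \<one> \<odot>\<^bsub>M\<^esub> a \<in> H" by (intro smult) auto
  then show "\<ominus>\<^bsub>M\<^esub> a \<in> H" using a assms(1) by (simp add: smult_l_minus subset_iff)
qed (use assms in auto)

lemma (in module) submodule_zero:
  "submodule H R M \<Longrightarrow> \<zero>\<^bsub>M\<^esub> \<in> H"
  using subgroup.one_closed[OF submodule.axioms(1)] by force

lemma (in abelian_monoid) finsum_closed_under:
  assumes "finite A" "\<And>i. i \<in> A \<Longrightarrow> u i \<in> H" "H \<subseteq> carrier G" "\<zero> \<in> H"
    and "\<And>a b. a \<in> H \<Longrightarrow> b \<in> H \<Longrightarrow> a \<oplus> b \<in> H"
  shows "(\<Oplus>i\<in>A. u i) \<in> H"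
  using assms(1,2)
proof induction
  case empty then show ?case using assms by simp
next
  case (insert x F)
  have "u \<in> F \<rightarrow> carrier G" "u x \<in> carrier G" using insert assms(3) by auto
  with insert show ?case using assms(5) by simp
qed

lemma linear_map_vimage_submodule:
  assumes "module R M" "module R N" "f \<in> linear_map R M N" "submodule H R N"
  shows "submodule {x \<in> carrier M. f x \<in> H} R M"
proof -
  interpret M: module R M by fact
  interpret N: module R N by fact
  note f = linear_mapD[OF assms(3)]
  show ?thesis
    using N.submoduleE(4,5)[OF assms(4)] N.submodule_zero[OF assms(4)]
    by (intro M.submoduleI') (auto simp: f linear_map_zero[OF assms(1-3)])
qed

section \<open>Free modules\<close>

lemma free_module_carrier:
  "f \<in> carrier (free_module R B) \<longleftrightarrow>
    (\<forall>x\<in>B. f x \<in> carrier R) \<and> (\<forall>x. x \<notin> B \<longrightarrow> f x = \<zero>\<^bsub>R\<^esub>) \<and> finite {x. f x \<noteq> \<zero>\<^bsub>R\<^esub>}"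
  by (simp add: free_module_def)

lemma free_module_simps [simp]:
  "\<zero>\<^bsub>free_module R B\<^esub> = (\<lambda>x. \<zero>\<^bsub>R\<^esub>)"
  "f \<oplus>\<^bsub>free_module R B\<^esub> h = (\<lambda>x. f x \<oplus>\<^bsub>R\<^esub> h x)"
  "r \<odot>\<^bsub>free_module R B\<^esub> f = (\<lambda>x. r \<otimes>\<^bsub>R\<^esub> f x)"
  by (simp_all add: free_module_def)

context cring
begin

lemma free_module_closed:
  "f \<in> carrier (free_module R B) \<Longrightarrow> f x \<in> carrier R"
  by (cases "x \<in> B") (auto simp: free_module_carrier)

lemma free_module_module: "module R (free_module R B)"
proof (rule moduleI)
  let ?F = "free_module R B"
  have add: "f \<oplus>\<^bsub>?F\<^esub> h \<in> carrier ?F" if "f \<in> carrier ?F" "h \<in> carrier ?F" for f h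
  proof -
    have "{x. f x \<oplus> h x \<noteq> \<zero>} \<subseteq> {x. f x \<noteq> \<zero>} \<union> {x. h x \<noteq> \<zero>}" by auto
    then have "finite {x. f x \<oplus> h x \<noteq> \<zero>}"
      using that by (auto simp: free_module_carrier intro: finite_subset)
    then show ?thesis using that by (auto simp: free_module_carrier)
  qed
  show smult: "a \<odot>\<^bsub>?F\<^esub> x \<in> carrier ?F" if "a \<in> carrier R" "x \<in> carrier ?F" for a x
  proof -
    have "{y. a \<otimes> x y \<noteq> \<zero>} \<subseteq> {y. x y \<noteq> \<zero>}" using that by auto
    then have "finite {y. a \<otimes> x y \<noteq> \<zero>}"
      using that by (auto simp: free_module_carrier intro: finite_subset)
    then show ?thesis using that by (auto simp: free_module_carrier)
  qed
  show "cring R" ..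
  note c = free_module_closed[of _ B]
  have zero: "\<zero>\<^bsub>?F\<^esub> \<in> carrier ?F" by (simp add: free_module_carrier)
  show "abelian_group ?F"
  proof (rule abelian_groupI)
    fix x assume x: "x \<in> carrier ?F"
    have "(\<ominus> \<one>) \<odot>\<^bsub>?F\<^esub> x \<oplus>\<^bsub>?F\<^esub> x = \<zero>\<^bsub>?F\<^esub>"
      using c[OF x] by (auto simp: l_minus l_neg)
    then show "\<exists>y\<in>carrier ?F. y \<oplus>\<^bsub>?F\<^esub> x = \<zero>\<^bsub>?F\<^esub>"
      using smult[OF _ x, of "\<ominus> \<one>"] by blast
  qed (use add zero c in \<open>simp_all add: a_ac\<close>)
qed (use free_module_closed[of _ B] in \<open>auto intro!: ext simp: l_distr r_distr m_assoc\<close>)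

lemma basis_vec_closed: "x \<in> B \<Longrightarrow> basis_vec R x \<in> carrier (free_module R B)"
  by (auto simp: free_module_carrier basis_vec_def cong: if_cong)

lemma free_module_induct:
  assumes H: "submodule H R (free_module R B)"
    and basis: "\<And>x. x \<in> B \<Longrightarrow> basis_vec R x \<in> H"
    and f: "f \<in> carrier (free_module R B)"
  shows "f \<in> H"
proof -
  interpret F: module R "free_module R B" by (rule free_module_module)
  have "f \<in> H" if "finite A" "f \<in> carrier (free_module R B)" "{x. f x \<noteq> \<zero>} \<subseteq> A" for A f
    using that
  proof (induction arbitrary: f rule: finite_induct)
    case empty
    then have "f = \<zero>\<^bsub>free_module R B\<^esub>" by auto
    then show ?case using F.submodule_zero[OF H] by simp
  next
    case (insert x A)
    note c = free_module_closed[OF insert.prems(1)]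
    show ?case
    proof (cases "f x = \<zero>")
      case True
      with insert show ?thesis by blast
    next
      case False
      then have x: "x \<in> B" using insert.prems by (auto simp: free_module_carrier)
      \<comment> \<open>Split off the coefficient of one basis element to shrink the support.\<close>
      let ?g = "f(x := \<zero>)"
      have "{y. ?g y \<noteq> \<zero>} \<subseteq> {y. f y \<noteq> \<zero>}" by auto
      then have "?g \<in> carrier (free_module R B)"
        using insert.prems(1) by (auto simp: free_module_carrier intro: finite_subset)
      moreover have "{y. ?g y \<noteq> \<zero>} \<subseteq> A" using insert.prems by auto
      ultimately have "?g \<in> H" by (rule insert.IH)
      then have "?g \<oplus>\<^bsub>free_module R B\<^esub> (f x \<odot>\<^bsub>free_module R B\<^esub> basis_vec R x) \<in> H"
        using F.submoduleE(4,5)[OF H] basis[OF x] c by blast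
      also have "?g \<oplus>\<^bsub>free_module R B\<^esub> (f x \<odot>\<^bsub>free_module R B\<^esub> basis_vec R x) = f"
        using c by (auto simp: basis_vec_def)
      finally show ?thesis .
    qed
  qed
  from this[of "{x. f x \<noteq> \<zero>}" f] f show ?thesis by (auto simp: free_module_carrier)
qed

end

text \<open>The linear extension of a map \<open>u\<close> on a basis, in the form in which \<^const>\<open>tensor_lift\<close>
  applies it to a representative.\<close>

definition free_eval :: "('r, 'z) ring_scheme \<Rightarrow> ('r, 'n) module \<Rightarrow> ('x \<Rightarrow> 'n) \<Rightarrow> ('x \<Rightarrow> 'r) \<Rightarrow> 'n"
  where "free_eval R N u f = (\<Oplus>\<^bsub>N\<^esub>x\<in>{x. f x \<noteq> \<zero>\<^bsub>R\<^esub>}. f x \<odot>\<^bsub>N\<^esub> u x)"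

text \<open>
  The locale \<^locale>\<open>module\<close> for module records without extension fields, the type on which tensor
  powers and direct sums are defined.
\<close>

locale plain_module = module R M
  for R :: "('r, 'z) ring_scheme" (structure) and M :: "('r, 'm) module" (structure)
begin

lemma free_eval_superset:
  assumes "u \<in> B \<rightarrow> carrier M" "f \<in> carrier (free_module R B)" "finite A"
    "{x. f x \<noteq> \<zero>} \<subseteq> A" "A \<subseteq> B"
  shows "free_eval R M u f = (\<Oplus>\<^bsub>M\<^esub>x\<in>A. f x \<odot>\<^bsub>M\<^esub> u x)"
  unfolding free_eval_def
  by (rule M.add.finprod_mono_neutral_cong_left)
    (use assms R.free_module_closed[OF assms(2)] in \<open>auto simp: Pi_def\<close>)

lemma free_eval_linear:
  assumes u: "u \<in> B \<rightarrow> carrier M"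
  shows "free_eval R M u \<in> linear_map R (free_module R B) M"
proof (rule linear_mapI)
  let ?F = "free_module R B"
  interpret F: module R ?F by (rule R.free_module_module)
  have supp: "finite {x. f x \<noteq> \<zero>}" "{x. f x \<noteq> \<zero>} \<subseteq> B" if "f \<in> carrier ?F" for f
    using that by (auto simp: free_module_carrier)
  note c = R.free_module_closed
  have uc: "u x \<in> carrier M" if "x \<in> B" for x using that u by auto
  show "free_eval R M u f \<in> carrier M" if f: "f \<in> carrier ?F" for f
    unfolding free_eval_def by (rule M.finsum_closed) (use supp[OF f] c[OF f] uc in blast)
  show "free_eval R M u (f \<oplus>\<^bsub>?F\<^esub> h) = free_eval R M u f \<oplus>\<^bsub>M\<^esub> free_eval R M u h"
    if f: "f \<in> carrier ?F" and h: "h \<in> carrier ?F" for f h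
  proof -
    let ?A = "{x. f x \<noteq> \<zero>} \<union> {x. h x \<noteq> \<zero>}"
    have A: "finite ?A" "?A \<subseteq> B" using supp f h by auto
    have "free_eval R M u (f \<oplus>\<^bsub>?F\<^esub> h) = (\<Oplus>\<^bsub>M\<^esub>x\<in>?A. (f \<oplus>\<^bsub>?F\<^esub> h) x \<odot>\<^bsub>M\<^esub> u x)"
      by (rule free_eval_superset[OF u F.a_closed[OF f h]]) (use A in auto)
    also have "\<dots> = (\<Oplus>\<^bsub>M\<^esub>x\<in>?A. f x \<odot>\<^bsub>M\<^esub> u x \<oplus>\<^bsub>M\<^esub> h x \<odot>\<^bsub>M\<^esub> u x)"
    proof (rule M.finsum_cong'[OF refl])
      show "(\<lambda>x. f x \<odot>\<^bsub>M\<^esub> u x \<oplus>\<^bsub>M\<^esub> h x \<odot>\<^bsub>M\<^esub> u x) \<in> ?A \<rightarrow> carrier M"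
        using c[OF f] c[OF h] uc A(2) by blast
      show "(f \<oplus>\<^bsub>?F\<^esub> h) x \<odot>\<^bsub>M\<^esub> u x = f x \<odot>\<^bsub>M\<^esub> u x \<oplus>\<^bsub>M\<^esub> h x \<odot>\<^bsub>M\<^esub> u x" if "x \<in> ?A" for x
        using smult_l_distr[OF c[OF f] c[OF h] uc] A(2) that by auto
    qed
    also have "\<dots> = (\<Oplus>\<^bsub>M\<^esub>x\<in>?A. f x \<odot>\<^bsub>M\<^esub> u x) \<oplus>\<^bsub>M\<^esub> (\<Oplus>\<^bsub>M\<^esub>x\<in>?A. h x \<odot>\<^bsub>M\<^esub> u x)"
      by (rule M.finsum_addf) (use c[OF f] c[OF h] uc A(2) in blast)+
    also have "\<dots> = free_eval R M u f \<oplus>\<^bsub>M\<^esub> free_eval R M u h"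
      by (subst (1 2) free_eval_superset[OF u, of _ ?A]) (use f h A in auto)
    finally show ?thesis .
  qed
  show "free_eval R M u (r \<odot>\<^bsub>?F\<^esub> f) = r \<odot>\<^bsub>M\<^esub> free_eval R M u f"
    if r: "r \<in> carrier R" and f: "f \<in> carrier ?F" for r f
  proof -
    let ?A = "{x. f x \<noteq> \<zero>}"
    have "free_eval R M u (r \<odot>\<^bsub>?F\<^esub> f) = (\<Oplus>\<^bsub>M\<^esub>x\<in>?A. (r \<odot>\<^bsub>?F\<^esub> f) x \<odot>\<^bsub>M\<^esub> u x)"
      by (rule free_eval_superset[OF u F.smult_closed[OF r f]]) (use supp[OF f] r in auto)
    also have "\<dots> = (\<Oplus>\<^bsub>M\<^esub>x\<in>?A. r \<odot>\<^bsub>M\<^esub> (f x \<odot>\<^bsub>M\<^esub> u x))"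
    proof (rule M.finsum_cong'[OF refl])
      show "(\<lambda>x. r \<odot>\<^bsub>M\<^esub> (f x \<odot>\<^bsub>M\<^esub> u x)) \<in> ?A \<rightarrow> carrier M"
        using c[OF f] uc r supp[OF f] by blast
      show "(r \<odot>\<^bsub>?F\<^esub> f) x \<odot>\<^bsub>M\<^esub> u x = r \<odot>\<^bsub>M\<^esub> (f x \<odot>\<^bsub>M\<^esub> u x)" if "x \<in> ?A" for x
        using smult_assoc1[OF r c[OF f] uc] supp[OF f] that by auto
    qed
    also have "\<dots> = r \<odot>\<^bsub>M\<^esub> free_eval R M u f"
      unfolding free_eval_def
      by (rule finsum_smult_ldistr[symmetric]) (use supp[OF f] c[OF f] uc r in blast)+
    finally show ?thesis .
  qed
qed

lemma free_eval_basis: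
  assumes "u x \<in> carrier M"
  shows "free_eval R M u (basis_vec R x) = u x"
proof (cases "\<one> = \<zero>")
  \<comment> \<open>Over the zero ring a basis vector has empty support.\<close>
  case True
  then have "u x = \<zero>\<^bsub>M\<^esub>" using assms smult_one[OF assms] smult_l_null[OF assms] by simp
  then show ?thesis using True by (simp add: free_eval_def basis_vec_def)
next
  case False
  then have "{y. basis_vec R x y \<noteq> \<zero>} = {x}" by (auto simp: basis_vec_def)
  then show ?thesis using assms by (simp add: free_eval_def basis_vec_def)
qed

end

section \<open>Quotient modules\<close>

locale quotient_by_submodule = plain_module +
  fixes N
  assumes submod: "submodule N R M"
begin

sublocale abelian_subgroup N M
  using submodule.axioms(1)[OF submod] M.abelian_group_axioms
  by (intro abelian_subgroupI3) (auto simp: additive_subgroup_def)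

lemma coset_eq_iff:
  assumes "x \<in> carrier M" "y \<in> carrier M"
  shows "N +>\<^bsub>M\<^esub> x = N +>\<^bsub>M\<^esub> y \<longleftrightarrow> x \<ominus>\<^bsub>M\<^esub> y \<in> N"
proof -
  have "x \<ominus>\<^bsub>M\<^esub> y \<in> N \<longleftrightarrow> x \<in> N +>\<^bsub>M\<^esub> y"
    using a_rcos_module[OF assms(2,1)] by (simp add: a_minus_def)
  also have "\<dots> \<longleftrightarrow> N +>\<^bsub>M\<^esub> x = N +>\<^bsub>M\<^esub> y"
    using a_repr_independence'[OF _ assms(2), of x] a_rcos_self[OF assms(1)] by blast
  finally show ?thesis by simp
qed

text \<open>
  The scalar multiple of a coset is defined as a union over its elements; all of them give the same
  coset because \<open>N\<close> is stable under scalars.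
\<close>

lemma quotient_module_simps:
  "carrier (quotient_module M N) = {N +>\<^bsub>M\<^esub> x | x. x \<in> carrier M}"
  "\<zero>\<^bsub>quotient_module M N\<^esub> = N +>\<^bsub>M\<^esub> \<zero>\<^bsub>M\<^esub>"
  "x \<in> carrier M \<Longrightarrow> y \<in> carrier M \<Longrightarrow>
    (N +>\<^bsub>M\<^esub> x) \<oplus>\<^bsub>quotient_module M N\<^esub> (N +>\<^bsub>M\<^esub> y) = N +>\<^bsub>M\<^esub> (x \<oplus>\<^bsub>M\<^esub> y)"
  "r \<in> carrier R \<Longrightarrow> x \<in> carrier M \<Longrightarrow>
    r \<odot>\<^bsub>quotient_module M N\<^esub> (N +>\<^bsub>M\<^esub> x) = N +>\<^bsub>M\<^esub> (r \<odot>\<^bsub>M\<^esub> x)"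
proof -
  show "carrier (quotient_module M N) = {N +>\<^bsub>M\<^esub> x | x. x \<in> carrier M}"
    by (auto simp: quotient_module_def A_RCOSETS_def')
  show "\<zero>\<^bsub>quotient_module M N\<^esub> = N +>\<^bsub>M\<^esub> \<zero>\<^bsub>M\<^esub>"
    using a_subset by (simp add: quotient_module_def)
  show "(N +>\<^bsub>M\<^esub> x) \<oplus>\<^bsub>quotient_module M N\<^esub> (N +>\<^bsub>M\<^esub> y) = N +>\<^bsub>M\<^esub> (x \<oplus>\<^bsub>M\<^esub> y)"
    if "x \<in> carrier M" "y \<in> carrier M"
    using that by (simp add: quotient_module_def a_rcos_sum)
  assume r: "r \<in> carrier R" and x: "x \<in> carrier M"
  have "N +>\<^bsub>M\<^esub> (r \<odot>\<^bsub>M\<^esub> y) = N +>\<^bsub>M\<^esub> (r \<odot>\<^bsub>M\<^esub> x)" if y: "y \<in> N +>\<^bsub>M\<^esub> x" for y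
  proof -
    have yc: "y \<in> carrier M" by (rule a_elemrcos_carrier[OF x y])
    have "y \<ominus>\<^bsub>M\<^esub> x \<in> N"
      using coset_eq_iff[OF yc x] a_repr_independence'[OF y x] by simp
    then have "r \<odot>\<^bsub>M\<^esub> (y \<ominus>\<^bsub>M\<^esub> x) \<in> N" using submoduleE(4)[OF submod r] by simp
    also have "r \<odot>\<^bsub>M\<^esub> (y \<ominus>\<^bsub>M\<^esub> x) = r \<odot>\<^bsub>M\<^esub> y \<ominus>\<^bsub>M\<^esub> r \<odot>\<^bsub>M\<^esub> x"
      using r x yc by (simp add: a_minus_def smult_r_distr smult_r_minus)
    finally show ?thesis using coset_eq_iff r x yc by simp
  qed
  moreover have "x \<in> N +>\<^bsub>M\<^esub> x" by (rule a_rcos_self[OF x])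
  ultimately have "(\<Union>y\<in>N +>\<^bsub>M\<^esub> x. N +>\<^bsub>M\<^esub> (r \<odot>\<^bsub>M\<^esub> y)) = N +>\<^bsub>M\<^esub> (r \<odot>\<^bsub>M\<^esub> x)"
    by blast
  then show "r \<odot>\<^bsub>quotient_module M N\<^esub> (N +>\<^bsub>M\<^esub> x) = N +>\<^bsub>M\<^esub> (r \<odot>\<^bsub>M\<^esub> x)"
    unfolding quotient_module_def by (simp only: module.simps)
qed

lemma quotient_module_cases:
  assumes "A \<in> carrier (quotient_module M N)"
  obtains x where "x \<in> carrier M" "A = N +>\<^bsub>M\<^esub> x"
  using assms by (auto simp: quotient_module_simps(1))

lemma coset_closed: "x \<in> carrier M \<Longrightarrow> N +>\<^bsub>M\<^esub> x \<in> carrier (quotient_module M N)"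
  by (auto simp: quotient_module_simps(1))

lemma quotient_module_module: "module R (quotient_module M N)"
proof (rule moduleI)
  let ?Q = "quotient_module M N"
  note s = quotient_module_simps(2-4) and cases = quotient_module_cases
  show "cring R" ..
  show "abelian_group ?Q"
  proof (rule abelian_groupI)
    show "\<zero>\<^bsub>?Q\<^esub> \<in> carrier ?Q" by (simp add: s coset_closed)
  next
    fix A assume "A \<in> carrier ?Q"
    then obtain x where x: "x \<in> carrier M" "A = N +>\<^bsub>M\<^esub> x" by (rule cases)
    then have "(N +>\<^bsub>M\<^esub> (\<ominus>\<^bsub>M\<^esub> x)) \<oplus>\<^bsub>?Q\<^esub> A = \<zero>\<^bsub>?Q\<^esub>" by (simp add: s M.l_neg)
    moreover have "N +>\<^bsub>M\<^esub> (\<ominus>\<^bsub>M\<^esub> x) \<in> carrier ?Q" using x(1) by (simp add: coset_closed)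
    ultimately show "\<exists>B\<in>carrier ?Q. B \<oplus>\<^bsub>?Q\<^esub> A = \<zero>\<^bsub>?Q\<^esub>" by blast
    show "\<zero>\<^bsub>?Q\<^esub> \<oplus>\<^bsub>?Q\<^esub> A = A"
      unfolding x(2) s(1) using x(1) by (subst s(2)) simp_all
    fix B assume "B \<in> carrier ?Q"
    then obtain y where y: "y \<in> carrier M" "B = N +>\<^bsub>M\<^esub> y" by (rule cases)
    have AB: "A \<oplus>\<^bsub>?Q\<^esub> B = N +>\<^bsub>M\<^esub> (x \<oplus>\<^bsub>M\<^esub> y)" using x y by (simp add: s)
    then show "A \<oplus>\<^bsub>?Q\<^esub> B \<in> carrier ?Q" using x(1) y(1) by (simp add: coset_closed)
    show "A \<oplus>\<^bsub>?Q\<^esub> B = B \<oplus>\<^bsub>?Q\<^esub> A"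
      unfolding AB unfolding x(2) y(2) using x(1) y(1) by (simp add: s(2) M.a_comm)
    fix C assume "C \<in> carrier ?Q"
    then obtain z where z: "z \<in> carrier M" "C = N +>\<^bsub>M\<^esub> z" by (rule cases)
    show "A \<oplus>\<^bsub>?Q\<^esub> B \<oplus>\<^bsub>?Q\<^esub> C = A \<oplus>\<^bsub>?Q\<^esub> (B \<oplus>\<^bsub>?Q\<^esub> C)"
      unfolding x(2) y(2) z(2) using x(1) y(1) z(1) by (simp add: s(2) M.a_assoc)
  qed
  fix A assume "A \<in> carrier ?Q"
  then obtain x where x: "x \<in> carrier M" "A = N +>\<^bsub>M\<^esub> x" by (rule cases)
  show "\<one> \<odot>\<^bsub>?Q\<^esub> A = A" using x by (simp add: s)
  fix r assume r: "r \<in> carrier R"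
  then show "r \<odot>\<^bsub>?Q\<^esub> A \<in> carrier ?Q" using x by (simp add: s coset_closed)
  {
    fix B assume "B \<in> carrier ?Q"
    then obtain y where y: "y \<in> carrier M" "B = N +>\<^bsub>M\<^esub> y" by (rule cases)
    show "r \<odot>\<^bsub>?Q\<^esub> (A \<oplus>\<^bsub>?Q\<^esub> B) = r \<odot>\<^bsub>?Q\<^esub> A \<oplus>\<^bsub>?Q\<^esub> r \<odot>\<^bsub>?Q\<^esub> B"
      using x y r by (simp add: s smult_r_distr)
  }
  fix t assume t: "t \<in> carrier R"
  show "(r \<oplus> t) \<odot>\<^bsub>?Q\<^esub> A = r \<odot>\<^bsub>?Q\<^esub> A \<oplus>\<^bsub>?Q\<^esub> t \<odot>\<^bsub>?Q\<^esub> A"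
    using x r t by (simp add: s smult_l_distr)
  show "r \<otimes> t \<odot>\<^bsub>?Q\<^esub> A = r \<odot>\<^bsub>?Q\<^esub> (t \<odot>\<^bsub>?Q\<^esub> A)"
    using x r t by (simp add: s smult_assoc1)
qed

lemma coset_linear: "(\<lambda>x. N +>\<^bsub>M\<^esub> x) \<in> linear_map R M (quotient_module M N)"
  by (rule linear_mapI) (simp_all add: quotient_module_simps(3,4) coset_closed)

end

section \<open>Tensor powers\<close>

definition multilinear ::
  "('r, 'z) ring_scheme \<Rightarrow> ('r, 'm) module \<Rightarrow> ('r, 'n) module \<Rightarrow> nat \<Rightarrow> ('m list \<Rightarrow> 'n) \<Rightarrow> bool"
  where "multilinear R M N i u \<longleftrightarrow> u \<in> tensor_words M i \<rightarrow> carrier N \<and>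
    (\<forall>us x vs. us @ x # vs \<in> tensor_words M i \<longrightarrow>
      (\<forall>y\<in>carrier M. u (us @ (x \<oplus>\<^bsub>M\<^esub> y) # vs) = u (us @ x # vs) \<oplus>\<^bsub>N\<^esub> u (us @ y # vs)) \<and>
      (\<forall>r\<in>carrier R. u (us @ (r \<odot>\<^bsub>M\<^esub> x) # vs) = r \<odot>\<^bsub>N\<^esub> u (us @ x # vs)))"

lemma multilinearI:
  assumes "\<And>as. as \<in> tensor_words M i \<Longrightarrow> u as \<in> carrier N"
    and "\<And>us x vs y. us @ x # vs \<in> tensor_words M i \<Longrightarrow> y \<in> carrier M \<Longrightarrow>
      u (us @ (x \<oplus>\<^bsub>M\<^esub> y) # vs) = u (us @ x # vs) \<oplus>\<^bsub>N\<^esub> u (us @ y # vs)"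
    and "\<And>us x vs r. us @ x # vs \<in> tensor_words M i \<Longrightarrow> r \<in> carrier R \<Longrightarrow>
      u (us @ (r \<odot>\<^bsub>M\<^esub> x) # vs) = r \<odot>\<^bsub>N\<^esub> u (us @ x # vs)"
  shows "multilinear R M N i u"
  using assms by (auto simp: multilinear_def)

lemma multilinearD:
  assumes "multilinear R M N i u"
  shows "as \<in> tensor_words M i \<Longrightarrow> u as \<in> carrier N"
    and "us @ x # vs \<in> tensor_words M i \<Longrightarrow> y \<in> carrier M \<Longrightarrow>
      u (us @ (x \<oplus>\<^bsub>M\<^esub> y) # vs) = u (us @ x # vs) \<oplus>\<^bsub>N\<^esub> u (us @ y # vs)"
    and "us @ x # vs \<in> tensor_words M i \<Longrightarrow> r \<in> carrier R \<Longrightarrow>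
      u (us @ (r \<odot>\<^bsub>M\<^esub> x) # vs) = r \<odot>\<^bsub>N\<^esub> u (us @ x # vs)"
  using assms by (auto simp: multilinear_def)

lemma tensor_words_iff: "as \<in> tensor_words M i \<longleftrightarrow> length as = i \<and> set as \<subseteq> carrier M"
  by (simp add: tensor_words_def)

text \<open>
  The product of the free modules on words which is induced by concatenation: a word of length
  \<open>i + j\<close> splits uniquely after \<open>i\<close> letters.
\<close>

definition tensor_conc :: "('r, 'z) ring_scheme \<Rightarrow> nat \<Rightarrow> ('m list \<Rightarrow> 'r) \<Rightarrow> ('m list \<Rightarrow> 'r) \<Rightarrow> 'm list \<Rightarrow> 'r"
  where "tensor_conc R i f g = (\<lambda>as. f (take i as) \<otimes>\<^bsub>R\<^esub> g (drop i as))"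

context plain_module
begin

abbreviation (input) "TF \<equiv> tensor_free R M"
abbreviation (input) "TP \<equiv> tensor_power R M"
abbreviation (input) "TN \<equiv> tensor_null R M"
abbreviation (input) "TW \<equiv> tensor_words M"

lemma tensor_free_module: "module R (TF i)"
  unfolding tensor_free_def by (rule R.free_module_module)

lemma tensor_basis_closed: "as \<in> TW i \<Longrightarrow> basis_vec R as \<in> carrier (TF i)"
  unfolding tensor_free_def by (rule R.basis_vec_closed)

lemma tensor_words_replace:
  "us @ x # vs \<in> TW i \<Longrightarrow> y \<in> carrier M \<Longrightarrow> us @ y # vs \<in> TW i"
  by (simp add: tensor_words_iff)

lemma tensor_relations_closed: "tensor_relations R M i \<subseteq> carrier (TF i)"
proof
  fix f assume "f \<in> tensor_relations R M i"
  interpret F: module R "TF i" by (rule tensor_free_module)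
  show "f \<in> carrier (TF i)" using \<open>f \<in> tensor_relations R M i\<close>
  proof cases
    case (additive us x vs y)
    then have "x \<in> carrier M" by (simp add: tensor_words_iff)
    with additive show ?thesis
      by (simp add: F.minus_closed tensor_basis_closed tensor_words_replace[OF additive(2)])
  next
    case (homogeneous us x vs r)
    then have "x \<in> carrier M" by (simp add: tensor_words_iff)
    with homogeneous show ?thesis
      by (simp add: F.minus_closed tensor_basis_closed tensor_words_replace[OF homogeneous(2)])
  qed
qed

lemma tensor_null_submodule: "submodule (TN i) R (TF i)"
proof -
  interpret F: module R "TF i" by (rule tensor_free_module)
  have c: "carrier (TF i) \<in> {N. submodule N R (TF i) \<and> tensor_relations R M i \<subseteq> N}"
    using F.carrier_is_submodule tensor_relations_closed by blast
  show ?thesis unfolding tensor_null_def span_submodule_def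
  proof (rule F.submoduleI')
    show "\<Inter> {N. submodule N R (TF i) \<and> tensor_relations R M i \<subseteq> N} \<subseteq> carrier (TF i)"
      using c by blast
  qed (use F.submodule_zero F.submoduleE(4,5) in blast)+
qed

lemma tensor_relations_null: "tensor_relations R M i \<subseteq> TN i"
  by (auto simp: tensor_null_def span_submodule_def)

lemma tensor_null_least:
  assumes "submodule N R (TF i)" "tensor_relations R M i \<subseteq> N"
  shows "TN i \<subseteq> N"
  using assms by (auto simp: tensor_null_def span_submodule_def)

lemma tensor_quotient: "quotient_by_submodule R (TF i) (TN i)"
  using tensor_free_module tensor_null_submodule
  by (simp add: quotient_by_submodule_def quotient_by_submodule_axioms_def plain_module_def)

lemma tensor_power_module: "module R (TP i)"
  unfolding tensor_power_def
  by (rule quotient_by_submodule.quotient_module_module[OF tensor_quotient])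

definition tensor_class :: "nat \<Rightarrow> ('m list \<Rightarrow> 'r) \<Rightarrow> ('m list \<Rightarrow> 'r) set"
  where "tensor_class i f = TN i +>\<^bsub>TF i\<^esub> f"

lemma tensor_class_linear: "tensor_class i \<in> linear_map R (TF i) (TP i)"
  using quotient_by_submodule.coset_linear[OF tensor_quotient[of i]]
  unfolding tensor_class_def[abs_def] tensor_power_def .

lemma tensor_power_cases:
  assumes "A \<in> carrier (TP i)"
  obtains f where "f \<in> carrier (TF i)" "A = tensor_class i f"
  using quotient_by_submodule.quotient_module_cases[OF tensor_quotient assms[unfolded tensor_power_def]]
  unfolding tensor_class_def by blast

lemma tensor_class_eq_iff:
  assumes "f \<in> carrier (TF i)" "g \<in> carrier (TF i)"
  shows "tensor_class i f = tensor_class i g \<longleftrightarrow> f \<ominus>\<^bsub>TF i\<^esub> g \<in> TN i"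
  unfolding tensor_class_def by (rule quotient_by_submodule.coset_eq_iff[OF tensor_quotient assms])

lemma tensor_class_mem:
  assumes "f \<in> carrier (TF i)" "g \<in> tensor_class i f"
  shows "g \<in> carrier (TF i)" "tensor_class i g = tensor_class i f"
proof -
  interpret Q: quotient_by_submodule R "TF i" "TN i" by (rule tensor_quotient)
  show "g \<in> carrier (TF i)"
    using Q.a_elemrcos_carrier[OF assms(1)] assms(2) by (simp add: tensor_class_def)
  show "tensor_class i g = tensor_class i f"
    using Q.a_repr_independence'[OF _ assms(1), of g] assms(2) by (simp add: tensor_class_def)
qed

lemma tensor_class_self: "f \<in> carrier (TF i) \<Longrightarrow> f \<in> tensor_class i f"
proof -
  interpret Q: quotient_by_submodule R "TF i" "TN i" by (rule tensor_quotient)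
  show "f \<in> carrier (TF i) \<Longrightarrow> f \<in> tensor_class i f"
    unfolding tensor_class_def by (rule Q.a_rcos_self)
qed

lemma pure_tensor_class: "as \<in> TW i \<Longrightarrow> pure_tensor R M as = tensor_class i (basis_vec R as)"
  by (auto simp: pure_tensor_def tensor_class_def tensor_words_iff)

lemma pure_tensor_multilinear: "multilinear R M (TP i) i (pure_tensor R M)"
proof (rule multilinearI)
  interpret F: module R "TF i" by (rule tensor_free_module)
  note l = linear_mapD[OF tensor_class_linear[of i]] and b = tensor_basis_closed
  show "pure_tensor R M as \<in> carrier (TP i)" if "as \<in> TW i" for as
    using that l(1)[OF b[OF that]] by (simp add: pure_tensor_class)
  show "pure_tensor R M (us @ (x \<oplus>\<^bsub>M\<^esub> y) # vs) =
      pure_tensor R M (us @ x # vs) \<oplus>\<^bsub>TP i\<^esub> pure_tensor R M (us @ y # vs)"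
    if w: "us @ x # vs \<in> TW i" and y: "y \<in> carrier M" for us x vs y
  proof -
    have x: "x \<in> carrier M" using w by (simp add: tensor_words_iff)
    note w' = w tensor_words_replace[OF w y] tensor_words_replace[OF w M.a_closed[OF x y]]
    have "tensor_class i (basis_vec R (us @ (x \<oplus>\<^bsub>M\<^esub> y) # vs)) =
        tensor_class i (basis_vec R (us @ x # vs) \<oplus>\<^bsub>TF i\<^esub> basis_vec R (us @ y # vs))"
      using tensor_relations.additive[OF w y, of R] tensor_relations_null b[OF w'(1)] b[OF w'(2)] b[OF w'(3)]
      by (subst tensor_class_eq_iff) auto
    then show ?thesis using w' l(2) b by (simp add: pure_tensor_class[of _ i])
  qed
  show "pure_tensor R M (us @ (r \<odot>\<^bsub>M\<^esub> x) # vs) = r \<odot>\<^bsub>TP i\<^esub> pure_tensor R M (us @ x # vs)"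
    if w: "us @ x # vs \<in> TW i" and r: "r \<in> carrier R" for us x vs r
  proof -
    have x: "x \<in> carrier M" using w by (simp add: tensor_words_iff)
    note w' = w tensor_words_replace[OF w smult_closed[OF r x]]
    have "tensor_class i (basis_vec R (us @ (r \<odot>\<^bsub>M\<^esub> x) # vs)) =
        tensor_class i (r \<odot>\<^bsub>TF i\<^esub> basis_vec R (us @ x # vs))"
      using tensor_relations.homogeneous[OF w r] tensor_relations_null b[OF w'(1)] b[OF w'(2)] r
      by (subst tensor_class_eq_iff) auto
    then show ?thesis using w' l(3) b r by (simp add: pure_tensor_class[of _ i])
  qed
qed

lemmas pure_tensor_closed = multilinearD(1)[OF pure_tensor_multilinear]

text \<open>
  The preimage of \<open>H\<close> in the free module is a submodule that contains the basis.
\<close>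

lemma tensor_power_induct:
  assumes H: "submodule H R (TP i)" and pure: "\<And>as. as \<in> TW i \<Longrightarrow> pure_tensor R M as \<in> H"
    and A: "A \<in> carrier (TP i)"
  shows "A \<in> H"
proof -
  obtain f where f: "f \<in> carrier (TF i)" "A = tensor_class i f" using A by (rule tensor_power_cases)
  have "f \<in> {f \<in> carrier (TF i). tensor_class i f \<in> H}"
    unfolding tensor_free_def
    by (rule R.free_module_induct[where B = "TW i"])
      (use linear_map_vimage_submodule[OF tensor_free_module tensor_power_module tensor_class_linear H]
        pure tensor_basis_closed f(1) in \<open>auto simp: pure_tensor_class tensor_free_def[symmetric]\<close>)
  with f show ?thesis by simp
qed

text \<open>The main tool for equations between linear maps: they may be checked on pure tensors.\<close>

lemma tensor_power_linear_eq:
  assumes "module R N" "f \<in> linear_map R (TP i) N" "h \<in> linear_map R (TP i) N"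
    and eq: "\<And>as. as \<in> TW i \<Longrightarrow> f (pure_tensor R M as) = h (pure_tensor R M as)"
    and A: "A \<in> carrier (TP i)"
  shows "f A = h A"
proof -
  interpret N: module R N by fact
  interpret T: module R "TP i" by (rule tensor_power_module)
  note f = linear_mapD[OF assms(2)] and h = linear_mapD[OF assms(3)]
  have "A \<in> {A \<in> carrier (TP i). f A = h A}"
  proof (rule tensor_power_induct)
    show "submodule {A \<in> carrier (TP i). f A = h A} R (TP i)"
      using linear_map_zero[OF tensor_power_module assms(1,2)]
        linear_map_zero[OF tensor_power_module assms(1,3)]
      by (intro T.submoduleI') (auto simp: f h)
  qed (use eq pure_tensor_closed A in auto)
  then show ?thesis by simp
qed

context
  fixes N :: "('r, 'n) module" and i u
  assumes N: "module R N" and u: "multilinear R M N i u"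
begin

interpretation N: plain_module R N using N by (simp add: plain_module_def)

text \<open>
  Multilinearity says that the linear extension of \<open>u\<close> kills the defining relations; its kernel is a
  submodule, so it kills all of \<^term>\<open>TN i\<close>.  Therefore \<^const>\<open>tensor_lift\<close> does not depend on the
  representative that it picks.
\<close>

lemma free_eval_null:
  assumes f: "f \<in> TN i"
  shows "free_eval R N u f = \<zero>\<^bsub>N\<^esub>"
proof -
  interpret F: module R "TF i" by (rule tensor_free_module)
  have uc: "u \<in> TW i \<rightarrow> carrier N" using u by (simp add: multilinear_def)
  have lin: "free_eval R N u \<in> linear_map R (TF i) N"
    unfolding tensor_free_def by (rule N.free_eval_linear[OF uc])
  note l = linear_mapD[OF lin] linear_map_minus[OF tensor_free_module N lin]
  have self: "x \<ominus>\<^bsub>N\<^esub> x = \<zero>\<^bsub>N\<^esub>" if "x \<in> carrier N" for x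
    using that by (simp add: a_minus_def N.M.r_neg)
  let ?K = "{f \<in> carrier (TF i). free_eval R N u f \<in> {\<zero>\<^bsub>N\<^esub>}}"
  have "TN i \<subseteq> ?K"
  proof (rule tensor_null_least)
    have "submodule {\<zero>\<^bsub>N\<^esub>} R N" by (rule N.submoduleI') auto
    then show "submodule ?K R (TF i)"
      by (rule linear_map_vimage_submodule[OF tensor_free_module N lin])
    show "tensor_relations R M i \<subseteq> ?K"
    proof
      fix f assume f: "f \<in> tensor_relations R M i"
      note b = tensor_basis_closed
      have "free_eval R N u f = \<zero>\<^bsub>N\<^esub>" using f
      proof cases
        case (additive us x vs y)
        then have x: "x \<in> carrier M" by (simp add: tensor_words_iff)
        note w = tensor_words_replace[OF additive(2)]
        note w' = additive(2) w[OF additive(3)] w[OF M.a_closed[OF x additive(3)]]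
        note un = multilinearD(1)[OF u]
        show ?thesis unfolding additive(1)
          using w'[THEN b] w'[THEN un] multilinearD(2)[OF u additive(2,3)]
          by (simp add: l N.free_eval_basis self)
      next
        case (homogeneous us x vs r)
        then have x: "x \<in> carrier M" by (simp add: tensor_words_iff)
        note w' = homogeneous(2) tensor_words_replace[OF homogeneous(2) smult_closed[OF homogeneous(3) x]]
        note un = multilinearD(1)[OF u]
        show ?thesis unfolding homogeneous(1)
          using w'[THEN b] w'[THEN un] multilinearD(3)[OF u homogeneous(2,3)] homogeneous(3)
          by (simp add: l N.free_eval_basis self)
      qed
      then show "f \<in> ?K" using f tensor_relations_closed by blast
    qed
  qed
  with f show ?thesis by blast
qed

lemma tensor_lift_class:
  assumes f: "f \<in> carrier (TF i)"
  shows "tensor_lift R N u (tensor_class i f) = free_eval R N u f"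
proof -
  interpret F: module R "TF i" by (rule tensor_free_module)
  have uc: "u \<in> TW i \<rightarrow> carrier N" using u by (simp add: multilinear_def)
  have lin: "free_eval R N u \<in> linear_map R (TF i) N"
    unfolding tensor_free_def by (rule N.free_eval_linear[OF uc])
  define g where "g = (SOME g. g \<in> tensor_class i f)"
  have "g \<in> tensor_class i f" unfolding g_def using tensor_class_self[OF f] by (rule someI[where P = "\<lambda>g. g \<in> tensor_class i f"])
  note g = tensor_class_mem[OF f this]
  have "g \<ominus>\<^bsub>TF i\<^esub> f \<in> TN i" using g tensor_class_eq_iff f by blast
  then have "free_eval R N u g \<ominus>\<^bsub>N\<^esub> free_eval R N u f = \<zero>\<^bsub>N\<^esub>"
    using free_eval_null linear_map_minus[OF tensor_free_module N lin g(1) f] by simp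
  then have "free_eval R N u g = free_eval R N u f"
    using linear_mapD(1)[OF lin g(1)] linear_mapD(1)[OF lin f]
      N.M.minus_equality[of "free_eval R N u g" "\<ominus>\<^bsub>N\<^esub> free_eval R N u f"]
    by (simp add: a_minus_def)
  then show ?thesis by (simp add: tensor_lift_def free_eval_def g_def Let_def)
qed

lemma tensor_lift_linear: "tensor_lift R N u \<in> linear_map R (TP i) N"
proof -
  interpret F: module R "TF i" by (rule tensor_free_module)
  have uc: "u \<in> TW i \<rightarrow> carrier N" using u by (simp add: multilinear_def)
  have lin: "free_eval R N u \<in> linear_map R (TF i) N"
    unfolding tensor_free_def by (rule N.free_eval_linear[OF uc])
  note l = linear_mapD[OF lin] and c = linear_mapD[OF tensor_class_linear[of i]]
  show ?thesis
  proof (rule linear_mapI)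
    fix A assume "A \<in> carrier (TP i)"
    then obtain f where f: "f \<in> carrier (TF i)" "A = tensor_class i f" by (rule tensor_power_cases)
    then show "tensor_lift R N u A \<in> carrier N" by (simp add: tensor_lift_class l)
    show "tensor_lift R N u (r \<odot>\<^bsub>TP i\<^esub> A) = r \<odot>\<^bsub>N\<^esub> tensor_lift R N u A" if "r \<in> carrier R" for r
      using that f by (simp add: c(3)[symmetric] tensor_lift_class l)
    fix B assume "B \<in> carrier (TP i)"
    then obtain g where g: "g \<in> carrier (TF i)" "B = tensor_class i g" by (rule tensor_power_cases)
    then show "tensor_lift R N u (A \<oplus>\<^bsub>TP i\<^esub> B) = tensor_lift R N u A \<oplus>\<^bsub>N\<^esub> tensor_lift R N u B"
      using f by (simp add: c(2)[symmetric] tensor_lift_class l)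
  qed
qed

lemma tensor_lift_pure: "as \<in> TW i \<Longrightarrow> tensor_lift R N u (pure_tensor R M as) = u as"
  using multilinearD(1)[OF u]
  by (simp add: pure_tensor_class tensor_lift_class tensor_basis_closed N.free_eval_basis)

end

subsection \<open>The product of the tensor algebra\<close>

lemma tensor_free_closed: "f \<in> carrier (TF i) \<Longrightarrow> f as \<in> carrier R"
  unfolding tensor_free_def by (rule R.free_module_closed)

lemma tensor_conc_closed:
  assumes f: "f \<in> carrier (TF i)" and g: "g \<in> carrier (TF j)"
  shows "tensor_conc R i f g \<in> carrier (TF (i + j))"
proof -
  note fc = tensor_free_closed[OF f] and gc = tensor_free_closed[OF g]
  have f0: "f as = \<zero>" if "as \<notin> TW i" for as
    using f that by (simp add: tensor_free_def free_module_carrier)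
  have g0: "g as = \<zero>" if "as \<notin> TW j" for as
    using g that by (simp add: tensor_free_def free_module_carrier)
  have "tensor_conc R i f g as = \<zero>" if as: "as \<notin> TW (i + j)" for as
  proof (cases "take i as \<in> TW i \<and> drop i as \<in> TW j")
    case True
    then have l: "min (length as) i = i" "length as - i = j"
      by (auto simp: tensor_words_iff)
    have s: "set (take i as @ drop i as) \<subseteq> carrier M"
      using True unfolding set_append by (simp add: tensor_words_iff)
    have "length as = i + j" using l by arith
    moreover have "set as \<subseteq> carrier M" using s by (simp only: append_take_drop_id)
    ultimately show ?thesis using as by (simp add: tensor_words_iff)
  next
    case False
    then have "f (take i as) = \<zero> \<or> g (drop i as) = \<zero>" using f0 g0 by blast
    then show ?thesis using fc gc by (auto simp: tensor_conc_def)
  qed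
  moreover have "finite {as. tensor_conc R i f g as \<noteq> \<zero>}"
  proof (rule finite_subset)
    show "{as. tensor_conc R i f g as \<noteq> \<zero>} \<subseteq>
        (\<lambda>(us, vs). us @ vs) ` ({us. f us \<noteq> \<zero>} \<times> {vs. g vs \<noteq> \<zero>})"
    proof
      fix as assume "as \<in> {as. tensor_conc R i f g as \<noteq> \<zero>}"
      then have "f (take i as) \<noteq> \<zero>" "g (drop i as) \<noteq> \<zero>"
        by (auto simp: tensor_conc_def fc gc)
      then show "as \<in> (\<lambda>(us, vs). us @ vs) ` ({us. f us \<noteq> \<zero>} \<times> {vs. g vs \<noteq> \<zero>})"
        by (intro image_eqI[of _ _ "(take i as, drop i as)"]) auto
    qed
  qed (use f g in \<open>auto simp: tensor_free_def free_module_carrier\<close>)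
  ultimately show ?thesis
    by (simp add: tensor_free_def free_module_carrier) (simp add: tensor_conc_def fc gc)
qed

lemma tensor_conc_linear_left:
  assumes g: "g \<in> carrier (TF j)"
  shows "(\<lambda>f. tensor_conc R i f g) \<in> linear_map R (TF i) (TF (i + j))"
proof (rule linear_mapI)
  note gc = tensor_free_closed[OF g] and fc = tensor_free_closed
  show "tensor_conc R i (f \<oplus>\<^bsub>TF i\<^esub> h) g = tensor_conc R i f g \<oplus>\<^bsub>TF (i + j)\<^esub> tensor_conc R i h g"
    if "f \<in> carrier (TF i)" "h \<in> carrier (TF i)" for f h
    using fc[OF that(1)] fc[OF that(2)] gc
    by (auto simp: tensor_free_def tensor_conc_def R.l_distr)
  show "tensor_conc R i (r \<odot>\<^bsub>TF i\<^esub> f) g = r \<odot>\<^bsub>TF (i + j)\<^esub> tensor_conc R i f g"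
    if "r \<in> carrier R" "f \<in> carrier (TF i)" for r f
    using fc[OF that(2)] gc that(1)
    by (auto simp: tensor_free_def tensor_conc_def R.m_assoc)
qed (use tensor_conc_closed g in auto)

lemma tensor_conc_linear_right:
  assumes f: "f \<in> carrier (TF i)"
  shows "tensor_conc R i f \<in> linear_map R (TF j) (TF (i + j))"
proof (rule linear_mapI)
  note fc = tensor_free_closed[OF f] and gc = tensor_free_closed
  show "tensor_conc R i f (g \<oplus>\<^bsub>TF j\<^esub> h) = tensor_conc R i f g \<oplus>\<^bsub>TF (i + j)\<^esub> tensor_conc R i f h"
    if "g \<in> carrier (TF j)" "h \<in> carrier (TF j)" for g h
    using gc[OF that(1)] gc[OF that(2)] fc
    by (auto simp: tensor_free_def tensor_conc_def R.r_distr)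
  show "tensor_conc R i f (r \<odot>\<^bsub>TF j\<^esub> g) = r \<odot>\<^bsub>TF (i + j)\<^esub> tensor_conc R i f g"
    if "r \<in> carrier R" "g \<in> carrier (TF j)" for r g
    using gc[OF that(2)] fc that(1)
    by (auto simp: tensor_free_def tensor_conc_def R.m_lcomm)
qed (use tensor_conc_closed f in auto)

lemma tensor_conc_basis:
  assumes "length as = i"
  shows "tensor_conc R i (basis_vec R as) (basis_vec R bs) = basis_vec R (as @ bs)"
proof
  fix cs
  have "take i cs = as \<and> drop i cs = bs \<longleftrightarrow> cs = as @ bs"
    using assms append_eq_conv_conj[of as bs cs] by auto
  then show "tensor_conc R i (basis_vec R as) (basis_vec R bs) cs = basis_vec R (as @ bs) cs"
    by (auto simp: tensor_conc_def basis_vec_def)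
qed

lemma tensor_words_append:
  "as \<in> TW i \<Longrightarrow> bs \<in> TW j \<Longrightarrow> as @ bs \<in> TW (i + j)"
  by (auto simp: tensor_words_iff)

text \<open>
  Appending a word to a defining relation gives the relation for the longer word.
\<close>

lemma tensor_conc_relation_left:
  assumes f: "f \<in> tensor_relations R M i" and bs: "bs \<in> TW j"
  shows "tensor_conc R i f (basis_vec R bs) \<in> tensor_relations R M (i + j)"
proof -
  note fm = tensor_free_module[of i] tensor_free_module[of "i + j"]
  interpret F: module R "TF i" by (rule tensor_free_module)
  note lin = tensor_conc_linear_left[OF tensor_basis_closed[OF bs], of i]
  note l = linear_mapD[OF lin] linear_map_minus[OF fm lin]
  note b = tensor_basis_closed
  show ?thesis using f
  proof cases
    case (additive us x vs y)
    then have x: "x \<in> carrier M" by (simp add: tensor_words_iff)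
    note w = tensor_words_replace[OF additive(2)]
    note w' = additive(2) w[OF additive(3)] w[OF M.a_closed[OF x additive(3)]]
    have len: "length as = i" if "as \<in> TW i" for as using that by (simp add: tensor_words_iff)
    have "us @ x # (vs @ bs) \<in> TW (i + j)" using tensor_words_append[OF additive(2) bs] by simp
    from tensor_relations.additive[OF this additive(3), of R] show ?thesis
      unfolding additive(1) using w'[THEN b] w'[THEN len]
      by (simp add: l tensor_conc_basis del: length_append)
  next
    case (homogeneous us x vs r)
    then have x: "x \<in> carrier M" by (simp add: tensor_words_iff)
    note w' = homogeneous(2) tensor_words_replace[OF homogeneous(2) smult_closed[OF homogeneous(3) x]]
    have len: "length as = i" if "as \<in> TW i" for as using that by (simp add: tensor_words_iff)
    have "us @ x # (vs @ bs) \<in> TW (i + j)" using tensor_words_append[OF homogeneous(2) bs] by simp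
    from tensor_relations.homogeneous[OF this homogeneous(3)] show ?thesis
      unfolding homogeneous(1) using w'[THEN b] w'[THEN len] homogeneous(3)
      by (simp add: l tensor_conc_basis del: length_append)
  qed
qed

lemma tensor_conc_relation_right:
  assumes as: "as \<in> TW i" and g: "g \<in> tensor_relations R M j"
  shows "tensor_conc R i (basis_vec R as) g \<in> tensor_relations R M (i + j)"
proof -
  note fm = tensor_free_module[of j] tensor_free_module[of "i + j"]
  interpret F: module R "TF j" by (rule tensor_free_module)
  note lin = tensor_conc_linear_right[OF tensor_basis_closed[OF as], of j]
  note l = linear_mapD[OF lin] linear_map_minus[OF fm lin]
  note b = tensor_basis_closed
  have len: "length as = i" using as by (simp add: tensor_words_iff)
  show ?thesis using g
  proof cases
    case (additive us x vs y)
    then have x: "x \<in> carrier M" by (simp add: tensor_words_iff)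
    note w = tensor_words_replace[OF additive(2)]
    note w' = additive(2) w[OF additive(3)] w[OF M.a_closed[OF x additive(3)]]
    have "(as @ us) @ x # vs \<in> TW (i + j)" using tensor_words_append[OF as additive(2)] by simp
    from tensor_relations.additive[OF this additive(3), of R] show ?thesis
      unfolding additive(1) using w'[THEN b] len by (simp add: l tensor_conc_basis)
  next
    case (homogeneous us x vs r)
    then have x: "x \<in> carrier M" by (simp add: tensor_words_iff)
    note w' = homogeneous(2) tensor_words_replace[OF homogeneous(2) smult_closed[OF homogeneous(3) x]]
    have "(as @ us) @ x # vs \<in> TW (i + j)" using tensor_words_append[OF as homogeneous(2)] by simp
    from tensor_relations.homogeneous[OF this homogeneous(3)] show ?thesis
      unfolding homogeneous(1) using w'[THEN b] len homogeneous(3)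
      by (simp add: l tensor_conc_basis)
  qed
qed

text \<open>
  For a fixed relation the claim extends linearly from words to all \<open>g\<close>, and then, for fixed \<open>g\<close>,
  from relations to the submodule that they span.
\<close>

lemma tensor_conc_null_left:
  assumes f: "f \<in> TN i" and g: "g \<in> carrier (TF j)"
  shows "tensor_conc R i f g \<in> TN (i + j)"
proof -
  note fm = tensor_free_module
  have rel: "tensor_conc R i f g \<in> TN (i + j)" if f: "f \<in> tensor_relations R M i" for f
  proof -
    have fF: "f \<in> carrier (TF i)" using f tensor_relations_closed by blast
    have "g \<in> {g \<in> carrier (TF j). tensor_conc R i f g \<in> TN (i + j)}"
    proof (rule R.free_module_induct[where B = "TW j", folded tensor_free_def])
      show "submodule {g \<in> carrier (TF j). tensor_conc R i f g \<in> TN (i + j)} R (TF j)"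
        by (rule linear_map_vimage_submodule[OF fm fm tensor_conc_linear_right[OF fF] tensor_null_submodule])
    qed (use g tensor_basis_closed tensor_conc_relation_left[OF f] tensor_relations_null in blast)+
    then show ?thesis by blast
  qed
  have "TN i \<subseteq> {f \<in> carrier (TF i). tensor_conc R i f g \<in> TN (i + j)}"
    using rel tensor_relations_closed
    by (intro tensor_null_least linear_map_vimage_submodule[OF fm fm tensor_conc_linear_left[OF g] tensor_null_submodule])
      blast
  then show ?thesis using f by blast
qed

lemma tensor_conc_null_right:
  assumes f: "f \<in> carrier (TF i)" and g: "g \<in> TN j"
  shows "tensor_conc R i f g \<in> TN (i + j)"
proof -
  note fm = tensor_free_module
  have rel: "tensor_conc R i f g \<in> TN (i + j)" if g: "g \<in> tensor_relations R M j" for g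
  proof -
    have gF: "g \<in> carrier (TF j)" using g tensor_relations_closed by blast
    have "f \<in> {f \<in> carrier (TF i). tensor_conc R i f g \<in> TN (i + j)}"
    proof (rule R.free_module_induct[where B = "TW i", folded tensor_free_def])
      show "submodule {f \<in> carrier (TF i). tensor_conc R i f g \<in> TN (i + j)} R (TF i)"
        by (rule linear_map_vimage_submodule[OF fm fm tensor_conc_linear_left[OF gF] tensor_null_submodule])
    qed (use f tensor_basis_closed tensor_conc_relation_right[OF _ g] tensor_relations_null in blast)+
    then show ?thesis by blast
  qed
  have "TN j \<subseteq> {g \<in> carrier (TF j). tensor_conc R i f g \<in> TN (i + j)}"
    using rel tensor_relations_closed
    by (intro tensor_null_least linear_map_vimage_submodule[OF fm fm tensor_conc_linear_right[OF f] tensor_null_submodule])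
      blast
  then show ?thesis using g by blast
qed

text \<open>
  All cosets in the union that defines \<^const>\<open>tensor_mult\<close> coincide, because concatenation with a
  null element on either side is null.
\<close>

lemma tensor_mult_class:
  assumes f: "f \<in> carrier (TF i)" and g: "g \<in> carrier (TF j)"
  shows "tensor_mult R M i j (tensor_class i f) (tensor_class j g) =
    tensor_class (i + j) (tensor_conc R i f g)"
proof -
  note fm = tensor_free_module
  interpret F: module R "TF i" by (rule fm)
  have *: "tensor_class (i + j) (tensor_conc R i f' g') = tensor_class (i + j) (tensor_conc R i f g)"
    if f': "f' \<in> tensor_class i f" and g': "g' \<in> tensor_class j g" for f' g'
  proof -
    note F = tensor_class_mem[OF f f'] and G = tensor_class_mem[OF g g']
    have "f' \<ominus>\<^bsub>TF i\<^esub> f \<in> TN i" "g' \<ominus>\<^bsub>TF j\<^esub> g \<in> TN j"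
      using F G f g tensor_class_eq_iff by blast+
    then have "tensor_conc R i f' g' \<ominus>\<^bsub>TF (i + j)\<^esub> tensor_conc R i f g' \<in> TN (i + j)"
      "tensor_conc R i f g' \<ominus>\<^bsub>TF (i + j)\<^esub> tensor_conc R i f g \<in> TN (i + j)"
      using tensor_conc_null_left[of "f' \<ominus>\<^bsub>TF i\<^esub> f" i g' j] tensor_conc_null_right[of f i "g' \<ominus>\<^bsub>TF j\<^esub> g" j]
        linear_map_minus[OF fm fm tensor_conc_linear_left[OF G(1)] F(1) f]
        linear_map_minus[OF fm fm tensor_conc_linear_right[OF f] G(1) g] F G f g by simp_all
    then show ?thesis using tensor_class_eq_iff tensor_conc_closed F(1) G(1) f g by metis
  qed
  have "tensor_mult R M i j (tensor_class i f) (tensor_class j g) =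
      (\<Union>f'\<in>tensor_class i f. \<Union>g'\<in>tensor_class j g. tensor_class (i + j) (tensor_conc R i f' g'))"
    by (simp only: tensor_mult_def tensor_class_def tensor_conc_def)
  also have "\<dots> = (\<Union>f'\<in>tensor_class i f. \<Union>g'\<in>tensor_class j g. tensor_class (i + j) (tensor_conc R i f g))"
    using * by blast
  also have "\<dots> = tensor_class (i + j) (tensor_conc R i f g)"
    using tensor_class_self[OF f] tensor_class_self[OF g] by blast
  finally show ?thesis .
qed

lemma tensor_mult_pure:
  assumes "as \<in> TW i" "bs \<in> TW j"
  shows "tensor_mult R M i j (pure_tensor R M as) (pure_tensor R M bs) = pure_tensor R M (as @ bs)"
  using assms tensor_words_append[OF assms]
  by (simp add: pure_tensor_class tensor_mult_class tensor_basis_closed tensor_conc_basis tensor_words_iff)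

lemma tensor_mult_linear_left:
  assumes "B \<in> carrier (TP j)"
  shows "(\<lambda>A. tensor_mult R M i j A B) \<in> linear_map R (TP i) (TP (i + j))"
proof -
  obtain g where g: "g \<in> carrier (TF j)" "B = tensor_class j g" using assms by (rule tensor_power_cases)
  note c = linear_mapD[OF tensor_class_linear] and l = linear_mapD[OF tensor_conc_linear_left[OF g(1)]]
  interpret F: module R "TF i" by (rule tensor_free_module)
  show ?thesis unfolding g(2)
  proof (rule linear_mapI)
    fix A assume "A \<in> carrier (TP i)"
    then obtain f where f: "f \<in> carrier (TF i)" "A = tensor_class i f" by (rule tensor_power_cases)
    then show "tensor_mult R M i j A (tensor_class j g) \<in> carrier (TP (i + j))"
      using g by (simp add: tensor_mult_class c l)
    show "tensor_mult R M i j (r \<odot>\<^bsub>TP i\<^esub> A) (tensor_class j g) =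
        r \<odot>\<^bsub>TP (i + j)\<^esub> tensor_mult R M i j A (tensor_class j g)" if "r \<in> carrier R" for r
      using that f g by (simp add: c(3)[symmetric] tensor_mult_class l)
    fix A' assume "A' \<in> carrier (TP i)"
    then obtain f' where f': "f' \<in> carrier (TF i)" "A' = tensor_class i f'" by (rule tensor_power_cases)
    then show "tensor_mult R M i j (A \<oplus>\<^bsub>TP i\<^esub> A') (tensor_class j g) =
        tensor_mult R M i j A (tensor_class j g) \<oplus>\<^bsub>TP (i + j)\<^esub> tensor_mult R M i j A' (tensor_class j g)"
      using f g by (simp add: c(2)[symmetric] tensor_mult_class l)
  qed
qed

lemma tensor_mult_linear_right:
  assumes "A \<in> carrier (TP i)"
  shows "tensor_mult R M i j A \<in> linear_map R (TP j) (TP (i + j))"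
proof -
  obtain f where f: "f \<in> carrier (TF i)" "A = tensor_class i f" using assms by (rule tensor_power_cases)
  note c = linear_mapD[OF tensor_class_linear] and l = linear_mapD[OF tensor_conc_linear_right[OF f(1)]]
  interpret F: module R "TF j" by (rule tensor_free_module)
  show ?thesis unfolding f(2)
  proof (rule linear_mapI)
    fix B assume "B \<in> carrier (TP j)"
    then obtain g where g: "g \<in> carrier (TF j)" "B = tensor_class j g" by (rule tensor_power_cases)
    then show "tensor_mult R M i j (tensor_class i f) B \<in> carrier (TP (i + j))"
      using f by (simp add: tensor_mult_class c l)
    show "tensor_mult R M i j (tensor_class i f) (r \<odot>\<^bsub>TP j\<^esub> B) =
        r \<odot>\<^bsub>TP (i + j)\<^esub> tensor_mult R M i j (tensor_class i f) B" if "r \<in> carrier R" for r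
      using that f g by (simp add: c(3)[symmetric] tensor_mult_class l)
    fix B' assume "B' \<in> carrier (TP j)"
    then obtain g' where g': "g' \<in> carrier (TF j)" "B' = tensor_class j g'" by (rule tensor_power_cases)
    then show "tensor_mult R M i j (tensor_class i f) (B \<oplus>\<^bsub>TP j\<^esub> B') =
        tensor_mult R M i j (tensor_class i f) B \<oplus>\<^bsub>TP (i + j)\<^esub> tensor_mult R M i j (tensor_class i f) B'"
      using f g by (simp add: c(2)[symmetric] tensor_mult_class l)
  qed
qed

end

section \<open>Submodules of a commutative ring over a subring\<close>

lemma mult_module_simps [simp]:
  "carrier (mult_module S Q) = Q"
  "x \<oplus>\<^bsub>mult_module S Q\<^esub> y = x \<oplus>\<^bsub>S\<^esub> y"
  "\<zero>\<^bsub>mult_module S Q\<^esub> = \<zero>\<^bsub>S\<^esub>"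
  "r \<odot>\<^bsub>mult_module S Q\<^esub> x = r \<otimes>\<^bsub>S\<^esub> x"
  "x \<otimes>\<^bsub>mult_module S Q\<^esub> y = x \<otimes>\<^bsub>S\<^esub> y"
  "\<one>\<^bsub>mult_module S Q\<^esub> = \<one>\<^bsub>S\<^esub>"
  by (simp_all add: mult_module_def)

lemma finsum_mult_module [simp]: "finsum (mult_module S (carrier S)) f A = finsum S f A"
  by (simp add: finsum_def finprod_def mult_module_def)

text \<open>
  An \<open>R\<close>-submodule \<open>P\<close> of a commutative ring, for a subring \<open>R\<close>, with the assumptions in terms of the
  ring operations only.
\<close>

locale subring_submodule = S?: cring S
  for S :: "('s, 'z) ring_scheme" (structure) +
  fixes R P :: "'s set"
  assumes subring: "subring R S"
    and P_subset: "P \<subseteq> carrier S"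
    and P_zero: "\<zero> \<in> P"
    and P_add: "x \<in> P \<Longrightarrow> y \<in> P \<Longrightarrow> x \<oplus> y \<in> P"
    and P_smult: "r \<in> R \<Longrightarrow> x \<in> P \<Longrightarrow> r \<otimes> x \<in> P"
begin

abbreviation (input) "RR \<equiv> S\<lparr>carrier := R\<rparr>"
abbreviation (input) "SR \<equiv> mult_module S (carrier S)"
abbreviation (input) "PM \<equiv> mult_module S P"
abbreviation (input) "TT \<equiv> tensor_power RR PM"

lemma R_subset: "R \<subseteq> carrier S"
  by (rule subringE(1)[OF subring])

lemma R_carrier [simp]: "r \<in> R \<Longrightarrow> r \<in> carrier S"
  using R_subset by blast

lemma P_carrier [simp]: "x \<in> P \<Longrightarrow> x \<in> carrier S"
  using P_subset by blast

lemma RR_cring: "cring RR"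
  using subcring_iff[OF R_subset] subcringI'[OF subring] by simp

lemma SR_module: "module RR SR"
proof (rule moduleI)
  show "abelian_group SR"
  proof (rule abelian_groupI)
    fix x assume "x \<in> carrier SR"
    then show "\<exists>y\<in>carrier SR. y \<oplus>\<^bsub>SR\<^esub> x = \<zero>\<^bsub>SR\<^esub>" by (auto intro!: bexI[of _ "\<ominus> x"] simp: S.l_neg)
  qed (auto simp: S.a_ac)
qed (auto simp: RR_cring S.l_distr S.r_distr S.m_assoc)

lemma PM_submodule: "submodule P RR SR"
proof -
  interpret SR: module RR SR by (rule SR_module)
  show ?thesis by (rule SR.submoduleI') (auto simp: P_zero P_add P_smult)
qed

lemma PM_module: "module RR PM"
  using submodule.submodule_is_module[OF PM_submodule SR_module] by (simp add: mult_module_def)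

sublocale T: plain_module RR PM
  using PM_module by (simp add: plain_module_def)

abbreviation (input) "\<mu> \<equiv> mult_map S R"

lemma list_prod_closed: "set as \<subseteq> carrier S \<Longrightarrow> list_prod S as \<in> carrier S"
  by (induction as) (auto simp: list_prod_def)

lemma list_prod_Cons: "list_prod S (a # as) = a \<otimes> list_prod S as"
  by (simp add: list_prod_def)

lemma list_prod_append:
  assumes "set as \<subseteq> carrier S" "set bs \<subseteq> carrier S"
  shows "list_prod S (as @ bs) = list_prod S as \<otimes> list_prod S bs"
  using assms
  by (induction as) (simp_all add: list_prod_Cons list_prod_closed S.m_assoc, simp add: list_prod_def list_prod_closed[unfolded list_prod_def])

lemma tensor_word_carrier: "as \<in> tensor_words PM i \<Longrightarrow> set as \<subseteq> carrier S"
  using P_subset by (auto simp: tensor_words_iff)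

lemma list_prod_multilinear: "multilinear RR PM SR i (list_prod S)"
proof (rule multilinearI)
  show "list_prod S as \<in> carrier SR" if "as \<in> tensor_words PM i" for as
    using that by (simp add: list_prod_closed tensor_word_carrier)
next
  fix us x vs assume w: "us @ x # vs \<in> tensor_words PM i"
  have c: "set us \<subseteq> carrier S" "x \<in> carrier S" "set vs \<subseteq> carrier S"
    using tensor_word_carrier[OF w] by auto
  note c' = c(2) list_prod_closed[OF c(1)] list_prod_closed[OF c(3)]
  note ap = list_prod_append[OF c(1)]
  show "list_prod S (us @ (x \<oplus>\<^bsub>PM\<^esub> y) # vs) = list_prod S (us @ x # vs) \<oplus>\<^bsub>SR\<^esub> list_prod S (us @ y # vs)"
    if "y \<in> carrier PM" for y
    using c c' that by (simp add: ap list_prod_Cons S.l_distr S.r_distr)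
  show "list_prod S (us @ (r \<odot>\<^bsub>PM\<^esub> x) # vs) = r \<odot>\<^bsub>SR\<^esub> list_prod S (us @ x # vs)"
    if "r \<in> carrier RR" for r
    using c c' that by (simp add: ap list_prod_Cons S.m_ac)
qed

lemma mult_map_linear: "\<mu> \<in> linear_map RR (TT i) SR"
  unfolding mult_map_def by (rule T.tensor_lift_linear[OF SR_module list_prod_multilinear])

lemma mult_map_pure: "as \<in> tensor_words PM i \<Longrightarrow> \<mu> (pure_tensor RR PM as) = list_prod S as"
  unfolding mult_map_def by (rule T.tensor_lift_pure[OF SR_module list_prod_multilinear])

lemma mult_map_closed [simp]: "A \<in> carrier (TT i) \<Longrightarrow> \<mu> A \<in> carrier S"
  using linear_mapD(1)[OF mult_map_linear] by simp

lemma mult_map_zero: "\<mu> \<zero>\<^bsub>TT i\<^esub> = \<zero>"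
  using linear_map_zero[OF T.tensor_power_module SR_module mult_map_linear] by simp

lemma mult_linear_left: "s \<in> carrier S \<Longrightarrow> f \<in> linear_map RR L SR \<Longrightarrow> (\<lambda>x. s \<otimes> f x) \<in> linear_map RR L SR"
  by (auto simp: linear_map_def Pi_def S.r_distr S.m_lcomm)

text \<open>
  Both sides are linear in \<open>A\<close> and in \<open>B\<close>, and on pure tensors they are products over a concatenated word.
\<close>

lemma mult_map_tensor_mult:
  assumes A: "A \<in> carrier (TT i)" and B: "B \<in> carrier (TT j)"
  shows "\<mu> (tensor_mult RR PM i j A B) = \<mu> A \<otimes> \<mu> B"
proof -
  have pure: "\<mu> (tensor_mult RR PM i j A (pure_tensor RR PM bs)) = \<mu> A \<otimes> list_prod S bs"
    if bs: "bs \<in> tensor_words PM j" for bs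
  proof -
    have bsc: "list_prod S bs \<in> carrier S" by (rule list_prod_closed[OF tensor_word_carrier[OF bs]])
    have "\<mu> (tensor_mult RR PM i j A (pure_tensor RR PM bs)) = list_prod S bs \<otimes> \<mu> A"
    proof (rule T.tensor_power_linear_eq[OF SR_module _ _ _ A])
      show "(\<lambda>A. \<mu> (tensor_mult RR PM i j A (pure_tensor RR PM bs))) \<in> linear_map RR (TT i) SR"
        by (rule linear_map_comp[OF T.tensor_mult_linear_left[OF T.pure_tensor_closed[OF bs]] mult_map_linear])
      show "(\<lambda>A. list_prod S bs \<otimes> \<mu> A) \<in> linear_map RR (TT i) SR"
        by (rule mult_linear_left[OF bsc mult_map_linear])
      show "\<mu> (tensor_mult RR PM i j (pure_tensor RR PM as) (pure_tensor RR PM bs)) =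
          list_prod S bs \<otimes> \<mu> (pure_tensor RR PM as)" if as: "as \<in> tensor_words PM i" for as
        using as bs T.tensor_words_append[OF as bs]
        by (simp add: T.tensor_mult_pure mult_map_pure list_prod_append tensor_word_carrier
            list_prod_closed S.m_comm)
    qed
    then show ?thesis using A bsc by (simp add: S.m_comm)
  qed
  show ?thesis
  proof (rule T.tensor_power_linear_eq[OF SR_module _ _ _ B])
    show "(\<lambda>B. \<mu> (tensor_mult RR PM i j A B)) \<in> linear_map RR (TT j) SR"
      by (rule linear_map_comp[OF T.tensor_mult_linear_right[OF A] mult_map_linear])
    show "(\<lambda>B. \<mu> A \<otimes> \<mu> B) \<in> linear_map RR (TT j) SR"
      by (rule mult_linear_left[OF _ mult_map_linear]) (use A in simp)
  qed (use pure mult_map_pure in auto)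
qed

section \<open>Reduction modulo \<open>\<phi>\<close>\<close>

definition mult_compatible :: "nat \<Rightarrow> (('s list \<Rightarrow> 's) set \<Rightarrow> 's) \<Rightarrow> bool"
  where "mult_compatible n \<phi> \<longleftrightarrow> (\<forall>as. as \<in> tensor_words PM n \<longrightarrow> \<phi> (pure_tensor RR PM as) = list_prod S as)"

context
  fixes n and \<phi> :: "('s list \<Rightarrow> 's) set \<Rightarrow> 's"
  assumes \<phi>: "\<phi> \<in> linear_map RR (TT n) (mult_module S R)" and n_pos: "n > 0"
begin

abbreviation (input) "contract_word i as \<equiv>
  \<phi> (pure_tensor RR PM (take n as)) \<odot>\<^bsub>TT (i - n)\<^esub> pure_tensor RR PM (drop n as)"

lemma take_drop_words:
  assumes "as \<in> tensor_words PM i" "n \<le> i"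
  shows "take n as \<in> tensor_words PM n" "drop n as \<in> tensor_words PM (i - n)"
  using assms set_take_subset[of n as] set_drop_subset[of n as] by (auto simp: tensor_words_iff)

lemma contract_multilinear:
  assumes "n \<le> i"
  shows "multilinear RR PM (TT (i - n)) i (contract_word i)"
proof (rule multilinearI)
  interpret TP: module RR "TT (i - n)" by (rule T.tensor_power_module)
  note \<phi>' = linear_mapD[OF \<phi>]
  note pn = T.pure_tensor_multilinear[of n] and pi = T.pure_tensor_multilinear[of "i - n"]
  note tw = take_drop_words[OF _ assms]
  have \<phi>c: "\<phi> (pure_tensor RR PM (take n as)) \<in> carrier RR" if "as \<in> tensor_words PM i" for as
    using \<phi>'(1)[OF T.pure_tensor_closed[OF tw(1)[OF that]]] by simp
  have pc: "pure_tensor RR PM (drop n as) \<in> carrier (TT (i - n))" if "as \<in> tensor_words PM i" for as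
    by (rule T.pure_tensor_closed[OF tw(2)[OF that]])
  show "contract_word i as \<in> carrier (TT (i - n))" if "as \<in> tensor_words PM i" for as
    using \<phi>c[OF that] pc[OF that] by (rule TP.smult_closed)
  \<comment> \<open>Linearity in one letter comes from \<open>\<phi>\<close> if it is among the first \<open>n\<close>, else from the remaining tensor.\<close>
  show "contract_word i (us @ (x \<oplus>\<^bsub>PM\<^esub> y) # vs) =
      contract_word i (us @ x # vs) \<oplus>\<^bsub>TT (i - n)\<^esub> contract_word i (us @ y # vs)"
    if w: "us @ x # vs \<in> tensor_words PM i" and y: "y \<in> carrier PM" for us x vs y
  proof -
    note w2 = T.tensor_words_replace[OF w y]
    show ?thesis
    proof (cases "length us < n")
      case True
      then obtain k where k: "n - length us = Suc k" by (metis Suc_diff_Suc)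
      have t: "take n (us @ z # vs) = us @ z # take k vs" "drop n (us @ z # vs) = drop k vs" for z
        using True k by auto
      show ?thesis
        using multilinearD(2)[OF pn tw(1)[OF w, unfolded t] y] \<phi>c[OF w] \<phi>c[OF w2] pc[OF w]
          T.pure_tensor_closed[OF tw(1)[OF w]] T.pure_tensor_closed[OF tw(1)[OF w2]]
          TP.smult_l_distr[OF \<phi>c[OF w] \<phi>c[OF w2] pc[OF w]]
        unfolding t by (simp add: \<phi>'(2))
    next
      case False
      then have t: "take n (us @ z # vs) = take n us" "drop n (us @ z # vs) = drop n us @ z # vs" for z
        by auto
      show ?thesis
        using multilinearD(2)[OF pi tw(2)[OF w, unfolded t] y]
          TP.smult_r_distr[OF \<phi>c[OF w] pc[OF w] pc[OF w2]]
        unfolding t by simp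
    qed
  qed
  show "contract_word i (us @ (r \<odot>\<^bsub>PM\<^esub> x) # vs) = r \<odot>\<^bsub>TT (i - n)\<^esub> contract_word i (us @ x # vs)"
    if w: "us @ x # vs \<in> tensor_words PM i" and r: "r \<in> carrier RR" for us x vs r
  proof (cases "length us < n")
    case True
    then obtain k where k: "n - length us = Suc k" by (metis Suc_diff_Suc)
    have t: "take n (us @ z # vs) = us @ z # take k vs" "drop n (us @ z # vs) = drop k vs" for z
      using True k by auto
    show ?thesis
      using multilinearD(3)[OF pn tw(1)[OF w, unfolded t] r] \<phi>c[OF w] pc[OF w]
        \<phi>'(3)[OF r T.pure_tensor_closed[OF tw(1)[OF w]]] r
        TP.smult_assoc1[OF r \<phi>c[OF w] pc[OF w]]
      unfolding t by simp
  next
    case False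
    then have t: "take n (us @ z # vs) = take n us" "drop n (us @ z # vs) = drop n us @ z # vs" for z
      by auto
    have comm: "r \<odot>\<^bsub>TT (i - n)\<^esub> (s \<odot>\<^bsub>TT (i - n)\<^esub> A) = s \<odot>\<^bsub>TT (i - n)\<^esub> (r \<odot>\<^bsub>TT (i - n)\<^esub> A)"
      if "s \<in> carrier RR" "A \<in> carrier (TT (i - n))" for s A
      using TP.smult_assoc1[OF r that] TP.smult_assoc1[OF that(1) r that(2)] r that(1) by (simp add: S.m_comm)
    show ?thesis
      using multilinearD(3)[OF pi tw(2)[OF w, unfolded t] r] comm[OF \<phi>c[OF w] pc[OF w]]
      unfolding t by simp
  qed
qed

lemma contract_linear: "n \<le> i \<Longrightarrow> contract RR PM n \<phi> i \<in> linear_map RR (TT i) (TT (i - n))"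
  unfolding contract_def by (rule T.tensor_lift_linear[OF T.tensor_power_module contract_multilinear])

text \<open>
  Contraction replaces the first \<open>n\<close> letters of a word by the scalar \<open>\<phi>\<close>, which here is their product.
\<close>

lemma mult_map_contract:
  assumes i: "n \<le> i" and A: "A \<in> carrier (TT i)" and comp: "mult_compatible n \<phi>"
  shows "\<mu> (contract RR PM n \<phi> i A) = \<mu> A"
proof (rule T.tensor_power_linear_eq[OF SR_module _ mult_map_linear _ A])
  show "(\<lambda>A. \<mu> (contract RR PM n \<phi> i A)) \<in> linear_map RR (TT i) SR"
    by (rule linear_map_comp[OF contract_linear[OF i] mult_map_linear])
  fix as assume as: "as \<in> tensor_words PM i"
  note tw = take_drop_words[OF as i]
  have "contract RR PM n \<phi> i (pure_tensor RR PM as) = contract_word i as"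
    unfolding contract_def
    by (rule T.tensor_lift_pure[OF T.tensor_power_module contract_multilinear[OF i] as])
  also have "\<mu> \<dots> = \<phi> (pure_tensor RR PM (take n as)) \<otimes> \<mu> (pure_tensor RR PM (drop n as))"
    using linear_mapD(3)[OF mult_map_linear, of "\<phi> (pure_tensor RR PM (take n as))"]
      linear_mapD(1)[OF \<phi> T.pure_tensor_closed[OF tw(1)]] T.pure_tensor_closed[OF tw(2)] by simp
  also have "\<dots> = list_prod S (take n as) \<otimes> list_prod S (drop n as)"
    using comp tw by (simp add: mult_compatible_def mult_map_pure)
  also have "\<dots> = list_prod S as"
    using list_prod_append[OF tensor_word_carrier[OF tw(1)] tensor_word_carrier[OF tw(2)]] by simp
  finally show "\<mu> (contract RR PM n \<phi> i (pure_tensor RR PM as)) = \<mu> (pure_tensor RR PM as)"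
    using as by (simp add: mult_map_pure)
qed

text \<open>
  Each contraction lowers the degree by \<open>n\<close>, so the result is homogeneous of degree \<open>i mod n\<close>;
  a tensor of degree less than \<open>n\<close> stays as it is.
\<close>

lemma reduce_eq_inj:
  assumes "A \<in> carrier (TT i)"
  obtains A' where "A' \<in> carrier (TT (i mod n))" "reduce RR PM n \<phi> i A = ds_inj TT (i mod n) A'"
    "i < n \<or> mult_compatible n \<phi> \<Longrightarrow> \<mu> A' = \<mu> A"
proof -
  have "\<exists>A'\<in>carrier (TT (i mod n)). reduce RR PM n \<phi> i A = ds_inj TT (i mod n) A' \<and>
      (i < n \<or> mult_compatible n \<phi> \<longrightarrow> \<mu> A' = \<mu> A)"
    using assms
  proof (induction i arbitrary: A rule: less_induct)
    case (less i)
    show ?case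
    proof (cases "i < n")
      case True
      then show ?thesis using less.prems by (auto simp: reduce.simps[of _ _ _ _ i])
    next
      case False
      then have i: "n \<le> i" by simp
      have c: "contract RR PM n \<phi> i A \<in> carrier (TT (i - n))"
        by (rule linear_mapD(1)[OF contract_linear[OF i] less.prems])
      have r: "reduce RR PM n \<phi> i A = reduce RR PM n \<phi> (i - n) (contract RR PM n \<phi> i A)"
        using False n_pos by (subst reduce.simps) simp
      have "i - n < i" "(i - n) mod n = i mod n" using i n_pos by (auto simp: le_mod_geq)
      then show ?thesis
        using less.IH[OF _ c] False mult_map_contract[OF i less.prems] unfolding r by auto
    qed
  qed
  then show ?thesis using that by blast
qed

end

end

section \<open>Direct sums\<close>

lemma direct_sum_simps [simp]:
  "\<zero>\<^bsub>direct_sum T I\<^esub> = (\<lambda>i. \<zero>\<^bsub>T i\<^esub>)"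
  "x \<oplus>\<^bsub>direct_sum T I\<^esub> y = (\<lambda>i. x i \<oplus>\<^bsub>T i\<^esub> y i)"
  "r \<odot>\<^bsub>direct_sum T I\<^esub> x = (\<lambda>i. r \<odot>\<^bsub>T i\<^esub> x i)"
  by (simp_all add: direct_sum_def)

lemma direct_sum_carrier:
  "x \<in> carrier (direct_sum T I) \<longleftrightarrow>
    (\<forall>i\<in>I. x i \<in> carrier (T i)) \<and> (\<forall>i. i \<notin> I \<longrightarrow> x i = \<zero>\<^bsub>T i\<^esub>) \<and> finite {i. x i \<noteq> \<zero>\<^bsub>T i\<^esub>}"
  by (simp add: direct_sum_def)

context
  fixes R :: "('r, 'z) ring_scheme" and T :: "'i \<Rightarrow> ('r, 'm) module"
  assumes T: "\<And>i. module R (T i)"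
begin

interpretation T: module R "T i" for i by (rule T)

lemma direct_sum_component: "x \<in> carrier (direct_sum T I) \<Longrightarrow> x i \<in> carrier (T i)"
  by (cases "i \<in> I") (auto simp: direct_sum_carrier)

lemma direct_sum_module: "module R (direct_sum T I)"
proof (rule moduleI)
  let ?D = "direct_sum T I"
  note c = direct_sum_component[of _ I]
  have add: "x \<oplus>\<^bsub>?D\<^esub> y \<in> carrier ?D" if "x \<in> carrier ?D" "y \<in> carrier ?D" for x y
  proof -
    have "{i. x i \<oplus>\<^bsub>T i\<^esub> y i \<noteq> \<zero>\<^bsub>T i\<^esub>} \<subseteq> {i. x i \<noteq> \<zero>\<^bsub>T i\<^esub>} \<union> {i. y i \<noteq> \<zero>\<^bsub>T i\<^esub>}" by auto
    then have "finite {i. x i \<oplus>\<^bsub>T i\<^esub> y i \<noteq> \<zero>\<^bsub>T i\<^esub>}"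
      using that by (auto simp: direct_sum_carrier intro: finite_subset)
    then show ?thesis using that by (auto simp: direct_sum_carrier)
  qed
  show smult: "a \<odot>\<^bsub>?D\<^esub> x \<in> carrier ?D" if "a \<in> carrier R" "x \<in> carrier ?D" for a x
  proof -
    have "{i. a \<odot>\<^bsub>T i\<^esub> x i \<noteq> \<zero>\<^bsub>T i\<^esub>} \<subseteq> {i. x i \<noteq> \<zero>\<^bsub>T i\<^esub>}" using that(1) by auto
    then have "finite {i. a \<odot>\<^bsub>T i\<^esub> x i \<noteq> \<zero>\<^bsub>T i\<^esub>}"
      using that by (auto simp: direct_sum_carrier intro: finite_subset)
    then show ?thesis using that by (auto simp: direct_sum_carrier)
  qed
  show "cring R" using T module.axioms(1) by blast
  have zero: "\<zero>\<^bsub>?D\<^esub> \<in> carrier ?D" by (simp add: direct_sum_carrier)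
  show "abelian_group ?D"
  proof (rule abelian_groupI)
    fix x assume x: "x \<in> carrier ?D"
    have "(\<ominus>\<^bsub>R\<^esub> \<one>\<^bsub>R\<^esub>) \<odot>\<^bsub>?D\<^esub> x \<oplus>\<^bsub>?D\<^esub> x = \<zero>\<^bsub>?D\<^esub>"
      using c[OF x] by (auto simp: T.smult_l_minus T.M.l_neg)
    then show "\<exists>y\<in>carrier ?D. y \<oplus>\<^bsub>?D\<^esub> x = \<zero>\<^bsub>?D\<^esub>"
      using smult[OF _ x, of "\<ominus>\<^bsub>R\<^esub> \<one>\<^bsub>R\<^esub>"] by blast
  qed (use add zero c in \<open>simp_all add: T.M.a_ac\<close>)
qed (use direct_sum_component[of _ I] in \<open>auto intro!: ext simp: T.smult_l_distr T.smult_r_distr T.smult_assoc1\<close>)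

lemma ds_inj_closed:
  assumes "a \<in> carrier (T i)" "i \<in> I"
  shows "ds_inj T i a \<in> carrier (direct_sum T I)"
proof -
  have "{j. ds_inj T i a j \<noteq> \<zero>\<^bsub>T j\<^esub>} \<subseteq> {i}" by (auto simp: ds_inj_def)
  then have "finite {j. ds_inj T i a j \<noteq> \<zero>\<^bsub>T j\<^esub>}" by (rule finite_subset) simp
  then show ?thesis using assms by (auto simp: direct_sum_carrier ds_inj_def)
qed

end

lemma saturated_zero: "saturated n I \<Longrightarrow> 0 \<in> I"
  using subgroup.one_closed[of "int ` I" "integer_mod_group n"]
  by (auto simp: saturated_def)

lemma saturated_add_mod:
  assumes "saturated n I" "i \<in> I" "j \<in> I"
  shows "(i + j) mod n \<in> I"
proof -
  have "(int i + int j) mod int n \<in> int ` I"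
    using subgroup.m_closed[of "int ` I" "integer_mod_group n" "int i" "int j"] assms
    by (auto simp: saturated_def)
  then have "int ((i + j) mod n) \<in> int ` I" by (simp add: of_nat_mod)
  then show ?thesis by auto
qed

context subring_submodule
begin

section \<open>The map induced on the direct sum\<close>

abbreviation (input) "DS \<equiv> direct_sum TT"

lemma tensor_component_closed:
  "x \<in> carrier (DS I) \<Longrightarrow> x i \<in> carrier (TT i)"
  by (rule direct_sum_component[OF T.tensor_power_module])

lemma mult_map_component_closed: "x \<in> carrier (DS I) \<Longrightarrow> \<mu> (x i) \<in> carrier S"
  by (rule mult_map_closed[OF tensor_component_closed])

lemma lambda_map_linear:
  assumes "finite I"
  shows "lambda_map S R I \<in> linear_map RR (DS I) SR"
proof (rule linear_mapI)
  note c = tensor_component_closed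
  note m = linear_mapD[OF mult_map_linear]
  have \<mu>c: "(\<lambda>i. \<mu> (x i)) \<in> I \<rightarrow> carrier S" if "x \<in> carrier (DS I)" for x
    using mult_map_component_closed[OF that] by auto
  show "lambda_map S R I x \<in> carrier SR" if "x \<in> carrier (DS I)" for x
    using \<mu>c[OF that] by (simp add: lambda_map_def)
  show "lambda_map S R I (x \<oplus>\<^bsub>DS I\<^esub> y) = lambda_map S R I x \<oplus>\<^bsub>SR\<^esub> lambda_map S R I y"
    if x: "x \<in> carrier (DS I)" and y: "y \<in> carrier (DS I)" for x y
    using \<mu>c[OF x] \<mu>c[OF y] c[OF x] c[OF y] by (simp add: lambda_map_def S.finsum_addf m)
  show "lambda_map S R I (r \<odot>\<^bsub>DS I\<^esub> x) = r \<odot>\<^bsub>SR\<^esub> lambda_map S R I x"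
    if r: "r \<in> carrier RR" and x: "x \<in> carrier (DS I)" for r x
    using \<mu>c[OF x] r c[OF x] assms by (simp add: lambda_map_def m S.finsum_rdistr)
qed

text \<open>
  The product of the radical extension is computed in degrees \<open>{..<n}\<close>, so its values are
  first evaluated with that index set.
\<close>

lemma lambda_map_superset:
  assumes "finite J" "I \<subseteq> J" "x \<in> carrier (DS I)"
  shows "lambda_map S R J x = lambda_map S R I x"
  unfolding lambda_map_def
proof (rule S.add.finprod_mono_neutral_cong_left[symmetric])
  show "\<mu> (x i) = \<zero>" if "i \<in> J - I" for i
    using that assms(3) by (simp add: direct_sum_carrier mult_map_zero)
qed (use assms mult_map_component_closed[OF assms(3)] in auto)

lemma lambda_map_inj:
  assumes "finite I" "i \<in> I" "a \<in> carrier (TT i)"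
  shows "lambda_map S R I (ds_inj TT i a) = \<mu> a"
proof -
  have "lambda_map S R I (ds_inj TT i a) = (\<Oplus>j\<in>I. if i = j then \<mu> a else \<zero>)"
    unfolding lambda_map_def
    by (rule S.finsum_cong') (use assms in \<open>auto simp: ds_inj_def mult_map_zero\<close>)
  also have "\<dots> = \<mu> a"
    using S.add.finprod_singleton[OF assms(2,1), of "\<lambda>_. \<mu> a"] assms(3) by auto
  finally show ?thesis .
qed

section \<open>Multiplicativity\<close>

lemma tensor_algebra_mult_closed:
  assumes "x \<in> carrier (DS I)" "y \<in> carrier (DS J)"
  shows "tensor_algebra_mult RR PM x y l \<in> carrier (TT l)"
    "\<mu> (tensor_algebra_mult RR PM x y l) = (\<Oplus>i\<in>{..l}. \<mu> (x i) \<otimes> \<mu> (y (l - i)))"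
proof -
  note c = tensor_component_closed
  interpret TP: module RR "TT l" by (rule T.tensor_power_module)
  have tc: "tensor_mult RR PM i (l - i) (x i) (y (l - i)) \<in> carrier (TT l)" if "i \<le> l" for i
    using linear_mapD(1)[OF T.tensor_mult_linear_left[OF c[OF assms(2), of "l - i"], of i] c[OF assms(1)]] that
    by simp
  then show "tensor_algebra_mult RR PM x y l \<in> carrier (TT l)"
    unfolding tensor_algebra_mult_def by (intro TP.finsum_closed) auto
  have "\<mu> (tensor_algebra_mult RR PM x y l) =
      (\<Oplus>\<^bsub>SR\<^esub>i\<in>{..l}. \<mu> (tensor_mult RR PM i (l - i) (x i) (y (l - i))))"
    unfolding tensor_algebra_mult_def
    by (rule linear_map_finsum[OF T.tensor_power_module SR_module mult_map_linear]) (use tc in auto)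
  also have "\<dots> = (\<Oplus>i\<in>{..l}. \<mu> (x i) \<otimes> \<mu> (y (l - i)))"
    unfolding finsum_mult_module
    by (rule S.finsum_cong') (use c[OF assms(1)] c[OF assms(2)] mult_map_component_closed[OF assms(1)] mult_map_component_closed[OF assms(2)] in
        \<open>auto simp: mult_map_tensor_mult\<close>)
  finally show "\<mu> (tensor_algebra_mult RR PM x y l) = (\<Oplus>i\<in>{..l}. \<mu> (x i) \<otimes> \<mu> (y (l - i)))" .
qed

lemma tensor_algebra_mult_support:
  assumes x: "x \<in> carrier (DS I)" and y: "y \<in> carrier (DS J)"
    and nz: "tensor_algebra_mult RR PM x y l \<noteq> \<zero>\<^bsub>TT l\<^esub>"
  obtains i j where "i \<in> I" "j \<in> J" "l = i + j"
proof -
  note c = tensor_component_closed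
  note tm = T.tensor_power_module
  interpret TP: module RR "TT l" by (rule tm)
  have "\<exists>i\<le>l. i \<in> I \<and> l - i \<in> J"
  proof (rule ccontr)
    assume *: "\<not> ?thesis"
    have "tensor_mult RR PM i (l - i) (x i) (y (l - i)) = \<zero>\<^bsub>TT l\<^esub>" if i: "i \<in> {..l}" for i
    proof (cases "i \<in> I")
      case False
      then have "x i = \<zero>\<^bsub>TT i\<^esub>" using x by (simp add: direct_sum_carrier)
      then show ?thesis
        using linear_map_zero[OF tm tm T.tensor_mult_linear_left[OF c[OF y, of "l - i"], of i]] i by simp
    next
      case True
      then have "y (l - i) = \<zero>\<^bsub>TT (l - i)\<^esub>" using y * i by (simp add: direct_sum_carrier)
      then show ?thesis
        using linear_map_zero[OF tm tm T.tensor_mult_linear_right[OF c[OF x, of i], of "l - i"]] i by simp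
    qed
    then have "tensor_algebra_mult RR PM x y l = \<zero>\<^bsub>TT l\<^esub>"
      unfolding tensor_algebra_mult_def by (rule TP.M.add.finprod_one_eqI)
    with nz show False by contradiction
  qed
  then show ?thesis using that by (metis le_add_diff_inverse)
qed

context
  fixes n \<phi> I
  assumes \<phi>: "\<phi> \<in> linear_map RR (TT n) (mult_module S R)" and I: "saturated n I" and n_pos: "n > 0"
    and comp: "I = {0} \<or> mult_compatible n \<phi>"
begin

abbreviation (input) "SQ \<equiv> radical_extension RR PM n \<phi> I"

lemma radical_extension_carrier: "carrier SQ = carrier (DS I)"
  by (simp add: radical_extension_def)

text \<open>
  A product of homogeneous elements of degrees \<open>i\<close> and \<open>j\<close> in \<open>I\<close> is reduced to degree
  \<open>(i + j) mod n\<close>, which is again in \<open>I\<close>.  If \<open>I = {0}\<close>, then \<open>i + j = 0 < n\<close>; so in both cases the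
  reduction preserves the value under the multiplication map, and the formula is the Cauchy product
  of two finite sums.
\<close>

lemma radical_mult:
  assumes x: "x \<in> carrier (DS I)" and y: "y \<in> carrier (DS I)"
  shows "x \<otimes>\<^bsub>SQ\<^esub> y \<in> carrier (DS I)"
    and "lambda_map S R I (x \<otimes>\<^bsub>SQ\<^esub> y) = lambda_map S R I x \<otimes> lambda_map S R I y"
proof -
  note c = tensor_component_closed
  note dm = direct_sum_module[OF T.tensor_power_module]
  define z where "z = tensor_algebra_mult RR PM x y"
  have I_sub: "I \<subseteq> {..<n}" using I by (simp add: saturated_def)
  define Z where "Z = {l. z l \<noteq> \<zero>\<^bsub>TT l\<^esub>}"
  have Z: "\<exists>i\<in>I. \<exists>j\<in>I. l = i + j" if "l \<in> Z" for l
    using tensor_algebra_mult_support[OF x y, of l] that unfolding Z_def z_def by blast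
  \<comment> \<open>The bound \<open>n - 1\<close> on both degrees is the form in which the Cauchy product formula is applied.\<close>
  have Z_le: "Z \<subseteq> {..(n - 1) + (n - 1)}"
  proof
    fix l assume "l \<in> Z"
    then obtain i j where "i \<in> I" "j \<in> I" "l = i + j" using Z by blast
    moreover from this I_sub have "i < n" "j < n" by auto
    ultimately show "l \<in> {..(n - 1) + (n - 1)}" by simp
  qed
  then have Z_fin: "finite Z" by (rule finite_subset) simp
  have zc: "z l \<in> carrier (TT l)" for l
    unfolding z_def by (rule tensor_algebra_mult_closed(1)[OF x y])
  have xy: "x \<otimes>\<^bsub>SQ\<^esub> y = (\<Oplus>\<^bsub>DS {..<n}\<^esub>l\<in>Z. reduce RR PM n \<phi> l (z l))"
    by (simp add: radical_extension_def phi_tilde_def Z_def z_def)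
  have red: "reduce RR PM n \<phi> l (z l) \<in> carrier (DS I) \<and>
      lambda_map S R {..<n} (reduce RR PM n \<phi> l (z l)) = \<mu> (z l)" if l: "l \<in> Z" for l
  proof -
    obtain A where A: "A \<in> carrier (TT (l mod n))" "reduce RR PM n \<phi> l (z l) = ds_inj TT (l mod n) A"
      "l < n \<or> mult_compatible n \<phi> \<Longrightarrow> \<mu> A = \<mu> (z l)"
      using reduce_eq_inj[OF \<phi> n_pos zc] by metis
    have "l mod n \<in> I" using Z[OF l] saturated_add_mod[OF I] by auto
    moreover have "l < n \<or> mult_compatible n \<phi>" using Z[OF l] comp n_pos by auto
    ultimately show ?thesis using A ds_inj_closed[where T = TT, OF T.tensor_power_module A(1)] I_sub
      by (auto simp: lambda_map_inj)
  qed
  interpret D: module RR "DS {..<n}" by (rule dm)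
  interpret DI: module RR "DS I" by (rule dm)
  have sub: "carrier (DS I) \<subseteq> carrier (DS {..<n})"
    using I_sub c by (fastforce simp: direct_sum_carrier)
  show xyc: "x \<otimes>\<^bsub>SQ\<^esub> y \<in> carrier (DS I)" unfolding xy
  proof (rule D.finsum_closed_under[OF Z_fin _ sub])
    show "\<zero>\<^bsub>DS {..<n}\<^esub> \<in> carrier (DS I)" using DI.zero_closed by simp
    show "a \<oplus>\<^bsub>DS {..<n}\<^esub> b \<in> carrier (DS I)" if "a \<in> carrier (DS I)" "b \<in> carrier (DS I)" for a b
      using DI.M.a_closed[OF that] by simp
  qed (use red in auto)
  have \<mu>x: "\<mu> (x i) \<in> carrier S" and \<mu>y: "\<mu> (y i) \<in> carrier S" for i
    using mult_map_component_closed x y by blast+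
  have x0: "\<mu> (x i) = \<zero>" and y0: "\<mu> (y i) = \<zero>" if "n - 1 < i" for i
  proof -
    have "i \<notin> I" using that I_sub by auto
    then show "\<mu> (x i) = \<zero>" "\<mu> (y i) = \<zero>"
      using x y by (simp_all add: direct_sum_carrier mult_map_zero)
  qed
  have n1: "{..n - 1} = {..<n}" using n_pos by auto
  have "lambda_map S R I (x \<otimes>\<^bsub>SQ\<^esub> y) = lambda_map S R {..<n} (x \<otimes>\<^bsub>SQ\<^esub> y)"
    using I_sub xyc by (simp add: lambda_map_superset)
  also have "\<dots> = (\<Oplus>\<^bsub>SR\<^esub>l\<in>Z. lambda_map S R {..<n} (reduce RR PM n \<phi> l (z l)))"
    unfolding xy
    by (rule linear_map_finsum[OF dm SR_module lambda_map_linear[OF finite_lessThan] Z_fin]) (use red sub in auto)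
  also have "\<dots> = (\<Oplus>l\<in>Z. \<mu> (z l))"
    unfolding finsum_mult_module by (rule S.finsum_cong') (use red mult_map_closed[OF zc] in auto)
  also have "\<dots> = (\<Oplus>l\<in>{..(n - 1) + (n - 1)}. \<mu> (z l))"
    by (rule S.add.finprod_mono_neutral_cong_left) (use Z_le mult_map_closed[OF zc] in \<open>auto simp: Z_def mult_map_zero\<close>)
  also have "\<dots> = (\<Oplus>l\<in>{..(n - 1) + (n - 1)}. \<Oplus>i\<in>{..l}. \<mu> (x i) \<otimes> \<mu> (y (l - i)))"
    unfolding z_def tensor_algebra_mult_closed(2)[OF x y] ..
  also have "\<dots> = (\<Oplus>i\<in>{..n - 1}. \<mu> (x i)) \<otimes> (\<Oplus>i\<in>{..n - 1}. \<mu> (y i))"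
    by (rule S.cauchy_product) (use x0 y0 \<mu>x \<mu>y in auto)
  also have "\<dots> = lambda_map S R {..<n} x \<otimes> lambda_map S R {..<n} y"
    unfolding lambda_map_def n1 ..
  also have "\<dots> = lambda_map S R I x \<otimes> lambda_map S R I y"
    using I_sub x y by (simp add: lambda_map_superset)
  finally show "lambda_map S R I (x \<otimes>\<^bsub>SQ\<^esub> y) = lambda_map S R I x \<otimes> lambda_map S R I y" .
qed

lemma lambda_map_ring_hom: "lambda_map S R I \<in> ring_hom SQ SR"
proof (rule ring_hom_memI)
  have fin: "finite I" using I finite_subset by (auto simp: saturated_def)
  have e: "[] \<in> tensor_words PM 0" by (simp add: tensor_words_iff)
  show "lambda_map S R I x \<in> carrier SR" if "x \<in> carrier SQ" for x
    using linear_mapD(1)[OF lambda_map_linear[OF fin]] that radical_extension_carrier by blast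
  show "lambda_map S R I (x \<otimes>\<^bsub>SQ\<^esub> y) = lambda_map S R I x \<otimes>\<^bsub>SR\<^esub> lambda_map S R I y"
    if "x \<in> carrier SQ" "y \<in> carrier SQ" for x y
    using radical_mult(2) that by (simp add: radical_extension_carrier)
  show "lambda_map S R I (x \<oplus>\<^bsub>SQ\<^esub> y) = lambda_map S R I x \<oplus>\<^bsub>SR\<^esub> lambda_map S R I y"
    if "x \<in> carrier SQ" "y \<in> carrier SQ" for x y
    using linear_mapD(2)[OF lambda_map_linear[OF fin]] that
    unfolding radical_extension_carrier by (simp add: radical_extension_def)
  show "lambda_map S R I \<one>\<^bsub>SQ\<^esub> = \<one>\<^bsub>SR\<^esub>"
    using lambda_map_inj[OF fin saturated_zero[OF I] T.pure_tensor_closed[OF e]] mult_map_pure[OF e]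
    by (simp add: radical_extension_def list_prod_def)
qed

end

end

section \<open>Tensor powers of an invertible submodule\<close>

text \<open>
  A dual pair \<open>a\<close>, \<open>b\<close> makes \<open>P\<close> an invertible module: \<open>Q i\<close> plays the part of the \<open>i\<close>-th power of \<open>P\<close>, and
  the elements \<open>b s\<close> belong to its inverse, so that they lower the degree.
\<close>

locale invertible_powers = subring_submodule S R P
  for S :: "('s, 'z) ring_scheme" (structure) and R P :: "'s set" +
  fixes Q :: "nat \<Rightarrow> 's set" and L :: "'i set" and a b :: "'i \<Rightarrow> 's"
  assumes Q_0: "Q 0 = R" and Q_1: "Q (Suc 0) = P"
    and Q_submodule: "submodule (Q i) (S\<lparr>carrier := R\<rparr>) (mult_module S (carrier S))"
    and Q_mult: "p \<in> P \<Longrightarrow> q \<in> Q i \<Longrightarrow> p \<otimes> q \<in> Q (Suc i)"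
    and L_finite: "finite L"
    and a_closed: "s \<in> L \<Longrightarrow> a s \<in> P"
    and b_closed: "s \<in> L \<Longrightarrow> b s \<in> carrier S"
    and b_mult: "s \<in> L \<Longrightarrow> q \<in> Q (Suc i) \<Longrightarrow> b s \<otimes> q \<in> Q i"
    and dual: "(\<Oplus>s\<in>L. a s \<otimes> b s) = \<one>"
begin

lemma Q_carrier: "q \<in> Q i \<Longrightarrow> q \<in> carrier S"
  using module.submoduleE(1)[OF SR_module Q_submodule] by auto

lemma b_mult_P: "s \<in> L \<Longrightarrow> p \<in> P \<Longrightarrow> b s \<otimes> p \<in> R"
  using b_mult[of s p 0] by (simp add: Q_0 Q_1)

lemma dual_expand:
  assumes "x \<in> carrier S"
  shows "(\<Oplus>s\<in>L. a s \<otimes> (b s \<otimes> x)) = x"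
proof -
  have "(\<Oplus>s\<in>L. a s \<otimes> (b s \<otimes> x)) = (\<Oplus>s\<in>L. a s \<otimes> b s \<otimes> x)"
    by (rule S.finsum_cong') (use assms a_closed b_closed in \<open>auto simp: S.m_assoc\<close>)
  also have "\<dots> = (\<Oplus>s\<in>L. a s \<otimes> b s) \<otimes> x"
    by (rule S.finsum_ldistr[symmetric]) (use L_finite assms a_closed b_closed in auto)
  finally show ?thesis using assms by (simp add: dual)
qed

abbreviation (input) "drop_word s i as \<equiv> (b s \<otimes> hd as) \<odot>\<^bsub>TT i\<^esub> pure_tensor RR PM (tl as)"

text \<open>
  Contraction of the first factor with \<open>b s\<close>.
\<close>

definition tensor_drop :: "'i \<Rightarrow> nat \<Rightarrow> ('s list \<Rightarrow> 's) set \<Rightarrow> ('s list \<Rightarrow> 's) set"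
  where "tensor_drop s i = tensor_lift RR (TT i) (drop_word s i)"

lemma drop_multilinear:
  assumes s: "s \<in> L"
  shows "multilinear RR PM (TT i) (Suc i) (drop_word s i)"
proof (rule multilinearI)
  interpret TP: module RR "TT i" by (rule T.tensor_power_module)
  have hd: "hd as \<in> P" "tl as \<in> tensor_words PM i" if "as \<in> tensor_words PM (Suc i)" for as
    using that by (cases as; auto simp: tensor_words_iff)+
  have hc: "b s \<otimes> hd as \<in> carrier RR" if "as \<in> tensor_words PM (Suc i)" for as
    using b_mult_P[OF s] hd(1)[OF that] by simp
  have pc: "pure_tensor RR PM (tl as) \<in> carrier (TT i)" if "as \<in> tensor_words PM (Suc i)" for as
    by (rule T.pure_tensor_closed[OF hd(2)[OF that]])
  show "drop_word s i as \<in> carrier (TT i)" if "as \<in> tensor_words PM (Suc i)" for as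
    using hc[OF that] pc[OF that] by (rule TP.smult_closed)
  fix us x vs assume w: "us @ x # vs \<in> tensor_words PM (Suc i)"
  then have x: "x \<in> P" by (simp add: tensor_words_iff)
  show "drop_word s i (us @ (x \<oplus>\<^bsub>PM\<^esub> y) # vs) =
      drop_word s i (us @ x # vs) \<oplus>\<^bsub>TT i\<^esub> drop_word s i (us @ y # vs)"
    if y: "y \<in> carrier PM" for y
  proof (cases us)
    case Nil
    then show ?thesis
      using TP.smult_l_distr[of "b s \<otimes> x" "b s \<otimes> y" "pure_tensor RR PM vs"]
        b_mult_P[OF s] pc[OF w] x y b_closed[OF s] by (simp add: S.r_distr)
  next
    case (Cons u us')
    then have w': "us' @ x # vs \<in> tensor_words PM i" using w by (simp add: tensor_words_iff)
    show ?thesis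
      using Cons multilinearD(2)[OF T.pure_tensor_multilinear w' y] hc[OF w]
        T.pure_tensor_closed[OF w'] T.pure_tensor_closed[OF T.tensor_words_replace[OF w' y]]
      by (simp add: TP.smult_r_distr)
  qed
  show "drop_word s i (us @ (r \<odot>\<^bsub>PM\<^esub> x) # vs) = r \<odot>\<^bsub>TT i\<^esub> drop_word s i (us @ x # vs)"
    if r: "r \<in> carrier RR" for r
  proof (cases us)
    case Nil
    then show ?thesis
      using TP.smult_assoc1[of r "b s \<otimes> x" "pure_tensor RR PM vs"]
        b_mult_P[OF s] pc[OF w] x r b_closed[OF s] by (simp add: S.m_lcomm)
  next
    case (Cons u us')
    then have w': "us' @ x # vs \<in> tensor_words PM i" using w by (simp add: tensor_words_iff)
    have c: "b s \<otimes> u \<in> carrier RR" using hc[OF w] Cons by simp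
    have "(b s \<otimes> u) \<odot>\<^bsub>TT i\<^esub> (r \<odot>\<^bsub>TT i\<^esub> A) = r \<odot>\<^bsub>TT i\<^esub> ((b s \<otimes> u) \<odot>\<^bsub>TT i\<^esub> A)"
      if "A \<in> carrier (TT i)" for A
      using TP.smult_assoc1[OF c r that] TP.smult_assoc1[OF r c that] r c by (simp add: S.m_comm)
    then show ?thesis
      using Cons multilinearD(3)[OF T.pure_tensor_multilinear w' r] T.pure_tensor_closed[OF w'] by simp
  qed
qed

lemma tensor_drop_linear: "s \<in> L \<Longrightarrow> tensor_drop s i \<in> linear_map RR (TT (Suc i)) (TT i)"
  unfolding tensor_drop_def by (rule T.tensor_lift_linear[OF T.tensor_power_module drop_multilinear])

lemma tensor_drop_pure:
  "s \<in> L \<Longrightarrow> as \<in> tensor_words PM (Suc i) \<Longrightarrow> tensor_drop s i (pure_tensor RR PM as) = drop_word s i as"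
  unfolding tensor_drop_def by (rule T.tensor_lift_pure[OF T.tensor_power_module drop_multilinear])

lemma tensor_words_Suc:
  assumes "as \<in> tensor_words PM (Suc i)"
  obtains p ws where "as = p # ws" "p \<in> P" "ws \<in> tensor_words PM i"
  using assms by (cases as) (auto simp: tensor_words_iff)

lemma mult_map_drop:
  assumes s: "s \<in> L" and A: "A \<in> carrier (TT (Suc i))"
  shows "\<mu> (tensor_drop s i A) = b s \<otimes> \<mu> A"
proof (rule T.tensor_power_linear_eq[OF SR_module _ _ _ A])
  show "(\<lambda>A. \<mu> (tensor_drop s i A)) \<in> linear_map RR (TT (Suc i)) SR"
    by (rule linear_map_comp[OF tensor_drop_linear[OF s] mult_map_linear])
  show "(\<lambda>A. b s \<otimes> \<mu> A) \<in> linear_map RR (TT (Suc i)) SR"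
    by (rule mult_linear_left[OF b_closed[OF s] mult_map_linear])
  fix as assume as: "as \<in> tensor_words PM (Suc i)"
  then obtain p ws where p: "as = p # ws" "p \<in> P" "ws \<in> tensor_words PM i" by (rule tensor_words_Suc)
  show "\<mu> (tensor_drop s i (pure_tensor RR PM as)) = b s \<otimes> \<mu> (pure_tensor RR PM as)"
    using linear_mapD(3)[OF mult_map_linear[of i], of "b s \<otimes> p" "pure_tensor RR PM ws"]
      T.pure_tensor_closed[OF p(3)] b_mult_P[OF s p(2)] b_closed[OF s] p as
      list_prod_closed[OF tensor_word_carrier[OF p(3)]]
    by (simp add: tensor_drop_pure[OF s] mult_map_pure[OF as[unfolded p(1)]] mult_map_pure[OF p(3)]
        list_prod_Cons S.m_assoc)
qed

lemma Cons_linear: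
  assumes ws: "ws \<in> tensor_words PM i"
  shows "(\<lambda>x. pure_tensor RR PM (x # ws)) \<in> linear_map RR PM (TT (Suc i))"
proof (rule linear_mapI)
  have w: "[] @ x # ws \<in> tensor_words PM (Suc i)" if "x \<in> P" for x
    using that ws by (simp add: tensor_words_iff)
  show "pure_tensor RR PM (x # ws) \<in> carrier (TT (Suc i))" if "x \<in> carrier PM" for x
    using T.pure_tensor_closed[OF w[of x]] that by simp
  show "pure_tensor RR PM ((x \<oplus>\<^bsub>PM\<^esub> y) # ws) =
      pure_tensor RR PM (x # ws) \<oplus>\<^bsub>TT (Suc i)\<^esub> pure_tensor RR PM (y # ws)"
    if "x \<in> carrier PM" "y \<in> carrier PM" for x y
    using multilinearD(2)[OF T.pure_tensor_multilinear w[of x], of y] that by simp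
  show "pure_tensor RR PM ((r \<odot>\<^bsub>PM\<^esub> x) # ws) = r \<odot>\<^bsub>TT (Suc i)\<^esub> pure_tensor RR PM (x # ws)"
    if "r \<in> carrier RR" "x \<in> carrier PM" for r x
    using multilinearD(3)[OF T.pure_tensor_multilinear w[of x], of r] that by simp
qed

lemma finsum_PM:
  assumes "f \<in> L \<rightarrow> P"
  shows "(\<Oplus>\<^bsub>PM\<^esub>s\<in>L. f s) = (\<Oplus>s\<in>L. f s)"
proof -
  have "(\<lambda>x. x) \<in> linear_map RR PM SR" by (rule linear_mapI) auto
  from linear_map_finsum[OF PM_module SR_module this L_finite] assms show ?thesis by simp
qed

lemma singleton_word: "x \<in> P \<Longrightarrow> [x] \<in> tensor_words PM 1"
  by (simp add: tensor_words_iff)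

lemma tensor_mult_drop_linear:
  "s \<in> L \<Longrightarrow> (\<lambda>A. tensor_mult RR PM 1 i (pure_tensor RR PM [a s]) (tensor_drop s i A))
    \<in> linear_map RR (TT (Suc i)) (TT (Suc i))"
  using linear_map_comp[OF tensor_drop_linear
      T.tensor_mult_linear_right[OF T.pure_tensor_closed[OF singleton_word[OF a_closed]]]]
  by simp

text \<open>
  For a pure tensor with first factor \<open>p\<close> the scalars \<open>b s \<otimes> p\<close> lie in \<open>R\<close>; they can be moved into the
  first factor, where they give the expansion of \<open>p\<close> in the elements \<open>a s\<close>.
\<close>

lemma tensor_dual_expand:
  assumes A: "A \<in> carrier (TT (Suc i))"
  shows "(\<Oplus>\<^bsub>TT (Suc i)\<^esub>s\<in>L. tensor_mult RR PM 1 i (pure_tensor RR PM [a s]) (tensor_drop s i A)) = A"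
proof (rule T.tensor_power_linear_eq[OF T.tensor_power_module _ _ _ A])
  note tm = T.tensor_power_module
  show "(\<lambda>A. \<Oplus>\<^bsub>TT (Suc i)\<^esub>s\<in>L. tensor_mult RR PM 1 i (pure_tensor RR PM [a s]) (tensor_drop s i A))
      \<in> linear_map RR (TT (Suc i)) (TT (Suc i))"
    by (rule linear_map_sum[OF tm tm L_finite tensor_mult_drop_linear])
  show "(\<lambda>A. A) \<in> linear_map RR (TT (Suc i)) (TT (Suc i))" by (rule linear_mapI) auto
  interpret TP: module RR "TT (Suc i)" by (rule tm)
  fix as assume as: "as \<in> tensor_words PM (Suc i)"
  then obtain p ws where p: "as = p # ws" "p \<in> P" "ws \<in> tensor_words PM i" by (rule tensor_words_Suc)
  have bp: "b s \<otimes> p \<otimes> a s \<in> P" if "s \<in> L" for s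
    by (rule P_smult[OF b_mult_P[OF that p(2)] a_closed[OF that]])
  have "(\<Oplus>\<^bsub>TT (Suc i)\<^esub>s\<in>L. tensor_mult RR PM 1 i (pure_tensor RR PM [a s]) (tensor_drop s i (pure_tensor RR PM as)))
    = (\<Oplus>\<^bsub>TT (Suc i)\<^esub>s\<in>L. pure_tensor RR PM ((b s \<otimes> p \<otimes> a s) # ws))"
  proof (rule TP.M.finsum_cong'[OF refl])
    show "(\<lambda>s. pure_tensor RR PM ((b s \<otimes> p \<otimes> a s) # ws)) \<in> L \<rightarrow> carrier (TT (Suc i))"
      using linear_mapD(1)[OF Cons_linear[OF p(3)]] bp by simp
    fix s assume s: "s \<in> L"
    note l = linear_mapD(3)[OF T.tensor_mult_linear_right[OF T.pure_tensor_closed[OF singleton_word[OF a_closed[OF s]]], of i],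
        of "b s \<otimes> p" "pure_tensor RR PM ws"]
    have "tensor_mult RR PM 1 i (pure_tensor RR PM [a s]) (tensor_drop s i (pure_tensor RR PM as)) =
        tensor_mult RR PM 1 i (pure_tensor RR PM [a s]) ((b s \<otimes> p) \<odot>\<^bsub>TT i\<^esub> pure_tensor RR PM ws)"
      using tensor_drop_pure[OF s as] p(1) by simp
    also have "\<dots> = (b s \<otimes> p) \<odot>\<^bsub>TT (Suc i)\<^esub> pure_tensor RR PM (a s # ws)"
      using l b_mult_P[OF s p(2)] T.pure_tensor_closed[OF p(3)]
        T.tensor_mult_pure[OF singleton_word[OF a_closed[OF s]] p(3)] by simp
    also have "\<dots> = pure_tensor RR PM ((b s \<otimes> p \<otimes> a s) # ws)"
      using linear_mapD(3)[OF Cons_linear[OF p(3)], of "b s \<otimes> p" "a s"] b_mult_P[OF s p(2)] a_closed[OF s] by simp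
    finally show "tensor_mult RR PM 1 i (pure_tensor RR PM [a s]) (tensor_drop s i (pure_tensor RR PM as)) =
        pure_tensor RR PM ((b s \<otimes> p \<otimes> a s) # ws)" .
  qed
  also have "\<dots> = pure_tensor RR PM ((\<Oplus>\<^bsub>PM\<^esub>s\<in>L. b s \<otimes> p \<otimes> a s) # ws)"
    by (rule linear_map_finsum[OF PM_module tm Cons_linear[OF p(3)] L_finite, symmetric]) (use bp in simp)
  also have "(\<Oplus>\<^bsub>PM\<^esub>s\<in>L. b s \<otimes> p \<otimes> a s) = (\<Oplus>s\<in>L. b s \<otimes> p \<otimes> a s)"
    by (rule finsum_PM) (use bp in simp)
  also have "\<dots> = (\<Oplus>s\<in>L. a s \<otimes> (b s \<otimes> p))"
    by (rule S.finsum_cong') (use p(2) a_closed b_closed in \<open>auto simp: S.m_comm\<close>)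
  also have "\<dots> = p" by (rule dual_expand) (use p(2) in simp)
  finally show "(\<Oplus>\<^bsub>TT (Suc i)\<^esub>s\<in>L. tensor_mult RR PM 1 i (pure_tensor RR PM [a s]) (tensor_drop s i (pure_tensor RR PM as)))
      = pure_tensor RR PM as"
    by (simp add: p(1))
qed

lemma tensor_power_0_cases:
  assumes "A \<in> carrier (TT 0)"
  obtains r where "r \<in> R" "A = r \<odot>\<^bsub>TT 0\<^esub> pure_tensor RR PM []"
proof -
  interpret TP: module RR "TT 0" by (rule T.tensor_power_module)
  have e: "[] \<in> tensor_words PM 0" by (simp add: tensor_words_iff)
  note ec = T.pure_tensor_closed[OF e]
  let ?H = "{r \<odot>\<^bsub>TT 0\<^esub> pure_tensor RR PM [] | r. r \<in> R}"
  have "submodule ?H RR (TT 0)"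
  proof (rule TP.submoduleI')
    show "?H \<subseteq> carrier (TT 0)" using ec TP.smult_closed by auto
    show "\<zero>\<^bsub>TT 0\<^esub> \<in> ?H"
      using TP.smult_l_null[OF ec] subringE(2)[OF subring] by force
    show "x \<oplus>\<^bsub>TT 0\<^esub> y \<in> ?H" if "x \<in> ?H" "y \<in> ?H" for x y
    proof -
      from that obtain r r' where *: "r \<in> R" "r' \<in> R" "x = r \<odot>\<^bsub>TT 0\<^esub> pure_tensor RR PM []"
        "y = r' \<odot>\<^bsub>TT 0\<^esub> pure_tensor RR PM []" by blast
      then show ?thesis using TP.smult_l_distr[of r r', OF _ _ ec] subringE(7)[OF subring, of r r'] by auto
    qed
    show "c \<odot>\<^bsub>TT 0\<^esub> x \<in> ?H" if "c \<in> carrier RR" "x \<in> ?H" for c x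
    proof -
      from that obtain r where *: "r \<in> R" "c \<in> R" "x = r \<odot>\<^bsub>TT 0\<^esub> pure_tensor RR PM []" by auto
      then show ?thesis using TP.smult_assoc1[of c r, OF _ _ ec] subringE(6)[OF subring, of c r] by auto
    qed
  qed
  moreover have "pure_tensor RR PM as \<in> ?H" if "as \<in> tensor_words PM 0" for as
    using that TP.smult_one[OF ec] subringE(3)[OF subring] by (force simp: tensor_words_iff)
  ultimately have "A \<in> ?H" using T.tensor_power_induct assms by blast
  then show ?thesis using that by blast
qed

lemma mult_map_scalar: "r \<in> R \<Longrightarrow> \<mu> (r \<odot>\<^bsub>TT 0\<^esub> pure_tensor RR PM []) = r"
proof -
  have e: "[] \<in> tensor_words PM 0" by (simp add: tensor_words_iff)
  show "r \<in> R \<Longrightarrow> \<mu> (r \<odot>\<^bsub>TT 0\<^esub> pure_tensor RR PM []) = r"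
    using linear_mapD(3)[OF mult_map_linear _ T.pure_tensor_closed[OF e], of r]
    by (simp add: mult_map_pure[OF e] list_prod_def)
qed

text \<open>
  If \<open>\<mu>\<close> kills \<open>A\<close>, it kills all contractions of \<open>A\<close>, which have lower degree and therefore vanish; and \<open>A\<close>
  is expanded in its contractions.
\<close>

lemma mult_map_kernel:
  assumes "A \<in> carrier (TT i)" "\<mu> A = \<zero>"
  shows "A = \<zero>\<^bsub>TT i\<^esub>"
  using assms
proof (induction i arbitrary: A)
  case 0
  interpret TP: module RR "TT 0" by (rule T.tensor_power_module)
  have e: "[] \<in> tensor_words PM 0" by (simp add: tensor_words_iff)
  obtain r where "r \<in> R" "A = r \<odot>\<^bsub>TT 0\<^esub> pure_tensor RR PM []"
    using 0(1) by (rule tensor_power_0_cases)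
  then show ?case using mult_map_scalar 0(2) TP.smult_l_null[OF T.pure_tensor_closed[OF e]] by simp
next
  case (Suc i)
  interpret TP: module RR "TT (Suc i)" by (rule T.tensor_power_module)
  have "tensor_mult RR PM 1 i (pure_tensor RR PM [a s]) (tensor_drop s i A) = \<zero>\<^bsub>TT (Suc i)\<^esub>"
    if s: "s \<in> L" for s
  proof -
    have "tensor_drop s i A = \<zero>\<^bsub>TT i\<^esub>"
      by (rule Suc.IH) (use linear_mapD(1)[OF tensor_drop_linear[OF s] Suc.prems(1)]
          mult_map_drop[OF s Suc.prems(1)] Suc.prems(2) b_closed[OF s] in auto)
    then show ?thesis
      using linear_map_zero[OF T.tensor_power_module T.tensor_power_module
          T.tensor_mult_linear_right[OF T.pure_tensor_closed[OF singleton_word[OF a_closed[OF s]]], of i]] by simp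
  qed
  then have "(\<Oplus>\<^bsub>TT (Suc i)\<^esub>s\<in>L. tensor_mult RR PM 1 i (pure_tensor RR PM [a s]) (tensor_drop s i A)) =
      \<zero>\<^bsub>TT (Suc i)\<^esub>"
    by (rule TP.M.add.finprod_one_eqI)
  then show ?case using tensor_dual_expand[OF Suc.prems(1)] by simp
qed

text \<open>
  Surjectivity uses the same expansion in \<open>S\<close>: \<open>q\<close> is the sum of the products of \<open>a s\<close> with the elements
  \<open>b s \<otimes> q\<close> of degree one less.
\<close>

lemma mult_map_image: "\<mu> ` carrier (TT i) = Q i"
proof
  have "list_prod S as \<in> Q (length as)" if "set as \<subseteq> P" for as
    using that
  proof (induction as)
    case Nil
    then show ?case using subringE(3)[OF subring] by (simp add: list_prod_def Q_0)
  qed (simp add: list_prod_Cons Q_mult)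
  then have pure: "list_prod S as \<in> Q i" if "as \<in> tensor_words PM i" for as
    using that by (auto simp: tensor_words_iff)
  show "\<mu> ` carrier (TT i) \<subseteq> Q i"
  proof (rule image_subsetI)
    fix A assume A: "A \<in> carrier (TT i)"
    have "A \<in> {A \<in> carrier (TT i). \<mu> A \<in> Q i}"
      by (rule T.tensor_power_induct[OF linear_map_vimage_submodule[OF T.tensor_power_module SR_module
              mult_map_linear Q_submodule] _ A])
        (use pure T.pure_tensor_closed in \<open>simp add: mult_map_pure\<close>)
    then show "\<mu> A \<in> Q i" by simp
  qed
  show "Q i \<subseteq> \<mu> ` carrier (TT i)"
  proof
    fix q assume "q \<in> Q i"
    then show "q \<in> \<mu> ` carrier (TT i)"
    proof (induction i arbitrary: q)
      case 0
      interpret TP: module RR "TT 0" by (rule T.tensor_power_module)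
      have e: "[] \<in> tensor_words PM 0" by (simp add: tensor_words_iff)
      show ?case
        using 0 mult_map_scalar[of q] TP.smult_closed[OF _ T.pure_tensor_closed[OF e], of q]
        by (auto simp: Q_0 intro!: image_eqI[of _ _ "q \<odot>\<^bsub>TT 0\<^esub> pure_tensor RR PM []"])
    next
      case (Suc i)
      interpret TP: module RR "TT (Suc i)" by (rule T.tensor_power_module)
      have "\<forall>s\<in>L. \<exists>B\<in>carrier (TT i). \<mu> B = b s \<otimes> q"
      proof
        fix s assume "s \<in> L"
        then have "b s \<otimes> q \<in> \<mu> ` carrier (TT i)" by (intro Suc.IH b_mult Suc.prems)
        then show "\<exists>B\<in>carrier (TT i). \<mu> B = b s \<otimes> q" by auto
      qed
      then obtain B where B: "\<And>s. s \<in> L \<Longrightarrow> B s \<in> carrier (TT i)" "\<And>s. s \<in> L \<Longrightarrow> \<mu> (B s) = b s \<otimes> q"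
        by metis
      let ?t = "\<lambda>s. tensor_mult RR PM 1 i (pure_tensor RR PM [a s]) (B s)"
      have tc: "?t s \<in> carrier (TT (Suc i))" if "s \<in> L" for s
        using linear_mapD(1)[OF T.tensor_mult_linear_right[OF T.pure_tensor_closed[OF singleton_word[OF a_closed[OF that]]]]
            B(1)[OF that]] by simp
      have t\<mu>: "\<mu> (?t s) = a s \<otimes> (b s \<otimes> q)" if "s \<in> L" for s
        using mult_map_tensor_mult[OF T.pure_tensor_closed[OF singleton_word[OF a_closed[OF that]]] B(1)[OF that]]
          B(2)[OF that] mult_map_pure[OF singleton_word[OF a_closed[OF that]]] a_closed[OF that]
        by (simp add: list_prod_def)
      have "\<mu> (\<Oplus>\<^bsub>TT (Suc i)\<^esub>s\<in>L. ?t s) = (\<Oplus>\<^bsub>SR\<^esub>s\<in>L. \<mu> (?t s))"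
        by (rule linear_map_finsum[OF T.tensor_power_module SR_module mult_map_linear L_finite])
          (use tc in auto)
      also have "\<dots> = (\<Oplus>s\<in>L. a s \<otimes> (b s \<otimes> q))"
        unfolding finsum_mult_module
        by (rule S.finsum_cong') (use t\<mu> a_closed b_closed Q_carrier[OF Suc.prems] in auto)
      also have "\<dots> = q" by (rule dual_expand[OF Q_carrier[OF Suc.prems]])
      finally show ?case
        by (intro image_eqI[OF _ TP.finsum_closed]) (use tc in auto)
    qed
  qed
qed

lemma mult_map_bij: "bij_betw \<mu> (carrier (TT i)) (Q i)"
proof -
  interpret TP: module RR "TT i" by (rule T.tensor_power_module)
  note lin = mult_map_linear[of i]
  have "inj_on \<mu> (carrier (TT i))"
  proof (rule inj_onI)
    fix A B assume AB: "A \<in> carrier (TT i)" "B \<in> carrier (TT i)" "\<mu> A = \<mu> B"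
    have "\<mu> (A \<ominus>\<^bsub>TT i\<^esub> B) = \<mu> A \<ominus>\<^bsub>SR\<^esub> \<mu> B"
      by (rule linear_map_minus[OF T.tensor_power_module SR_module lin AB(1,2)])
    also have "\<dots> = \<zero>"
    proof -
      interpret SR: module RR SR by (rule SR_module)
      show ?thesis using SR.M.r_neg[of "\<mu> B"] AB by (simp add: a_minus_def)
    qed
    finally have "A \<ominus>\<^bsub>TT i\<^esub> B = \<zero>\<^bsub>TT i\<^esub>" using AB by (intro mult_map_kernel) auto
    then show "A = B"
      using TP.M.minus_equality[of A "\<ominus>\<^bsub>TT i\<^esub> B"] AB by (simp add: a_minus_def)
  qed
  then show ?thesis using mult_map_image by (simp add: bij_betw_def)
qed

text \<open>
  The map factors into the bijection \<open>\<Psi>\<close> onto the families with components in \<open>Q i\<close> and the summation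
  \<open>\<sigma>\<close> of such families.
\<close>

lemma lambda_map_bij_iff:
  assumes fin: "finite I"
  shows "bij_betw (lambda_map S R I) (carrier (DS I)) (carrier S) \<longleftrightarrow>
    (\<forall>x\<in>carrier S. \<exists>!c. c \<in> (\<Pi>\<^sub>E i\<in>I. Q i) \<and> x = (\<Oplus>i\<in>I. c i))"
proof -
  let ?\<Psi> = "\<lambda>x. restrict (\<lambda>i. \<mu> (x i)) I" and ?\<sigma> = "\<lambda>c. \<Oplus>i\<in>I. c i"
  have \<Psi>: "bij_betw ?\<Psi> (carrier (DS I)) (\<Pi>\<^sub>E i\<in>I. Q i)"
  proof (rule bij_betwI')
    fix x y assume x: "x \<in> carrier (DS I)" and y: "y \<in> carrier (DS I)"
    show "?\<Psi> x = ?\<Psi> y \<longleftrightarrow> x = y"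
    proof
      assume eq: "?\<Psi> x = ?\<Psi> y"
      show "x = y"
      proof
        fix i show "x i = y i"
        proof (cases "i \<in> I")
          case True
          then have "\<mu> (x i) = \<mu> (y i)" using fun_cong[OF eq, of i] by simp
          then show ?thesis
            using bij_betw_imp_inj_on[OF mult_map_bij] tensor_component_closed x y by (meson inj_onD)
        qed (use x y in \<open>simp add: direct_sum_carrier\<close>)
      qed
    qed simp
  next
    fix x assume "x \<in> carrier (DS I)"
    then have "\<mu> (x i) \<in> Q i" for i
      unfolding mult_map_image[symmetric] by (intro imageI tensor_component_closed)
    then show "?\<Psi> x \<in> (\<Pi>\<^sub>E i\<in>I. Q i)" by (simp add: PiE_iff)
  next
    fix c assume c: "c \<in> (\<Pi>\<^sub>E i\<in>I. Q i)"
    have "\<forall>i\<in>I. \<exists>A\<in>carrier (TT i). \<mu> A = c i"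
    proof
      fix i assume "i \<in> I"
      then have "c i \<in> \<mu> ` carrier (TT i)" using c mult_map_image by auto
      then show "\<exists>A\<in>carrier (TT i). \<mu> A = c i" by auto
    qed
    then obtain A where A: "\<And>i. i \<in> I \<Longrightarrow> A i \<in> carrier (TT i)" "\<And>i. i \<in> I \<Longrightarrow> \<mu> (A i) = c i"
      by metis
    define x where "x = (\<lambda>i. if i \<in> I then A i else \<zero>\<^bsub>TT i\<^esub>)"
    have "finite {i. x i \<noteq> \<zero>\<^bsub>TT i\<^esub>}" by (rule finite_subset[OF _ fin]) (auto simp: x_def)
    then have "x \<in> carrier (DS I)" using A by (auto simp: direct_sum_carrier x_def)
    moreover have "c = ?\<Psi> x"
    proof
      show "c i = ?\<Psi> x i" for i
        by (cases "i \<in> I") (simp_all add: A(2) x_def PiE_arb[OF c])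
    qed
    ultimately show "\<exists>x\<in>carrier (DS I). c = ?\<Psi> x" by blast
  qed
  have \<sigma>c: "?\<sigma> c \<in> carrier S" if "c \<in> (\<Pi>\<^sub>E i\<in>I. Q i)" for c
    using that Q_carrier by (intro S.finsum_closed) (auto simp: PiE_iff)
  have "bij_betw (lambda_map S R I) (carrier (DS I)) (carrier S) \<longleftrightarrow>
      bij_betw (?\<sigma> \<circ> ?\<Psi>) (carrier (DS I)) (carrier S)"
  proof (rule bij_betw_cong)
    fix x assume "x \<in> carrier (DS I)"
    then show "lambda_map S R I x = (?\<sigma> \<circ> ?\<Psi>) x"
      unfolding lambda_map_def comp_def
      by (intro S.finsum_cong') (auto simp: mult_map_component_closed)
  qed
  also have "\<dots> \<longleftrightarrow> bij_betw ?\<sigma> (\<Pi>\<^sub>E i\<in>I. Q i) (carrier S)"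
    by (rule bij_betw_comp_iff[OF \<Psi>, symmetric])
  also have "\<dots> \<longleftrightarrow> (\<forall>x\<in>carrier S. \<exists>!c. c \<in> (\<Pi>\<^sub>E i\<in>I. Q i) \<and> x = ?\<sigma> c)"
  proof
    assume b: "bij_betw ?\<sigma> (\<Pi>\<^sub>E i\<in>I. Q i) (carrier S)"
    show "\<forall>x\<in>carrier S. \<exists>!c. c \<in> (\<Pi>\<^sub>E i\<in>I. Q i) \<and> x = ?\<sigma> c"
    proof
      fix x assume "x \<in> carrier S"
      then obtain c where "c \<in> (\<Pi>\<^sub>E i\<in>I. Q i)" "x = ?\<sigma> c"
        using bij_betw_imp_surj_on[OF b] by blast
      then show "\<exists>!c. c \<in> (\<Pi>\<^sub>E i\<in>I. Q i) \<and> x = ?\<sigma> c"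
        using inj_onD[OF bij_betw_imp_inj_on[OF b]] by blast
    qed
  next
    assume u: "\<forall>x\<in>carrier S. \<exists>!c. c \<in> (\<Pi>\<^sub>E i\<in>I. Q i) \<and> x = ?\<sigma> c"
    show "bij_betw ?\<sigma> (\<Pi>\<^sub>E i\<in>I. Q i) (carrier S)"
      by (rule bij_betwI') (use u \<sigma>c in metis)+
  qed
  finally show ?thesis .
qed

end

section \<open>An ideal \<open>J\<close> with \<open>S = J S\<close>\<close>

lemma (in abelian_monoid) finsum_swap:
  assumes "finite A" "finite B" "\<And>i j. i \<in> A \<Longrightarrow> j \<in> B \<Longrightarrow> f i j \<in> carrier G"
  shows "(\<Oplus>i\<in>A. \<Oplus>j\<in>B. f i j) = (\<Oplus>j\<in>B. \<Oplus>i\<in>A. f i j)"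
  using assms(1,3)
proof (induction A)
  case empty
  then show ?case by simp
next
  case (insert x A)
  have "(\<Oplus>j\<in>B. \<Oplus>i\<in>insert x A. f i j) = (\<Oplus>j\<in>B. f x j \<oplus> (\<Oplus>i\<in>A. f i j))"
    by (rule finsum_cong') (use insert in \<open>auto simp: Pi_def\<close>)
  also have "\<dots> = (\<Oplus>j\<in>B. f x j) \<oplus> (\<Oplus>j\<in>B. \<Oplus>i\<in>A. f i j)"
    by (rule finsum_addf) (use insert in \<open>auto simp: Pi_def\<close>)
  finally show ?case using insert by (simp add: Pi_def)
qed

context cring
begin

text \<open>
  Nakayama's lemma for a finitely generated extension ring, by elimination instead of determinants.
  The factor \<open>r\<close>, congruent to \<open>1\<close> modulo \<open>J\<close>, records that \<open>r S\<close> is contained in the span with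
  coefficients in \<open>J\<close> of the remaining generators \<open>x i\<close>.  If no generator is left, then \<open>r = r \<otimes> 1 = 0\<close>,
  and therefore \<open>1 \<in> J\<close>.
\<close>

lemma nakayama_unit:
  assumes sub: "subring K R" and J_sub: "J \<subseteq> K" and J_zero: "\<zero> \<in> J"
    and J_add: "\<And>i j. i \<in> J \<Longrightarrow> j \<in> J \<Longrightarrow> i \<oplus> j \<in> J"
    and J_mult: "\<And>r j. r \<in> K \<Longrightarrow> j \<in> J \<Longrightarrow> r \<otimes> j \<in> J"
    and A: "finite A" and x: "x \<in> A \<rightarrow> carrier R"
    and r: "r \<in> K" "\<one> \<ominus> r \<in> J"
    and span: "\<And>s. s \<in> carrier R \<Longrightarrow> \<exists>c. c \<in> A \<rightarrow> J \<and> r \<otimes> s = (\<Oplus>i\<in>A. c i \<otimes> x i)"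
  shows "\<one> \<in> J"
  using A x r span
proof (induction A arbitrary: r rule: finite_induct)
  case empty
  have "r \<in> carrier R" using empty.prems(2) subringE(1)[OF sub] by blast
  then have "r = \<zero>" using empty.prems(4)[of \<one>] by simp
  then show ?case using empty.prems(3) by (simp add: a_minus_def)
next
  case (insert a A)
  note K = subringE[OF sub]
  have Kc: "k \<in> carrier R" if "k \<in> K" for k using that K(1) by blast
  have Jc: "j \<in> carrier R" if "j \<in> J" for j using that J_sub Kc by blast
  have xa: "x a \<in> carrier R" and xA: "x \<in> A \<rightarrow> carrier R" using insert.prems(1) by auto
  have sumc: "(\<Oplus>i\<in>A. c i \<otimes> x i) \<in> carrier R" if "c \<in> A \<rightarrow> J" for c
    using that xA Jc by (intro finsum_closed) blast
  have split: "(\<Oplus>i\<in>insert a A. c i \<otimes> x i) = c a \<otimes> x a \<oplus> (\<Oplus>i\<in>A. c i \<otimes> x i)"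
    if "c \<in> insert a A \<rightarrow> J" for c
  proof -
    have "c i \<otimes> x i \<in> carrier R" if "i \<in> insert a A" for i
      using that \<open>c \<in> insert a A \<rightarrow> J\<close> Jc insert.prems(1) by blast
    then show ?thesis using insert.hyps by (simp add: Pi_def)
  qed
  have rc: "r \<in> carrier R" by (rule Kc[OF insert.prems(2)])
  obtain d where d: "d \<in> insert a A \<rightarrow> J" "r \<otimes> x a = (\<Oplus>i\<in>insert a A. d i \<otimes> x i)"
    using insert.prems(4)[OF xa] by blast
  have da: "d a \<in> J" "d \<in> A \<rightarrow> J" using d(1) by auto
  \<comment> \<open>Moving the term of \<open>x a\<close> to the left expresses \<open>q \<otimes> x a\<close> by the other generators; \<open>q\<close> is again
    congruent to \<open>1\<close>, so multiplication by \<open>q\<close> eliminates \<open>x a\<close>.\<close>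
  define q where "q = r \<ominus> d a"
  have q: "q \<in> K" using insert.prems(2) da(1) J_sub K(5,7) by (auto simp: q_def a_minus_def)
  have qc: "q \<in> carrier R" by (rule Kc[OF q])
  have q_xa: "q \<otimes> x a = (\<Oplus>i\<in>A. d i \<otimes> x i)"
  proof -
    have "q \<otimes> x a = r \<otimes> x a \<ominus> d a \<otimes> x a"
      using rc Jc[OF da(1)] xa by (simp add: q_def a_minus_def l_distr l_minus)
    also have "\<dots> = (\<Oplus>i\<in>A. d i \<otimes> x i)"
      unfolding d(2) split[OF d(1)] using sumc[OF da(2)] xa Jc[OF da(1)]
      by (simp add: a_minus_def a_ac r_neg2)
    finally show ?thesis .
  qed
  show ?case
  proof (rule insert.IH[OF xA])
    show "q \<otimes> r \<in> K" using q insert.prems(2) K(6) by blast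
    have "\<one> \<ominus> q \<otimes> r = (\<one> \<oplus> r) \<otimes> (\<one> \<ominus> r) \<oplus> r \<otimes> d a"
    proof -
      have "(\<one> \<oplus> r) \<otimes> (\<one> \<ominus> r) \<oplus> r \<otimes> d a = \<one> \<ominus> r \<otimes> r \<oplus> r \<otimes> d a"
        using rc Jc[OF da(1)] by algebra
      moreover have "\<one> \<ominus> q \<otimes> r = \<one> \<ominus> r \<otimes> r \<oplus> r \<otimes> d a"
        unfolding q_def using rc Jc[OF da(1)] by algebra
      ultimately show ?thesis by simp
    qed
    moreover have "\<dots> \<in> J"
      using insert.prems(2,3) da(1) K(3,7) by (intro J_add J_mult) auto
    ultimately show "\<one> \<ominus> q \<otimes> r \<in> J" by simp
    fix s assume s: "s \<in> carrier R"
    obtain c where c: "c \<in> insert a A \<rightarrow> J" "r \<otimes> s = (\<Oplus>i\<in>insert a A. c i \<otimes> x i)"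
      using insert.prems(4)[OF s] by blast
    have ca: "c a \<in> J" "c \<in> A \<rightarrow> J" using c(1) by auto
    note cac = Jc[OF ca(1)]
    have "q \<otimes> r \<otimes> s = q \<otimes> (r \<otimes> s)" using qc rc s by (rule m_assoc)
    also have "\<dots> = c a \<otimes> (q \<otimes> x a) \<oplus> q \<otimes> (\<Oplus>i\<in>A. c i \<otimes> x i)"
      unfolding c(2) split[OF c(1)] using cac xa qc sumc[OF ca(2)] by (simp add: r_distr m_lcomm)
    also have "\<dots> = c a \<otimes> (\<Oplus>i\<in>A. d i \<otimes> x i) \<oplus> q \<otimes> (\<Oplus>i\<in>A. c i \<otimes> x i)"
      unfolding q_xa ..
    also have "\<dots> = (\<Oplus>i\<in>A. c a \<otimes> (d i \<otimes> x i)) \<oplus> (\<Oplus>i\<in>A. q \<otimes> (c i \<otimes> x i))"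
      using insert.hyps(1) cac qc xA da(2) ca(2) Jc by (subst (1 2) finsum_rdistr) (auto simp: Pi_def)
    also have "\<dots> = (\<Oplus>i\<in>A. c a \<otimes> (d i \<otimes> x i) \<oplus> q \<otimes> (c i \<otimes> x i))"
      using cac qc xA da(2) ca(2) Jc by (intro finsum_addf[symmetric]) (auto simp: Pi_def)
    also have "\<dots> = (\<Oplus>i\<in>A. (c a \<otimes> d i \<oplus> q \<otimes> c i) \<otimes> x i)"
    proof (rule finsum_cong'[OF refl])
      have *: "d i \<in> carrier R" "c i \<in> carrier R" "x i \<in> carrier R" if "i \<in> A" for i
        using that da(2) ca(2) xA Jc by blast+
      show "(\<lambda>i. (c a \<otimes> d i \<oplus> q \<otimes> c i) \<otimes> x i) \<in> A \<rightarrow> carrier R" using * cac qc by auto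
      show "c a \<otimes> (d i \<otimes> x i) \<oplus> q \<otimes> (c i \<otimes> x i) = (c a \<otimes> d i \<oplus> q \<otimes> c i) \<otimes> x i" if "i \<in> A" for i
        using *[OF that] cac qc by (simp add: l_distr m_assoc)
    qed
    finally have "q \<otimes> r \<otimes> s = (\<Oplus>i\<in>A. (c a \<otimes> d i \<oplus> q \<otimes> c i) \<otimes> x i)" .
    moreover have "(\<lambda>i. c a \<otimes> d i \<oplus> q \<otimes> c i) \<in> A \<rightarrow> J"
      using ca da J_sub q by (auto intro!: J_add J_mult)
    ultimately show "\<exists>c. c \<in> A \<rightarrow> J \<and> q \<otimes> r \<otimes> s = (\<Oplus>i\<in>A. c i \<otimes> x i)" by blast
  qed
qed

end

section \<open>Partial actions as families of ring endomorphisms\<close>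

text \<open>
  The maps $x \mapsto \alpha_h(x 1_{h^{-1}})$ are additive and multiplicative on the whole ring, so that
  computations with them need no domains.  The idempotent $1_h$ is \<open>\<beta> h \<one>\<close>, and \<open>\<beta>_comp\<close> is the partial
  composition law.
\<close>

locale partial_endo = S?: cring S + G: group G
  for S :: "('s, 'z) ring_scheme" (structure) and G :: "('g, 'y) monoid_scheme" +
  fixes \<beta> :: "'g \<Rightarrow> 's \<Rightarrow> 's"
  assumes G_finite: "finite (carrier G)"
    and \<beta>_closed: "h \<in> carrier G \<Longrightarrow> x \<in> carrier S \<Longrightarrow> \<beta> h x \<in> carrier S"
    and \<beta>_add: "h \<in> carrier G \<Longrightarrow> x \<in> carrier S \<Longrightarrow> y \<in> carrier S \<Longrightarrow> \<beta> h (x \<oplus> y) = \<beta> h x \<oplus> \<beta> h y"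
    and \<beta>_mult: "h \<in> carrier G \<Longrightarrow> x \<in> carrier S \<Longrightarrow> y \<in> carrier S \<Longrightarrow> \<beta> h (x \<otimes> y) = \<beta> h x \<otimes> \<beta> h y"
    and \<beta>_comp: "h \<in> carrier G \<Longrightarrow> h' \<in> carrier G \<Longrightarrow> x \<in> carrier S \<Longrightarrow>
      \<beta> h (\<beta> h' x) = \<beta> h \<one> \<otimes> \<beta> (h \<otimes>\<^bsub>G\<^esub> h') x"
begin

lemma \<beta>_zero: "h \<in> carrier G \<Longrightarrow> \<beta> h \<zero> = \<zero>"
  using \<beta>_add[of h \<zero> \<zero>] \<beta>_closed[of h \<zero>] S.add.r_cancel_one' by auto

lemma \<beta>_finsum:
  assumes "h \<in> carrier G" "finite A" "u \<in> A \<rightarrow> carrier S"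
  shows "\<beta> h (\<Oplus>i\<in>A. u i) = (\<Oplus>i\<in>A. \<beta> h (u i))"
  using assms(2,3)
  by (induction A) (simp_all add: \<beta>_zero \<beta>_add \<beta>_closed Pi_def assms(1))

lemma \<beta>_one_mult: "h \<in> carrier G \<Longrightarrow> x \<in> carrier S \<Longrightarrow> \<beta> h \<one> \<otimes> \<beta> h x = \<beta> h x"
  using \<beta>_mult[of h \<one> x] by simp

definition invariants :: "'s set"
  where "invariants = {r \<in> carrier S. \<forall>h\<in>carrier G. \<beta> h r = r \<otimes> \<beta> h \<one>}"

text \<open>
  The eigenspace of \<open>\<theta>\<close>; for $\theta = \chi^i$ it is $Q_{\chi_p^i}$.
\<close>

definition component :: "('g \<Rightarrow> 's) \<Rightarrow> 's set"
  where "component \<theta> = {x \<in> carrier S. \<forall>h\<in>carrier G. \<beta> h x = \<theta> h \<otimes> \<beta> h \<one> \<otimes> x}"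

definition is_char :: "('g \<Rightarrow> 's) \<Rightarrow> bool"
  where "is_char \<theta> \<longleftrightarrow> \<theta> \<in> carrier G \<rightarrow> invariants \<and> \<theta> \<one>\<^bsub>G\<^esub> = \<one> \<and>
    (\<forall>h\<in>carrier G. \<forall>h'\<in>carrier G. \<theta> (h \<otimes>\<^bsub>G\<^esub> h') = \<theta> h \<otimes> \<theta> h')"

text \<open>
  Averaging against \<open>\<theta>\<close>, which produces elements of the eigenspace of \<open>\<theta>\<close>.  The trivial character
  gives the trace.
\<close>

definition char_sum :: "('g \<Rightarrow> 's) \<Rightarrow> 's \<Rightarrow> 's"
  where "char_sum \<theta> x = (\<Oplus>h\<in>carrier G. \<theta> (inv\<^bsub>G\<^esub> h) \<otimes> \<beta> h x)"

lemma invariants_carrier: "r \<in> invariants \<Longrightarrow> r \<in> carrier S"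
  by (simp add: invariants_def)

lemma \<beta>_invariant_mult:
  assumes "r \<in> invariants" "h \<in> carrier G" "x \<in> carrier S"
  shows "\<beta> h (r \<otimes> x) = r \<otimes> \<beta> h x"
proof -
  have "\<beta> h (r \<otimes> x) = r \<otimes> (\<beta> h \<one> \<otimes> \<beta> h x)"
    using assms by (simp add: \<beta>_mult invariants_def \<beta>_closed S.m_assoc)
  then show ?thesis using assms by (simp add: \<beta>_one_mult)
qed

lemma is_charD:
  assumes "is_char \<theta>"
  shows "h \<in> carrier G \<Longrightarrow> \<theta> h \<in> invariants" "h \<in> carrier G \<Longrightarrow> \<theta> h \<in> carrier S"
    "\<theta> \<one>\<^bsub>G\<^esub> = \<one>"
    "h \<in> carrier G \<Longrightarrow> h' \<in> carrier G \<Longrightarrow> \<theta> (h \<otimes>\<^bsub>G\<^esub> h') = \<theta> h \<otimes> \<theta> h'"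
  using assms invariants_carrier by (auto simp: is_char_def)

lemma component_carrier: "x \<in> component \<theta> \<Longrightarrow> x \<in> carrier S"
  by (simp add: component_def)

lemma char_sum_closed:
  assumes "is_char \<theta>" "x \<in> carrier S"
  shows "char_sum \<theta> x \<in> carrier S"
  unfolding char_sum_def by (intro S.finsum_closed) (auto intro!: is_charD[OF assms(1)] \<beta>_closed assms(2))

text \<open>
  Applying \<open>\<beta> h\<close> shifts the summation index by \<open>h\<close>, and the shift of \<open>\<theta>\<close> contributes the factor \<open>\<theta> h\<close>.
\<close>

lemma char_sum_component:
  assumes \<theta>: "is_char \<theta>" and x: "x \<in> carrier S"
  shows "char_sum \<theta> x \<in> component \<theta>"
proof -
  note \<theta>' = is_charD[OF \<theta>]
  have "\<beta> h (char_sum \<theta> x) = \<theta> h \<otimes> \<beta> h \<one> \<otimes> char_sum \<theta> x" if h: "h \<in> carrier G" for h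
  proof -
    let ?u = "\<lambda>h'. \<theta> (inv\<^bsub>G\<^esub> h') \<otimes> \<beta> h' x"
    have uc: "?u h' \<in> carrier S" if "h' \<in> carrier G" for h'
      using that \<theta>'(2) \<beta>_closed x by simp
    have c: "\<theta> h \<otimes> \<beta> h \<one> \<in> carrier S" using h \<theta>'(2) \<beta>_closed by simp
    have "\<beta> h (char_sum \<theta> x) = (\<Oplus>h'\<in>carrier G. \<beta> h (?u h'))"
      unfolding char_sum_def by (rule \<beta>_finsum[OF h G_finite]) (use uc in simp)
    also have "\<dots> = (\<Oplus>h'\<in>carrier G. \<theta> h \<otimes> \<beta> h \<one> \<otimes> ?u (h \<otimes>\<^bsub>G\<^esub> h'))"
    proof (rule S.finsum_cong'[OF refl])
      show "(\<lambda>h'. \<theta> h \<otimes> \<beta> h \<one> \<otimes> ?u (h \<otimes>\<^bsub>G\<^esub> h')) \<in> carrier G \<rightarrow> carrier S"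
        using c uc h by auto
      fix h' assume h': "h' \<in> carrier G"
      note G' = h h' G.inv_closed[OF h] G.inv_closed[OF h'] G.m_closed[OF h h']
      have \<theta>i: "\<theta> (inv\<^bsub>G\<^esub> h') = \<theta> h \<otimes> \<theta> (inv\<^bsub>G\<^esub> (h \<otimes>\<^bsub>G\<^esub> h'))"
      proof -
        have "\<theta> (inv\<^bsub>G\<^esub> (h \<otimes>\<^bsub>G\<^esub> h')) = \<theta> (inv\<^bsub>G\<^esub> h') \<otimes> \<theta> (inv\<^bsub>G\<^esub> h)"
          using h h' by (simp add: G.inv_mult_group \<theta>'(4))
        moreover have "\<theta> h \<otimes> \<theta> (inv\<^bsub>G\<^esub> h) = \<one>"
          using \<theta>'(4)[of h "inv\<^bsub>G\<^esub> h"] \<theta>'(3) h by simp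
        moreover have "\<theta> h \<otimes> (\<theta> (inv\<^bsub>G\<^esub> h') \<otimes> \<theta> (inv\<^bsub>G\<^esub> h)) = \<theta> (inv\<^bsub>G\<^esub> h') \<otimes> (\<theta> h \<otimes> \<theta> (inv\<^bsub>G\<^esub> h))"
          using h h' \<theta>'(2) by (simp add: S.m_lcomm)
        ultimately show ?thesis using h' \<theta>'(2) by simp
      qed
      have "\<beta> h (?u h') = \<theta> (inv\<^bsub>G\<^esub> h') \<otimes> (\<beta> h \<one> \<otimes> \<beta> (h \<otimes>\<^bsub>G\<^esub> h') x)"
        using G' x \<theta>'(1) \<beta>_closed by (simp add: \<beta>_invariant_mult \<beta>_comp)
      also have "\<dots> = \<theta> h \<otimes> \<beta> h \<one> \<otimes> ?u (h \<otimes>\<^bsub>G\<^esub> h')"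
        unfolding \<theta>i using G' x \<theta>'(2) \<beta>_closed by (simp add: S.m_ac)
      finally show "\<beta> h (?u h') = \<theta> h \<otimes> \<beta> h \<one> \<otimes> ?u (h \<otimes>\<^bsub>G\<^esub> h')" .
    qed
    also have "\<dots> = \<theta> h \<otimes> \<beta> h \<one> \<otimes> (\<Oplus>h'\<in>carrier G. ?u (h \<otimes>\<^bsub>G\<^esub> h'))"
      by (rule S.finsum_rdistr[symmetric]) (use G_finite c uc h in auto)
    also have "(\<Oplus>h'\<in>carrier G. ?u (h \<otimes>\<^bsub>G\<^esub> h')) = (\<Oplus>h'\<in>(\<lambda>h'. h \<otimes>\<^bsub>G\<^esub> h') ` carrier G. ?u h')"
      by (rule S.finsum_reindex[symmetric]) (use uc h in \<open>auto simp: inj_on_def\<close>)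
    also have "(\<lambda>h'. h \<otimes>\<^bsub>G\<^esub> h') ` carrier G = carrier G"
    proof
      show "carrier G \<subseteq> (\<lambda>h'. h \<otimes>\<^bsub>G\<^esub> h') ` carrier G"
      proof
        fix z assume "z \<in> carrier G"
        then show "z \<in> (\<lambda>h'. h \<otimes>\<^bsub>G\<^esub> h') ` carrier G"
          using h by (intro image_eqI[of _ _ "inv\<^bsub>G\<^esub> h \<otimes>\<^bsub>G\<^esub> z"]) (simp_all add: G.m_assoc[symmetric])
      qed
    qed (use h in auto)
    finally show ?thesis by (simp add: char_sum_def)
  qed
  then show ?thesis using char_sum_closed[OF assms] by (simp add: component_def)
qed

lemma component_mult:
  assumes "is_char \<theta>" "is_char \<theta>'" "x \<in> component \<theta>" "y \<in> component \<theta>'"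
    and "\<And>h. h \<in> carrier G \<Longrightarrow> \<theta> h \<otimes> \<theta>' h = \<theta>'' h"
  shows "x \<otimes> y \<in> component \<theta>''"
proof -
  note x = component_carrier[OF assms(3)] and y = component_carrier[OF assms(4)]
  have "\<beta> h (x \<otimes> y) = \<theta>'' h \<otimes> \<beta> h \<one> \<otimes> (x \<otimes> y)" if h: "h \<in> carrier G" for h
  proof -
    note c = is_charD(2)[OF assms(1) h] is_charD(2)[OF assms(2) h] \<beta>_closed[OF h S.one_closed]
    have "\<beta> h (x \<otimes> y) = (\<theta> h \<otimes> \<beta> h \<one> \<otimes> x) \<otimes> (\<theta>' h \<otimes> \<beta> h \<one> \<otimes> y)"
      using assms(3,4) h x y by (simp add: \<beta>_mult component_def)
    also have "\<dots> = (\<theta> h \<otimes> \<theta>' h) \<otimes> (\<beta> h \<one> \<otimes> \<beta> h \<one>) \<otimes> (x \<otimes> y)"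
      using c x y by (simp add: S.m_ac)
    finally show ?thesis using h by (simp add: \<beta>_one_mult assms(5))
  qed
  then show ?thesis using x y by (simp add: component_def)
qed

lemma component_zero: "is_char \<theta> \<Longrightarrow> \<zero> \<in> component \<theta>"
  by (simp add: component_def \<beta>_zero \<beta>_closed is_charD)

lemma component_add:
  "is_char \<theta> \<Longrightarrow> x \<in> component \<theta> \<Longrightarrow> y \<in> component \<theta> \<Longrightarrow> x \<oplus> y \<in> component \<theta>"
  by (simp add: component_def \<beta>_add \<beta>_closed is_charD S.r_distr)

lemma component_smult:
  assumes "is_char \<theta>" "r \<in> invariants" "x \<in> component \<theta>"
  shows "r \<otimes> x \<in> component \<theta>"
  using assms invariants_carrier[OF assms(2)]
  by (simp add: component_def \<beta>_invariant_mult \<beta>_closed is_charD S.m_lcomm)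

lemma component_one: "component (\<lambda>_. \<one>) = invariants"
  by (auto simp: component_def invariants_def \<beta>_closed S.m_comm)

lemma invariants_one: "\<one> \<in> invariants"
  by (simp add: invariants_def \<beta>_closed)

lemma is_char_one: "is_char (\<lambda>_. \<one>)"
  by (simp add: is_char_def invariants_one)

abbreviation (input) "tr \<equiv> char_sum (\<lambda>_. \<one>)"

lemma tr_eq: "x \<in> carrier S \<Longrightarrow> tr x = (\<Oplus>h\<in>carrier G. \<beta> h x)"
  unfolding char_sum_def by (rule S.finsum_cong') (auto simp: \<beta>_closed)

lemma tr_add:
  assumes "x \<in> carrier S" "y \<in> carrier S"
  shows "tr (x \<oplus> y) = tr x \<oplus> tr y"
proof -
  have "tr (x \<oplus> y) = (\<Oplus>h\<in>carrier G. \<beta> h x \<oplus> \<beta> h y)"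
    unfolding tr_eq[OF S.a_closed[OF assms]]
    by (rule S.finsum_cong') (use assms in \<open>auto simp: \<beta>_closed \<beta>_add\<close>)
  then show ?thesis using assms by (simp add: S.finsum_addf \<beta>_closed tr_eq)
qed

lemma tr_mult:
  assumes r: "r \<in> invariants" and x: "x \<in> carrier S"
  shows "tr (r \<otimes> x) = r \<otimes> tr x"
proof -
  note rc = invariants_carrier[OF r]
  have "tr (r \<otimes> x) = (\<Oplus>h\<in>carrier G. r \<otimes> \<beta> h x)"
    unfolding tr_eq[OF S.m_closed[OF rc x]]
    by (rule S.finsum_cong') (use r rc x in \<open>auto simp: \<beta>_closed \<beta>_invariant_mult\<close>)
  then show ?thesis using x rc G_finite by (simp add: S.finsum_rdistr \<beta>_closed tr_eq)
qed

lemma tr_zero: "tr \<zero> = \<zero>"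
  using tr_eq[of \<zero>] by (simp add: \<beta>_zero cong: S.finsum_cong)

lemma tr_closed: "x \<in> carrier S \<Longrightarrow> tr x \<in> carrier S"
  by (rule char_sum_closed[OF is_char_one])

lemma tr_finsum:
  assumes "finite A" "u \<in> A \<rightarrow> carrier S"
  shows "tr (\<Oplus>i\<in>A. u i) = (\<Oplus>i\<in>A. tr (u i))"
  using assms by (induction A) (simp_all add: tr_zero tr_add tr_closed Pi_def)

context
  fixes L :: "'i set" and x y :: "'i \<Rightarrow> 's"
  assumes L: "finite L" and x: "x \<in> L \<rightarrow> carrier S" and y: "y \<in> L \<rightarrow> carrier S"
    and galois: "\<And>h. h \<in> carrier G \<Longrightarrow>
      (\<Oplus>i\<in>L. x i \<otimes> \<beta> h (y i)) = (if h = \<one>\<^bsub>G\<^esub> then \<one> else \<zero>)"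
    and \<beta>_id: "\<And>s. s \<in> carrier S \<Longrightarrow> \<beta> \<one>\<^bsub>G\<^esub> s = s"
    and inv_subring: "subring invariants S"
begin

text \<open>
  After interchanging the sums the Galois condition leaves only the term of the neutral element.  For
  the trivial character this is the expansion of \<open>s\<close> in the generators \<open>x i\<close> with traces as coefficients.
\<close>

lemma galois_char_sum:
  assumes \<theta>: "is_char \<theta>" and s: "s \<in> carrier S"
  shows "(\<Oplus>i\<in>L. x i \<otimes> char_sum \<theta> (y i \<otimes> s)) = s"
proof -
  note \<theta>' = is_charD[OF \<theta>]
  have xc: "x i \<in> carrier S" and yc: "y i \<in> carrier S" if "i \<in> L" for i using x y that by auto
  let ?f = "\<lambda>i h. \<theta> (inv\<^bsub>G\<^esub> h) \<otimes> \<beta> h s \<otimes> (x i \<otimes> \<beta> h (y i))"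
  have fc: "?f i h \<in> carrier S" if "i \<in> L" "h \<in> carrier G" for i h
    using that xc yc \<theta>'(2) \<beta>_closed s by simp
  have "(\<Oplus>i\<in>L. x i \<otimes> char_sum \<theta> (y i \<otimes> s)) = (\<Oplus>i\<in>L. \<Oplus>h\<in>carrier G. ?f i h)"
  proof (rule S.finsum_cong'[OF refl])
    show "(\<lambda>i. \<Oplus>h\<in>carrier G. ?f i h) \<in> L \<rightarrow> carrier S"
      using fc by (intro Pi_I S.finsum_closed) auto
    fix i assume i: "i \<in> L"
    have "x i \<otimes> char_sum \<theta> (y i \<otimes> s) = (\<Oplus>h\<in>carrier G. x i \<otimes> (\<theta> (inv\<^bsub>G\<^esub> h) \<otimes> \<beta> h (y i \<otimes> s)))"
      unfolding char_sum_def
      by (rule S.finsum_rdistr) (use G_finite i xc yc \<theta>'(2) \<beta>_closed s in auto)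
    also have "\<dots> = (\<Oplus>h\<in>carrier G. ?f i h)"
      by (rule S.finsum_cong') (use i xc yc \<theta>'(2) \<beta>_closed s fc in \<open>auto simp: \<beta>_mult S.m_ac\<close>)
    finally show "x i \<otimes> char_sum \<theta> (y i \<otimes> s) = (\<Oplus>h\<in>carrier G. ?f i h)" .
  qed
  also have "\<dots> = (\<Oplus>h\<in>carrier G. \<Oplus>i\<in>L. ?f i h)"
    by (rule S.finsum_swap[OF L G_finite fc])
  also have "\<dots> = (\<Oplus>h\<in>carrier G. if \<one>\<^bsub>G\<^esub> = h then s else \<zero>)"
  proof (rule S.finsum_cong'[OF refl])
    fix h assume h: "h \<in> carrier G"
    have "(\<Oplus>i\<in>L. ?f i h) = \<theta> (inv\<^bsub>G\<^esub> h) \<otimes> \<beta> h s \<otimes> (\<Oplus>i\<in>L. x i \<otimes> \<beta> h (y i))"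
      by (rule S.finsum_rdistr[symmetric]) (use L h xc yc \<theta>'(2) \<beta>_closed s in auto)
    then show "(\<Oplus>i\<in>L. ?f i h) = (if \<one>\<^bsub>G\<^esub> = h then s else \<zero>)"
      using h \<theta>'(2,3) \<beta>_closed s by (auto simp: galois \<beta>_id)
  qed (use s in auto)
  also have "\<dots> = s"
    using S.add.finprod_singleton[OF G.one_closed G_finite, of "\<lambda>_. s"] s by simp
  finally show ?thesis .
qed

text \<open>
  The image of the trace is an ideal of the invariants, and \<open>galois_char_sum\<close> says that it generates \<open>S\<close>.
\<close>

lemma trace_one: obtains c where "c \<in> carrier S" "tr c = \<one>"
proof -
  have "\<one> \<in> tr ` carrier S"
  proof (rule S.nakayama_unit[OF inv_subring _ _ _ _ L x])
    show "tr ` carrier S \<subseteq> invariants"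
      using char_sum_component[OF is_char_one] by (auto simp: component_one)
    show "\<zero> \<in> tr ` carrier S" using tr_zero by force
    show "i \<oplus> j \<in> tr ` carrier S" if "i \<in> tr ` carrier S" "j \<in> tr ` carrier S" for i j
      using that by (auto simp: tr_add[symmetric])
    show "r \<otimes> j \<in> tr ` carrier S" if "r \<in> invariants" "j \<in> tr ` carrier S" for r j
      using that invariants_carrier by (auto simp: tr_mult[symmetric])
    show "\<one> \<in> invariants" by (rule invariants_one)
    show "\<one> \<ominus> \<one> \<in> tr ` carrier S" using tr_zero by (force simp: a_minus_def S.r_neg)
    fix s assume s: "s \<in> carrier S"
    have xc: "x i \<in> carrier S" and yc: "y i \<in> carrier S" if "i \<in> L" for i using x y that by auto
    have "s = (\<Oplus>i\<in>L. x i \<otimes> tr (y i \<otimes> s))"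
      by (rule galois_char_sum[OF is_char_one s, symmetric])
    also have "\<dots> = (\<Oplus>i\<in>L. tr (y i \<otimes> s) \<otimes> x i)"
      by (rule S.finsum_cong') (use xc yc s tr_closed in \<open>auto simp: S.m_comm\<close>)
    finally have "\<one> \<otimes> s = (\<Oplus>i\<in>L. tr (y i \<otimes> s) \<otimes> x i)" using s by simp
    moreover have "(\<lambda>i. tr (y i \<otimes> s)) \<in> L \<rightarrow> tr ` carrier S" using yc s by auto
    ultimately show "\<exists>c. c \<in> L \<rightarrow> tr ` carrier S \<and> \<one> \<otimes> s = (\<Oplus>i\<in>L. c i \<otimes> x i)" by blast
  qed
  then show ?thesis using that by auto
qed

text \<open>
  With $a_i$ and $b_i$ the character sums of $c x_i$ and $y_i$, the sum of the products $a_i b_i$ is the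
  trace of \<open>c\<close>; therefore \<open>c\<close> is chosen of trace one.
\<close>

lemma component_dual:
  assumes \<theta>: "is_char \<theta>" and \<theta>': "is_char \<theta>'"
    and inv: "\<And>h. h \<in> carrier G \<Longrightarrow> \<theta> (inv\<^bsub>G\<^esub> h) = \<theta>' h"
  obtains a b where "\<And>i. i \<in> L \<Longrightarrow> a i \<in> component \<theta>" "\<And>i. i \<in> L \<Longrightarrow> b i \<in> component \<theta>'"
    "(\<Oplus>i\<in>L. a i \<otimes> b i) = \<one>"
proof -
  obtain c where c: "c \<in> carrier S" "tr c = \<one>" by (rule trace_one)
  have xc: "x i \<in> carrier S" and yc: "y i \<in> carrier S" if "i \<in> L" for i using x y that by auto
  define a where "a = (\<lambda>i. char_sum \<theta> (c \<otimes> x i))"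
  define b where "b = (\<lambda>i. char_sum \<theta>' (y i))"
  have a: "a i \<in> component \<theta>" if "i \<in> L" for i
    unfolding a_def using that xc c by (intro char_sum_component[OF \<theta>]) auto
  have b: "b i \<in> component \<theta>'" if "i \<in> L" for i
    unfolding b_def using that yc by (intro char_sum_component[OF \<theta>']) auto
  have bc: "b i \<in> carrier S" if "i \<in> L" for i using b[OF that] by (rule component_carrier)
  have ab: "a i \<otimes> b i = tr (c \<otimes> x i \<otimes> b i)" if i: "i \<in> L" for i
  proof -
    have cx: "c \<otimes> x i \<in> carrier S" using c xc i by simp
    have "a i \<otimes> b i = (\<Oplus>h\<in>carrier G. \<theta> (inv\<^bsub>G\<^esub> h) \<otimes> \<beta> h (c \<otimes> x i) \<otimes> b i)"
      unfolding a_def char_sum_def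
      by (rule S.finsum_ldistr) (use G_finite bc[OF i] is_charD(2)[OF \<theta>] \<beta>_closed cx in auto)
    also have "\<dots> = (\<Oplus>h\<in>carrier G. \<beta> h (c \<otimes> x i \<otimes> b i))"
    proof (rule S.finsum_cong'[OF refl])
      show "(\<lambda>h. \<beta> h (c \<otimes> x i \<otimes> b i)) \<in> carrier G \<rightarrow> carrier S" using cx bc[OF i] \<beta>_closed by simp
      fix h assume h: "h \<in> carrier G"
      note hc = \<beta>_closed[OF h cx] \<beta>_closed[OF h S.one_closed] is_charD(2)[OF \<theta>' h] bc[OF i]
      \<comment> \<open>As an eigenvector, \<open>b i\<close> absorbs the character value and turns into \<open>\<beta> h (b i)\<close>.\<close>
      have "\<theta> (inv\<^bsub>G\<^esub> h) \<otimes> \<beta> h (c \<otimes> x i) \<otimes> b i = \<theta>' h \<otimes> (\<beta> h \<one> \<otimes> \<beta> h (c \<otimes> x i)) \<otimes> b i"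
        using h cx by (simp add: inv \<beta>_one_mult)
      also have "\<dots> = \<beta> h (c \<otimes> x i) \<otimes> (\<theta>' h \<otimes> \<beta> h \<one> \<otimes> b i)"
        using hc by (simp add: S.m_ac)
      also have "\<dots> = \<beta> h (c \<otimes> x i \<otimes> b i)"
        using b[OF i] h cx bc[OF i] by (simp add: component_def \<beta>_mult)
      finally show "\<theta> (inv\<^bsub>G\<^esub> h) \<otimes> \<beta> h (c \<otimes> x i) \<otimes> b i = \<beta> h (c \<otimes> x i \<otimes> b i)" .
    qed
    finally show ?thesis using tr_eq cx bc[OF i] by simp
  qed
  have "(\<Oplus>i\<in>L. a i \<otimes> b i) = (\<Oplus>i\<in>L. tr (c \<otimes> x i \<otimes> b i))"
    by (rule S.finsum_cong') (use ab c xc bc tr_closed in auto)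
  also have "\<dots> = tr (\<Oplus>i\<in>L. c \<otimes> x i \<otimes> b i)"
    by (rule tr_finsum[symmetric, OF L]) (use c xc bc in auto)
  also have "(\<Oplus>i\<in>L. c \<otimes> x i \<otimes> b i) = (\<Oplus>i\<in>L. c \<otimes> (x i \<otimes> b i))"
    by (rule S.finsum_cong') (use c xc bc in \<open>auto simp: S.m_assoc\<close>)
  also have "\<dots> = c \<otimes> (\<Oplus>i\<in>L. x i \<otimes> b i)"
    by (rule S.finsum_rdistr[symmetric]) (use L c xc bc in auto)
  also have "(\<Oplus>i\<in>L. x i \<otimes> b i) = (\<Oplus>i\<in>L. x i \<otimes> char_sum \<theta>' (y i \<otimes> \<one>))"
    unfolding b_def by (rule S.finsum_cong') (use xc yc char_sum_closed[OF \<theta>'] in auto)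
  also have "\<dots> = \<one>" by (rule galois_char_sum[OF \<theta>' S.one_closed])
  finally have "(\<Oplus>i\<in>L. a i \<otimes> b i) = \<one>" using c by simp
  with a b that show ?thesis by blast
qed

end

end

section \<open>Unital partial actions\<close>

text \<open>
  The composition law on all of \<open>S\<close> follows from the one on domains by cutting down with the
  idempotents \<open>e h\<close>, whose images under the action are given by the condition on the ideals
  \<open>D h\<close>.
\<close>

lemma partial_action_endo:
  assumes "unital_partial_action k S G D e \<alpha>"
  defines "\<beta> \<equiv> \<lambda>h x. \<alpha> h (x \<otimes>\<^bsub>S\<^esub> e (inv\<^bsub>G\<^esub> h))"
  shows partial_action_partial_endo: "partial_endo S G \<beta>"
    and partial_action_one: "\<And>h. h \<in> carrier G \<Longrightarrow> \<beta> h \<one>\<^bsub>S\<^esub> = e h"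
    and partial_action_id: "\<And>x. x \<in> carrier S \<Longrightarrow> \<beta> \<one>\<^bsub>G\<^esub> x = x"
proof -
  note ax = unital_partial_action.axioms[OF assms(1)]
  note A_finite_group = unital_partial_action.finite_group[OF assms(1)]
    and A_ideal_D = unital_partial_action.ideal_D[OF assms(1)]
    and A_e_in = unital_partial_action.e_in[OF assms(1)]
    and A_e_unit = unital_partial_action.e_unit[OF assms(1)]
    and A_\<alpha>_ring_iso = unital_partial_action.\<alpha>_ring_iso[OF assms(1)]
    and A_D_one = unital_partial_action.D_one[OF assms(1)]
    and A_\<alpha>_one = unital_partial_action.\<alpha>_one[OF assms(1)]
    and A_\<alpha>_image = unital_partial_action.\<alpha>_image[OF assms(1)]
    and A_\<alpha>_comp = unital_partial_action.\<alpha>_comp[OF assms(1)]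
  interpret S: cring S by (rule algebra.M_cring[OF ax(1)])
  interpret G: group G by (rule ax(2))
  note inv = G.inv_closed
  have D_sub: "D h \<subseteq> carrier S" if "h \<in> carrier G" for h
    using additive_subgroup.a_subset[OF ideal.axioms(1)[OF A_ideal_D[OF that]]] .
  then have D_carrier: "x \<in> carrier S" if "h \<in> carrier G" "x \<in> D h" for h x
    using that by blast
  have e_carrier: "e h \<in> carrier S" if "h \<in> carrier G" for h
    by (rule D_carrier[OF that A_e_in[OF that]])
  have e_D: "x \<otimes>\<^bsub>S\<^esub> e h \<in> D h" if "h \<in> carrier G" "x \<in> carrier S" for h x
    by (rule ideal.I_l_closed[OF A_ideal_D[OF that(1)] A_e_in[OF that(1)] that(2)])
  have D_mult: "y \<otimes>\<^bsub>S\<^esub> x \<in> D h" if "h \<in> carrier G" "x \<in> D h" "y \<in> carrier S" for h x y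
    by (rule ideal.I_l_closed[OF A_ideal_D[OF that(1)] that(2,3)])
  have D_e: "x \<otimes>\<^bsub>S\<^esub> e h = x" if "h \<in> carrier G" "x \<in> D h" for h x
    using A_e_unit[OF that] that e_carrier D_carrier by (simp add: S.m_comm)
  have \<alpha>_closed: "\<alpha> h x \<in> D h" if "h \<in> carrier G" "x \<in> D (inv\<^bsub>G\<^esub> h)" for h x
    using ring_iso_memE(1)[OF A_\<alpha>_ring_iso[OF that(1)], of x] that(2) by simp
  have \<alpha>_mult: "\<alpha> h (x \<otimes>\<^bsub>S\<^esub> y) = \<alpha> h x \<otimes>\<^bsub>S\<^esub> \<alpha> h y"
    if "h \<in> carrier G" "x \<in> D (inv\<^bsub>G\<^esub> h)" "y \<in> D (inv\<^bsub>G\<^esub> h)" for h x y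
    using ring_iso_memE(2)[OF A_\<alpha>_ring_iso[OF that(1)], of x y] that(2,3) by simp
  have \<alpha>_add: "\<alpha> h (x \<oplus>\<^bsub>S\<^esub> y) = \<alpha> h x \<oplus>\<^bsub>S\<^esub> \<alpha> h y"
    if "h \<in> carrier G" "x \<in> D (inv\<^bsub>G\<^esub> h)" "y \<in> D (inv\<^bsub>G\<^esub> h)" for h x y
    using ring_iso_memE(3)[OF A_\<alpha>_ring_iso[OF that(1)], of x y] that(2,3) by simp
  have \<alpha>_e: "\<alpha> h (e (inv\<^bsub>G\<^esub> h)) = e h" if "h \<in> carrier G" for h
    using ring_iso_memE(4)[OF A_\<alpha>_ring_iso[OF that]] by simp
  have \<beta>_D: "\<beta> h x \<in> D h" if "h \<in> carrier G" "x \<in> carrier S" for h x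
    unfolding \<beta>_def by (rule \<alpha>_closed[OF that(1) e_D[OF inv[OF that(1)] that(2)]])
  show one: "\<beta> h \<one>\<^bsub>S\<^esub> = e h" if "h \<in> carrier G" for h
    using that by (simp add: \<beta>_def e_carrier \<alpha>_e)
  show "\<beta> \<one>\<^bsub>G\<^esub> x = x" if "x \<in> carrier S" for x
    using that D_e[OF G.one_closed, of x] A_D_one A_\<alpha>_one by (simp add: \<beta>_def)
  \<comment> \<open>An isomorphism of ideals maps the identity of $S_{h^{-1}} \cap S_{h'}$ to that of its image.\<close>
  have \<alpha>_ee: "\<alpha> h (e (inv\<^bsub>G\<^esub> h) \<otimes>\<^bsub>S\<^esub> e h') = e h \<otimes>\<^bsub>S\<^esub> e (h \<otimes>\<^bsub>G\<^esub> h')"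
    if h: "h \<in> carrier G" and h': "h' \<in> carrier G" for h h'
  proof -
    note hh' = G.m_closed[OF h h']
    note ec = e_carrier[OF h] e_carrier[OF h'] e_carrier[OF inv[OF h]] e_carrier[OF hh']
    let ?u = "e (inv\<^bsub>G\<^esub> h) \<otimes>\<^bsub>S\<^esub> e h'" and ?v = "e h \<otimes>\<^bsub>S\<^esub> e (h \<otimes>\<^bsub>G\<^esub> h')"
    have u: "?u \<in> D (inv\<^bsub>G\<^esub> h)" "?u \<in> D h'"
      using e_D[OF inv[OF h] ec(2)] e_D[OF h' ec(3)] ec by (simp_all add: S.m_comm)
    have "?v \<in> D h" "?v \<in> D (h \<otimes>\<^bsub>G\<^esub> h')"
      using e_D[OF h ec(4)] e_D[OF hh' ec(1)] ec by (simp_all add: S.m_comm)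
    then obtain w where w: "w \<in> D (inv\<^bsub>G\<^esub> h)" "w \<in> D h'" "\<alpha> h w = ?v"
      using A_\<alpha>_image[OF h h'] by (smt (verit) IntE IntI imageE)
    have wc: "w \<in> carrier S" by (rule D_carrier[OF h' w(2)])
    have "w \<otimes>\<^bsub>S\<^esub> ?u = w"
      using D_e[OF inv[OF h] w(1)] D_e[OF h' w(2)] wc ec by (simp add: S.m_assoc[symmetric])
    then have "?v \<otimes>\<^bsub>S\<^esub> \<alpha> h ?u = ?v" using \<alpha>_mult[OF h w(1) u(1)] w(3) by simp
    moreover have "\<alpha> h ?u \<in> D h" "\<alpha> h ?u \<in> D (h \<otimes>\<^bsub>G\<^esub> h')"
      using A_\<alpha>_image[OF h h'] u by blast+
    then have "\<alpha> h ?u \<otimes>\<^bsub>S\<^esub> ?v = \<alpha> h ?u"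
      using D_e[OF h, of "\<alpha> h ?u"] D_e[OF hh', of "\<alpha> h ?u"] D_carrier[OF h] ec
      by (simp add: S.m_assoc[symmetric])
    moreover have "\<alpha> h ?u \<otimes>\<^bsub>S\<^esub> ?v = ?v \<otimes>\<^bsub>S\<^esub> \<alpha> h ?u"
      using D_carrier[OF h \<open>\<alpha> h ?u \<in> D h\<close>] ec by (simp add: S.m_comm)
    ultimately show ?thesis by simp
  qed
  show "partial_endo S G \<beta>"
  proof (unfold_locales)
    show "finite (carrier G)" by (rule A_finite_group)
    fix h x assume h: "h \<in> carrier G" and x: "x \<in> carrier S"
    note hi = inv[OF h]
    show "\<beta> h x \<in> carrier S" using D_carrier[OF h \<beta>_D[OF h x]] .
    show "\<beta> h (x \<oplus>\<^bsub>S\<^esub> y) = \<beta> h x \<oplus>\<^bsub>S\<^esub> \<beta> h y" if y: "y \<in> carrier S" for y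
      unfolding \<beta>_def
      using \<alpha>_add[OF h e_D[OF hi x] e_D[OF hi y]] x y e_carrier[OF hi] by (simp add: S.l_distr)
    show "\<beta> h (x \<otimes>\<^bsub>S\<^esub> y) = \<beta> h x \<otimes>\<^bsub>S\<^esub> \<beta> h y" if y: "y \<in> carrier S" for y
    proof -
      note ec = e_carrier[OF hi]
      have "x \<otimes>\<^bsub>S\<^esub> y \<otimes>\<^bsub>S\<^esub> e (inv\<^bsub>G\<^esub> h) = x \<otimes>\<^bsub>S\<^esub> y \<otimes>\<^bsub>S\<^esub> (e (inv\<^bsub>G\<^esub> h) \<otimes>\<^bsub>S\<^esub> e (inv\<^bsub>G\<^esub> h))"
        using D_e[OF hi A_e_in[OF hi]] by simp
      also have "\<dots> = (x \<otimes>\<^bsub>S\<^esub> e (inv\<^bsub>G\<^esub> h)) \<otimes>\<^bsub>S\<^esub> (y \<otimes>\<^bsub>S\<^esub> e (inv\<^bsub>G\<^esub> h))"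
        using x y ec by (simp add: S.m_ac)
      finally show ?thesis
        unfolding \<beta>_def using \<alpha>_mult[OF h e_D[OF hi x] e_D[OF hi y]] by simp
    qed
    fix h' assume h': "h' \<in> carrier G"
    note hi' = inv[OF h'] and hh' = G.m_closed[OF h h']
    note hhi' = inv[OF hh']
    note ec = e_carrier[OF h] e_carrier[OF h'] e_carrier[OF hi] e_carrier[OF hi'] e_carrier[OF hh'] e_carrier[OF hhi']
    \<comment> \<open>The element to which the composition law applies; it is factored once for each of the two maps.\<close>
    let ?y = "x \<otimes>\<^bsub>S\<^esub> e (inv\<^bsub>G\<^esub> h') \<otimes>\<^bsub>S\<^esub> e (inv\<^bsub>G\<^esub> (h \<otimes>\<^bsub>G\<^esub> h'))"
    have y1: "?y = (x \<otimes>\<^bsub>S\<^esub> e (inv\<^bsub>G\<^esub> h')) \<otimes>\<^bsub>S\<^esub> (e (inv\<^bsub>G\<^esub> h') \<otimes>\<^bsub>S\<^esub> e (inv\<^bsub>G\<^esub> (h \<otimes>\<^bsub>G\<^esub> h')))"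
      using D_e[OF hi' e_D[OF hi' x]] x ec by (simp add: S.m_assoc[symmetric])
    have y2: "?y = (x \<otimes>\<^bsub>S\<^esub> e (inv\<^bsub>G\<^esub> (h \<otimes>\<^bsub>G\<^esub> h'))) \<otimes>\<^bsub>S\<^esub> (e (inv\<^bsub>G\<^esub> (h \<otimes>\<^bsub>G\<^esub> h')) \<otimes>\<^bsub>S\<^esub> e (inv\<^bsub>G\<^esub> h'))"
      using D_e[OF hhi' e_D[OF hhi' x]] x ec by (simp add: S.m_assoc[symmetric]) (simp add: S.m_ac)
    have ee1: "e (inv\<^bsub>G\<^esub> h') \<otimes>\<^bsub>S\<^esub> e (inv\<^bsub>G\<^esub> (h \<otimes>\<^bsub>G\<^esub> h')) \<in> D (inv\<^bsub>G\<^esub> h')"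
      using e_D[OF hi' ec(6)] ec by (simp add: S.m_comm)
    have ee2: "e (inv\<^bsub>G\<^esub> (h \<otimes>\<^bsub>G\<^esub> h')) \<otimes>\<^bsub>S\<^esub> e (inv\<^bsub>G\<^esub> h') \<in> D (inv\<^bsub>G\<^esub> (h \<otimes>\<^bsub>G\<^esub> h'))"
      using e_D[OF hhi' ec(4)] ec by (simp add: S.m_comm)
    have yD: "?y \<in> D (inv\<^bsub>G\<^esub> h') \<inter> D (inv\<^bsub>G\<^esub> (h \<otimes>\<^bsub>G\<^esub> h'))"
      using D_mult[OF hi' ee1, of "x \<otimes>\<^bsub>S\<^esub> e (inv\<^bsub>G\<^esub> h')"] D_mult[OF hhi' ee2, of "x \<otimes>\<^bsub>S\<^esub> e (inv\<^bsub>G\<^esub> (h \<otimes>\<^bsub>G\<^esub> h'))"]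
        y1 y2 x ec by simp
    have g1: "h' \<otimes>\<^bsub>G\<^esub> inv\<^bsub>G\<^esub> (h \<otimes>\<^bsub>G\<^esub> h') = inv\<^bsub>G\<^esub> h"
      using h h' by (simp add: G.inv_mult_group G.m_assoc[symmetric])
    have g2: "h \<otimes>\<^bsub>G\<^esub> h' \<otimes>\<^bsub>G\<^esub> inv\<^bsub>G\<^esub> h' = h"
      using h h' by (simp add: G.m_assoc)
    note \<beta>c = D_carrier[OF h' \<beta>_D[OF h' x]] D_carrier[OF hh' \<beta>_D[OF hh' x]]
    have "\<beta> h' x \<otimes>\<^bsub>S\<^esub> e (inv\<^bsub>G\<^esub> h) = \<beta> h' x \<otimes>\<^bsub>S\<^esub> (e h' \<otimes>\<^bsub>S\<^esub> e (inv\<^bsub>G\<^esub> h))"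
      using D_e[OF h' \<beta>_D[OF h' x]] \<beta>c ec by (simp add: S.m_assoc[symmetric])
    also have "\<dots> = \<alpha> h' ?y"
      unfolding y1 \<alpha>_mult[OF h' e_D[OF hi' x] ee1] \<alpha>_ee[OF h' hhi'] g1 by (simp add: \<beta>_def)
    finally have "\<alpha> h (\<beta> h' x \<otimes>\<^bsub>S\<^esub> e (inv\<^bsub>G\<^esub> h)) = \<alpha> h (\<alpha> h' ?y)" by (rule arg_cong)
    then have "\<beta> h (\<beta> h' x) = \<alpha> h (\<alpha> h' ?y)" by (simp only: \<beta>_def)
    also have "\<dots> = \<alpha> (h \<otimes>\<^bsub>G\<^esub> h') ?y" by (rule A_\<alpha>_comp[OF h h' yD])
    also have "\<dots> = \<beta> (h \<otimes>\<^bsub>G\<^esub> h') x \<otimes>\<^bsub>S\<^esub> (e (h \<otimes>\<^bsub>G\<^esub> h') \<otimes>\<^bsub>S\<^esub> e h)"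
      unfolding y2 \<alpha>_mult[OF hh' e_D[OF hhi' x] ee2] \<alpha>_ee[OF hh' hi'] g2 by (simp add: \<beta>_def)
    also have "\<dots> = \<beta> h \<one>\<^bsub>S\<^esub> \<otimes>\<^bsub>S\<^esub> \<beta> (h \<otimes>\<^bsub>G\<^esub> h') x"
      using D_e[OF hh' \<beta>_D[OF hh' x]] \<beta>c ec one[OF h]
      by (simp add: S.m_assoc[symmetric]) (simp add: S.m_comm)
    finally show "\<beta> h (\<beta> h' x) = \<beta> h \<one>\<^bsub>S\<^esub> \<otimes>\<^bsub>S\<^esub> \<beta> (h \<otimes>\<^bsub>G\<^esub> h') x" .
  qed
qed

section \<open>Partial Kummer extensions\<close>

theorem proposition4p12:
  fixes k :: "('k, 'z) ring_scheme"
    and S :: "('k, 's) module"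
    and G :: "('g, 'y) monoid_scheme"
    and D :: "'g \<Rightarrow> 's set" and e :: "'g \<Rightarrow> 's" and \<alpha> :: "'g \<Rightarrow> 's \<Rightarrow> 's"
    and R :: "'s set" and n :: nat and g :: 'g and \<omega> :: 's and \<chi> :: "'g \<Rightarrow> 's"
    and \<phi> :: "('s list \<Rightarrow> 's) set \<Rightarrow> 's" and I :: "nat set"
    and RR :: "('k, 's) module" and Q :: "nat \<Rightarrow> 's set"
    and QM :: "('s, 's) module" and SQ :: "('s, nat \<Rightarrow> ('s list \<Rightarrow> 's) set) module"
    and SR :: "('s, 's) module"
  assumes RR: "RR = S\<lparr>carrier := R\<rparr>"
    and Q: "Q = char_component S G e \<alpha> \<chi>"
    and QM: "QM = mult_module S (Q 1)"
    and SQ: "SQ = radical_extension RR QM n \<phi> I"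
    and SR: "SR = mult_module S (carrier S)"
  assumes n: "n \<ge> 2"
    and g: "g \<in> carrier G" "carrier G = generate G {g}" "order G = n"
    and action: "unital_partial_action k S G D e \<alpha>"
    and kummerian: "partial_kummerian_extension n k S G D e \<alpha> R"
    and \<omega>: "kummerian_root RR n \<omega>"
    and \<chi>: "\<chi> \<in> characters G RR \<omega>" "\<chi> g = \<omega>"
    and \<phi>: "\<phi> \<in> module_iso RR (tensor_power RR QM n) (mult_module S R)"
    and I: "saturated n I"
  shows "(internal_direct_sum RR SR I Q \<longrightarrow>
            lambda_map S R I \<in> module_iso RR SQ SR \<and>
            graded_map (tensor_power RR QM) I Q (lambda_map S R I) \<and>
            (I = {0} \<or>
             (\<forall>as. length as = n \<and> set as \<subseteq> Q 1 \<longrightarrow> \<phi> (pure_tensor RR QM as) = list_prod S as) \<longrightarrow>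
              lambda_map S R I \<in> algebra_iso RR SQ SR)) \<and>
         (lambda_map S R I \<in> algebra_iso RR SQ SR \<longrightarrow> internal_direct_sum RR SR I Q)"
proof -
  define \<beta> where "\<beta> = (\<lambda>h x. \<alpha> h (x \<otimes>\<^bsub>S\<^esub> e (inv\<^bsub>G\<^esub> h)))"
  interpret E: partial_endo S G \<beta>
    unfolding \<beta>_def by (rule partial_action_partial_endo[OF action])
  have \<beta>_one: "\<beta> h \<one>\<^bsub>S\<^esub> = e h" if "h \<in> carrier G" for h
    unfolding \<beta>_def by (rule partial_action_one[OF action that])
  have \<beta>_id: "\<beta> \<one>\<^bsub>G\<^esub> s = s" if "s \<in> carrier S" for s
    unfolding \<beta>_def by (rule partial_action_id[OF action that])
  have galois: "partial_galois_extension k S G D e \<alpha> R"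
    using kummerian by (simp add: partial_kummerian_extension_def)
  have \<beta>_app: "\<alpha> h (s \<otimes>\<^bsub>S\<^esub> e (inv\<^bsub>G\<^esub> h)) = \<beta> h s" for h s by (simp add: \<beta>_def)
  have "partial_invariants S G e \<alpha> = E.invariants"
    by (auto simp: partial_invariants_def E.invariants_def \<beta>_app \<beta>_one)
  with galois have R_subring: "subring R S" and R_inv: "R = E.invariants"
    by (auto simp: partial_galois_extension_def)
  from galois obtain l :: nat and x y where x: "x \<in> {1..l} \<rightarrow> carrier S" and y: "y \<in> {1..l} \<rightarrow> carrier S"
    and xy: "\<And>h. h \<in> carrier G \<Longrightarrow> (\<Oplus>\<^bsub>S\<^esub>i\<in>{1..l}. x i \<otimes>\<^bsub>S\<^esub> \<beta> h (y i)) =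
      (if h = \<one>\<^bsub>G\<^esub> then \<one>\<^bsub>S\<^esub> else \<zero>\<^bsub>S\<^esub>)"
    unfolding partial_galois_extension_def \<beta>_def by blast

  have RR_cring: "cring RR"
    using E.S.subcring_iff[OF subringE(1)[OF R_subring]] E.S.subcringI'[OF R_subring] RR by simp
  interpret RR: cring RR by (rule RR_cring)
  interpret U: group "units_of RR" by (rule RR.units_group)
  interpret V: group "subgroup_generated (units_of RR) {\<omega>}" by (rule U.group_subgroup_generated)
  have \<chi>_hom: "\<chi> \<in> hom G (subgroup_generated (units_of RR) {\<omega>})"
    using \<chi>(1) by (simp add: characters_def)
  have \<chi>_R: "\<chi> h \<in> R" if "h \<in> carrier G" for h
    using hom_in_carrier[OF \<chi>_hom that] U.carrier_subgroup_generated_subset[of "{\<omega>}"] RR.Units_closed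
    by (auto simp: units_of_def RR)
  have \<chi>_mult: "\<chi> (h \<otimes>\<^bsub>G\<^esub> h') = \<chi> h \<otimes>\<^bsub>S\<^esub> \<chi> h'" if "h \<in> carrier G" "h' \<in> carrier G" for h h'
    using hom_mult[OF \<chi>_hom that] by (simp add: units_of_def RR)
  have \<chi>_one: "\<chi> \<one>\<^bsub>G\<^esub> = \<one>\<^bsub>S\<^esub>"
    using hom_one[OF \<chi>_hom E.G.group_axioms V.group_axioms] by (simp add: units_of_def RR)
  note \<chi>_S = E.invariants_carrier[OF \<chi>_R[unfolded R_inv]]
  have R_pow: "r [^]\<^bsub>S\<^esub> (i::nat) \<in> R" if "r \<in> R" for r i
    using that subringE(3,6)[OF R_subring] by (induction i) auto
  define \<chi>i where "\<chi>i = (\<lambda>(i::nat) h. \<chi> h [^]\<^bsub>S\<^esub> i)"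
  have char_\<chi>i: "E.is_char (\<chi>i i)" for i
    using R_pow[OF \<chi>_R] \<chi>_S
    by (auto simp: E.is_char_def \<chi>i_def \<chi>_one \<chi>_mult E.S.nat_pow_distrib R_inv[symmetric])
  define \<chi>' where "\<chi>' = (\<lambda>h. \<chi> (inv\<^bsub>G\<^esub> h))"
  have \<chi>_inv: "\<chi>' h \<otimes>\<^bsub>S\<^esub> \<chi> h = \<one>\<^bsub>S\<^esub>" if "h \<in> carrier G" for h
    using \<chi>_mult[of "inv\<^bsub>G\<^esub> h" h] that by (simp add: \<chi>'_def \<chi>_one)
  have char_\<chi>': "E.is_char \<chi>'"
    using \<chi>_R \<chi>_S
    by (auto simp: E.is_char_def \<chi>'_def \<chi>_one \<chi>_mult E.G.inv_mult_group R_inv[symmetric] E.S.m_comm)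
  have Q_comp: "Q i = E.component (\<chi>i i)" for i
    by (auto simp: Q char_component_def E.component_def partial_char_def \<chi>i_def \<beta>_app \<beta>_one)
  have Q0: "Q 0 = R" by (simp add: Q_comp \<chi>i_def E.component_one R_inv)

  obtain a b where a: "\<And>i. i \<in> {1..l} \<Longrightarrow> a i \<in> E.component (\<chi>i 1)"
    and b: "\<And>i. i \<in> {1..l} \<Longrightarrow> b i \<in> E.component \<chi>'"
    and ab: "(\<Oplus>\<^bsub>S\<^esub>i\<in>{1..l}. a i \<otimes>\<^bsub>S\<^esub> b i) = \<one>\<^bsub>S\<^esub>"
  proof (rule E.component_dual[OF _ x y xy \<beta>_id _ char_\<chi>i[of 1] char_\<chi>'])
    show "\<chi>i 1 (inv\<^bsub>G\<^esub> h) = \<chi>' h" if "h \<in> carrier G" for h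
      using that \<chi>_S by (simp add: \<chi>i_def \<chi>'_def)
  qed (use R_subring R_inv in auto)

  interpret P: subring_submodule S R "Q 1"
  proof (intro subring_submodule.intro subring_submodule_axioms.intro)
    show "cring S" by (rule E.S.is_cring)
    show "subring R S" by (rule R_subring)
    show "Q 1 \<subseteq> carrier S" using E.component_carrier Q_comp by auto
    show "\<zero>\<^bsub>S\<^esub> \<in> Q 1" unfolding Q_comp by (rule E.component_zero[OF char_\<chi>i])
    show "x \<oplus>\<^bsub>S\<^esub> y \<in> Q 1" if "x \<in> Q 1" "y \<in> Q 1" for x y
      using that unfolding Q_comp by (rule E.component_add[OF char_\<chi>i])
    show "r \<otimes>\<^bsub>S\<^esub> x \<in> Q 1" if "r \<in> R" "x \<in> Q 1" for r x
      using that unfolding Q_comp R_inv by (rule E.component_smult[OF char_\<chi>i])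
  qed
  interpret SRM: module "S\<lparr>carrier := R\<rparr>" "mult_module S (carrier S)" by (rule P.SR_module)
  have Q_submodule: "submodule (Q i) (S\<lparr>carrier := R\<rparr>) (mult_module S (carrier S))" for i
    unfolding Q_comp
    by (rule SRM.submoduleI') (auto simp: E.component_carrier E.component_zero[OF char_\<chi>i]
      E.component_add[OF char_\<chi>i] E.component_smult[OF char_\<chi>i] R_inv)
  interpret W: invertible_powers S R "Q 1" Q "{1..l}" a b
  proof (intro invertible_powers.intro invertible_powers_axioms.intro)
    show "subring_submodule S R (Q 1)" by (rule P.subring_submodule_axioms)
    show "Q (Suc 0) = Q 1" by simp
    show "p \<otimes>\<^bsub>S\<^esub> q \<in> Q (Suc i)" if "p \<in> Q 1" "q \<in> Q i" for p q i
      using that unfolding Q_comp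
      by (rule E.component_mult[OF char_\<chi>i char_\<chi>i]) (simp add: \<chi>i_def \<chi>_S E.S.m_comm)
    show "b s \<otimes>\<^bsub>S\<^esub> q \<in> Q i" if "s \<in> {1..l}" "q \<in> Q (Suc i)" for s q i
      using b[OF that(1)] that(2) unfolding Q_comp
    proof (rule E.component_mult[OF char_\<chi>' char_\<chi>i])
      fix h assume h: "h \<in> carrier G"
      have "\<chi>' h \<otimes>\<^bsub>S\<^esub> (\<chi> h [^]\<^bsub>S\<^esub> i \<otimes>\<^bsub>S\<^esub> \<chi> h) = \<chi>' h \<otimes>\<^bsub>S\<^esub> \<chi> h \<otimes>\<^bsub>S\<^esub> \<chi> h [^]\<^bsub>S\<^esub> i"
        using h \<chi>_S by (simp add: \<chi>'_def E.S.m_ac)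
      then show "\<chi>' h \<otimes>\<^bsub>S\<^esub> \<chi>i (Suc i) h = \<chi>i i h" using h \<chi>_S by (simp add: \<chi>i_def \<chi>_inv)
    qed
    show "a s \<in> Q 1" if "s \<in> {1..l}" for s using a[OF that] by (simp add: Q_comp)
    show "b s \<in> carrier S" if "s \<in> {1..l}" for s by (rule E.component_carrier[OF b[OF that]])
  qed (use Q0 Q_submodule ab in auto)

  have fin: "finite I" using I finite_subset by (auto simp: saturated_def)
  have SQ_carrier: "carrier SQ = carrier (direct_sum (tensor_power RR QM) I)"
    by (simp add: SQ radical_extension_def)
  have SQ_ops: "u \<oplus>\<^bsub>SQ\<^esub> v = u \<oplus>\<^bsub>direct_sum (tensor_power RR QM) I\<^esub> v"
    "r \<odot>\<^bsub>SQ\<^esub> u = r \<odot>\<^bsub>direct_sum (tensor_power RR QM) I\<^esub> u" for u v r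
    by (simp_all add: SQ radical_extension_def)
  \<comment> \<open>Both implications of the claim reduce to the bijectivity of the map.\<close>
  have sum_iff: "internal_direct_sum RR SR I Q \<longleftrightarrow>
      bij_betw (lambda_map S R I) (carrier SQ) (carrier SR)"
    using W.lambda_map_bij_iff[OF fin] fin Q_submodule
    by (simp add: internal_direct_sum_def SQ_carrier SR RR QM)
  have iso: "lambda_map S R I \<in> module_iso RR SQ SR"
    if "bij_betw (lambda_map S R I) (carrier SQ) (carrier SR)"
    using that linear_mapD(2,3)[OF P.lambda_map_linear[OF fin]]
    by (simp add: module_iso_def SQ_carrier SQ_ops RR QM SR)
  have graded: "graded_map (tensor_power RR QM) I Q (lambda_map S R I)"
    unfolding graded_map_def
  proof
    fix i assume i: "i \<in> I"
    have "lambda_map S R I ` ds_inj (tensor_power RR QM) i ` carrier (tensor_power RR QM i) =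
        mult_map S R ` carrier (tensor_power RR QM i)"
      unfolding image_image RR QM by (rule image_cong[OF refl P.lambda_map_inj[OF fin i]])
    then show "lambda_map S R I ` ds_inj (tensor_power RR QM) i ` carrier (tensor_power RR QM i) = Q i"
      using W.mult_map_image by (simp add: RR QM)
  qed
  have \<phi>_linear: "\<phi> \<in> linear_map (S\<lparr>carrier := R\<rparr>) (tensor_power (S\<lparr>carrier := R\<rparr>) (mult_module S (Q 1)) n) (mult_module S R)"
    using \<phi> by (auto simp: module_iso_def linear_map_def RR QM bij_betw_def)
  have algebra: "lambda_map S R I \<in> algebra_iso RR SQ SR"
    if bij: "bij_betw (lambda_map S R I) (carrier SQ) (carrier SR)"
      and comp: "I = {0} \<or>
        (\<forall>as. length as = n \<and> set as \<subseteq> Q 1 \<longrightarrow> \<phi> (pure_tensor RR QM as) = list_prod S as)"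
  proof -
    have comp': "I = {0} \<or> P.mult_compatible n \<phi>"
      using comp unfolding P.mult_compatible_def by (auto simp: tensor_words_iff RR QM)
    have "lambda_map S R I \<in> ring_hom SQ SR"
      using P.lambda_map_ring_hom[OF \<phi>_linear I _ comp'] n by (simp add: SQ RR QM SR)
    then show ?thesis using bij iso by (simp add: algebra_iso_def ring_iso_def)
  qed
  show ?thesis
    using sum_iff iso graded algebra by (auto simp: algebra_iso_def ring_iso_def)
qed

end
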